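(* Let $\mathrm{H}^n$ be the $n$-dimensional discrete Heisenberg group equipped with the restriction of the metric $d$ described in the context, and let $B_k=\{p\in\mathrm{H}^n : d(p,0)\le k\}$ for $k\in\mathbb{N}$. Then for every non-singular ergodic action of $\mathrm{H}^n$ on a standard probability space $(X,\mathcal{B},\mu)$ and every $f\in L^1(\mu)$, $$\lim_{k\to\infty}\frac{\sum_{g\in B_k}\hat g f}{\sum_{g\in B_k}\hat g 1}=\int f\,d\mu\qquad\mu\text{-almost everywhere.}$$
   Context: The continuous Heisenberg group $\mathbb{H}^n$ is the set $\mathbb{C}^n\times\mathbb{R}$ with product $(z,\tau)\cdot(w,\sigma)=(z+w,\ \tau+\sigma+\tfrac12\operatorname{Im}\langle z,w\rangle)$, where $\langle z,w\rangle=\sum_{j=1}^n\overline{z_j}w_j$; its identity is $0=(0,0)$. The discrete Heisenberg group $\mathrm{H}^n$ is the subgroup generated by the elements $(e_j,0)$ and $(ie_j,0)$, $j=1,\dots,n$; as a set $\mathrm{H}^n=\{(z,\tau): z\in\mathbb{Z}^n+i\mathbb{Z}^n,\ \tau\in\tfrac12\langle \operatorname{Re} z,\operatorname{Im} z\rangle_{\mathbb{R}^n}+\mathbb{Z}\}$. Dilations are $\delta_\lambda(z,\tau)=(\lambda z,\lambda^2\tau)$ for $\lambda>0$. The metric is $d(p,q)=\inf\{r>0:\delta_{1/r}(pq^{-1})\in B_{eucl}\}$, where $B_{eucl}$ is the closed Euclidean unit ball of $\mathbb{C}^n\times\mathbb{R}\cong\mathbb{R}^{2n+1}$; explicitly,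 for $p=(z,\tau)$, $q=(w,\sigma)$, $d(p,q)=\frac{1}{\sqrt2}\big(\|z-w\|^2+\sqrt{\|z-w\|^4+4(\tau-\sigma-\tfrac12\operatorname{Im}\langle z,w\rangle)^2}\big)^{1/2}$. A non-singular action of a countable group $G$ on $(X,\mathcal{B},\mu)$ is an action by measurable bijections $x\mapsto gx$ such that $\mu\circ g$ and $\mu$ have the same null sets; $\omega_g=\frac{d(\mu\circ g)}{d\mu}$ and for $f\in L^1$, $\hat g f(x)=f(gx)\omega_g(x)$. Ergodic means every $G$-invariant measurable set is null or conull. *)

theory Defs
  imports "HOL-Probability.Probability"
begin

type_synonym 'n heis = "(complex ^ 'n) \<times> real"

definition cinner :: "complex ^ 'n \<Rightarrow> complex ^ 'n \<Rightarrow> complex" where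
  "cinner z w = (\<Sum>j\<in>UNIV. cnj (z $ j) * w $ j)"

definition heis_mult :: "'n::finite heis \<Rightarrow> 'n heis \<Rightarrow> 'n heis" where
  "heis_mult p q = (fst p + fst q, snd p + snd q + Im (cinner (fst p) (fst q)) / 2)"

definition heis_zero :: "'n::finite heis" where
  "heis_zero = (0, 0)"

definition heis_inv :: "'n::finite heis \<Rightarrow> 'n heis" where
  "heis_inv p = (- fst p, - snd p)"

definition discrete_heis :: "'n::finite heis set" where
  "discrete_heis = {(z, \<tau>). (\<forall>j. Re (z $ j) \<in> \<int> \<and> Im (z $ j) \<in> \<int>) \<and>
      \<tau> - (\<Sum>j\<in>UNIV. Re (z $ j) * Im (z $ j)) / 2 \<in> \<int>}"

definition heis_dist :: "'n::finite heis \<Rightarrow> 'n heis \<Rightarrow> real" where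
  "heis_dist p q = (let z = fst p; \<tau> = snd p; w = fst q; \<sigma> = snd q in
     (1 / sqrt 2) * sqrt ((norm (z - w))\<^sup>2 +
        sqrt ((norm (z - w)) ^ 4 + 4 * (\<tau> - \<sigma> - Im (cinner z w) / 2)\<^sup>2)))"

definition heis_ball :: "nat \<Rightarrow> 'n::finite heis set" where
  "heis_ball k = {p \<in> discrete_heis. heis_dist p heis_zero \<le> real k}"

text \<open>Standard probability space: the measurable space is a standard Borel space,
  i.e. Borel isomorphic to a Borel subset of the reals (Kuratowski).\<close>
definition standard_borel_space :: "'x measure \<Rightarrow> bool" where
  "standard_borel_space M \<longleftrightarrow> (\<exists>(T::'x \<Rightarrow> real) A. A \<in> sets borel \<and>
      bij_betw T (space M) A \<and> sets M = {T -` B \<inter> space M | B. B \<in> sets borel})"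

definition nonsingular_heis_action :: "'x measure \<Rightarrow> ('n::finite heis \<Rightarrow> 'x \<Rightarrow> 'x) \<Rightarrow> bool" where
  "nonsingular_heis_action M act \<longleftrightarrow>
     (\<forall>g\<in>discrete_heis. act g \<in> M \<rightarrow>\<^sub>M M \<and> bij_betw (act g) (space M) (space M)) \<and>
     (\<forall>x\<in>space M. act heis_zero x = x) \<and>
     (\<forall>g\<in>discrete_heis. \<forall>h\<in>discrete_heis. \<forall>x\<in>space M.
         act (heis_mult g h) x = act g (act h x)) \<and>
     (\<forall>g\<in>discrete_heis. \<forall>A\<in>sets M. emeasure M (act g ` A) = 0 \<longleftrightarrow> emeasure M A = 0)"

definition ergodic_heis_action :: "'x measure \<Rightarrow> ('n::finite heis \<Rightarrow> 'x \<Rightarrow> 'x) \<Rightarrow> bool" where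
  "ergodic_heis_action M act \<longleftrightarrow>
     (\<forall>A\<in>sets M. (\<forall>g\<in>discrete_heis. act g -` A \<inter> space M = A) \<longrightarrow>
        emeasure M A = 0 \<or> emeasure M (space M - A) = 0)"

text \<open>omega_g = d(mu o g)/d mu, where (mu o g)(A) = mu(g A) = (distr M M (act g^-1)) A.\<close>
definition heis_omega :: "'x measure \<Rightarrow> ('n::finite heis \<Rightarrow> 'x \<Rightarrow> 'x) \<Rightarrow> 'n heis \<Rightarrow> 'x \<Rightarrow> real" where
  "heis_omega M act g x = enn2real (RN_deriv M (distr M M (act (heis_inv g))) x)"

definition heis_hat :: "'x measure \<Rightarrow> ('n::finite heis \<Rightarrow> 'x \<Rightarrow> 'x) \<Rightarrow> 'n heis \<Rightarrow> ('x \<Rightarrow> real) \<Rightarrow> 'x \<Rightarrow> real" where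
  "heis_hat M act g f x = f (act g x) * heis_omega M act g x"

end

theory Submission
  imports Defs "HOL-Real_Asymp.Real_Asymp"
begin

text \<open>
  Write \<open>\<nu> g\<close> for the Radon-Nikodym cocycle at a point, seen as a measure on the group. The squared gauge
  \<open>gauge2\<close> makes the distance right-invariant, and the metric has the Besicovitch covering property,
  which transfers to a maximal inequality for the ratios. So it suffices to treat a dense class. Constants
  are trivial, and a coboundary \<open>h (u x) \<omega>\<^sub>u x - h x\<close> sums over a ball to a term supported on a thin shell;
  by ergodicity, functions of integral zero are limits of sums of coboundaries (mass transport along the
  orbits).

  The core is that shells carry a vanishing proportion of the \<open>\<nu>\<close>-mass of the balls. Shells are
  \<open>\<bar>d\<^sup>2 - k\<^sup>2\<bar> \<le> t (\<bar>z\<bar> + t)\<close>, thinner near the poles than metric annuli. A single estimate on crowded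
  configurations bounds both the overlap of balls and the number of nested shells, with centres on the
  previous ones, through a common point. If a set of points had heavy shells at many
  scales, then covering it at each scale would produce disjoint masses outside the shells already used, up
  to a loss controlled by induction on the length of the nested chains; too many scales give a
  contradiction.
\<close>

section \<open>The squared gauge\<close>

text \<open>The metric is invariant on the right, whereas coboundaries translate balls on the left.
  A displacement of length s changes d^2 by O(s (|z| + s)), and this dictates the thickness of the
  shells. Their slimness near the vertical axis is essential: a narrow cone can hold two points of a
  crowd, and a third is excluded only because the slack is measured by horizontal parts. The same
  perturbation estimate stands in for the triangle inequality of d. The induction on chains works
  because the part of a set near a chosen shell lies on one more shell of the chain, and more than N
  nested shells have no common point. Scales grow by factors of 10000, so neighbourhoods formed at
  lower levels are negligible against the radii of the next one. The number of levels must not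
  depend on the weight: it is fixed before the scales are chosen, and the estimate is then read
  along every orbit.\<close>

lemma Im_cinner: "Im (cinner z w) = inner (\<chi> j. \<i> * z $ j) w"
  by (simp add: cinner_def inner_vec_def inner_complex_def sum_subtractf algebra_simps)

lemma norm_cinner_rotate: "norm (\<chi> j. \<i> * (z::complex^'n::finite) $ j) = norm z"
  by (simp add: norm_vec_def norm_mult)

lemma abs_Im_cinner_le: "\<bar>Im (cinner z w)\<bar> \<le> norm z * norm w"
  using Cauchy_Schwarz_ineq2[of "\<chi> j. \<i> * z $ j" w] by (simp add: Im_cinner norm_cinner_rotate)

lemma Im_cinner_self [simp]: "Im (cinner z z) = 0"
  by (simp add: cinner_def algebra_simps)

lemma Im_cinner_minus: "Im (cinner w z) = - Im (cinner z w)"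
  by (simp add: cinner_def algebra_simps sum_negf[symmetric] del: sum_negf)

lemma Im_cinner_bilinear [simp]:
  "Im (cinner (z + z') w) = Im (cinner z w) + Im (cinner z' w)"
  "Im (cinner z (w + w')) = Im (cinner z w) + Im (cinner z w')"
  "Im (cinner (z - z') w) = Im (cinner z w) - Im (cinner z' w)"
  "Im (cinner z (w - w')) = Im (cinner z w) - Im (cinner z w')"
  "Im (cinner (- z) w) = - Im (cinner z w)"
  "Im (cinner z (- w)) = - Im (cinner z w)"
  "Im (cinner 0 w) = 0" "Im (cinner z 0) = 0"
  "Im (cinner (a *\<^sub>R z) w) = a * Im (cinner z w)"
  "Im (cinner z (a *\<^sub>R w)) = a * Im (cinner z w)"
  by (simp_all add: cinner_def algebra_simps sum.distrib sum_subtractf sum_negf sum_distrib_left)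

text \<open>The squared distance to the identity. It is the larger root R of R^2 = |z|^2 R +
  \<tau>^2, the equation that puts the point on a dilated Euclidean unit sphere; squares keep ball
  conditions polynomial.\<close>

definition gauge2 :: "'n::finite heis \<Rightarrow> real" where
  "gauge2 p = ((norm (fst p))\<^sup>2 + sqrt ((norm (fst p)) ^ 4 + 4 * (snd p)\<^sup>2)) / 2"

definition hdist2 :: "'n::finite heis \<Rightarrow> 'n heis \<Rightarrow> real" where
  "hdist2 p q = gauge2 (heis_mult p (heis_inv q))"

text \<open>The horizontal distance, a pseudometric. It controls how strongly \<open>hdist2\<close>
  reacts when a point is moved.\<close>

definition hgap :: "'n::finite heis \<Rightarrow> 'n heis \<Rightarrow> real" where
  "hgap p q = norm (fst p - fst q)"

section \<open>Group laws, right invariance and perturbation of the gauge\<close>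

lemma heis_mult_assoc: "heis_mult (heis_mult p q) r = heis_mult p (heis_mult q r)"
  by (simp add: heis_mult_def algebra_simps add_divide_distrib)

lemma heis_mult_zero [simp]: "heis_mult p heis_zero = p" "heis_mult heis_zero p = p"
  by (simp_all add: heis_mult_def heis_zero_def)

lemma heis_mult_inv [simp]: "heis_mult p (heis_inv p) = heis_zero" "heis_mult (heis_inv p) p = heis_zero"
  by (simp_all add: heis_mult_def heis_zero_def heis_inv_def)

lemma heis_mult_inv_cancel [simp]:
  "heis_mult (heis_inv p) (heis_mult p q) = q" "heis_mult p (heis_mult (heis_inv p) q) = q"
  by (simp_all flip: heis_mult_assoc)

lemma heis_mult_inv_cancel_right [simp]:
  "heis_mult (heis_mult q p) (heis_inv p) = q" "heis_mult (heis_mult q (heis_inv p)) p = q"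
  by (simp_all add: heis_mult_assoc)

lemma heis_inv_inv [simp]: "heis_inv (heis_inv p) = p" "heis_inv heis_zero = heis_zero"
  by (simp_all add: heis_inv_def heis_zero_def)

lemma heis_inv_mult: "heis_inv (heis_mult p q) = heis_mult (heis_inv q) (heis_inv p)"
  using Im_cinner_minus[of "fst p" "fst q"] by (simp add: heis_mult_def heis_inv_def)

lemma hdist2_right_invariant [simp]: "hdist2 (heis_mult p g) (heis_mult q g) = hdist2 p q"
  by (simp add: hdist2_def heis_inv_mult flip: heis_mult_assoc)

lemma hgap_right_invariant [simp]: "hgap (heis_mult p g) (heis_mult q g) = hgap p q"
  by (simp add: hgap_def heis_mult_def)

lemma gauge2_inv: "gauge2 (heis_inv p) = gauge2 p"
  by (simp add: gauge2_def heis_inv_def)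

lemma hdist2_commute: "hdist2 p q = hdist2 q p"
proof -
  have "heis_mult p (heis_inv q) = heis_inv (heis_mult q (heis_inv p))" by (simp add: heis_inv_mult)
  then show ?thesis unfolding hdist2_def by (metis gauge2_inv)
qed

lemma hgap_commute: "hgap p q = hgap q p"
  by (simp add: hgap_def norm_minus_commute)

lemma hgap_triangle: "hgap p r \<le> hgap p q + hgap q r"
  unfolding hgap_def using norm_triangle_ineq[of "fst p - fst q" "fst q - fst r"] by simp

lemma hgap_nonneg [simp]: "0 \<le> hgap p q"
  by (simp add: hgap_def)

lemma hdist2_zero [simp]: "hdist2 p heis_zero = gauge2 p"
  by (simp add: hdist2_def)

lemma hgap_zero [simp]: "hgap p heis_zero = norm (fst p)"
  by (simp add: hgap_def heis_zero_def)

lemma gauge2_zero [simp]: "gauge2 heis_zero = 0"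
  by (simp add: gauge2_def heis_zero_def)

lemma hdist2_self [simp]: "hdist2 p p = 0"
  by (simp add: hdist2_def)

lemma gauge2_ge_norm: "(norm (fst p))\<^sup>2 \<le> gauge2 p"
proof -
  have "(norm (fst p))\<^sup>2 = sqrt (norm (fst p) ^ 4)"
    by (rule real_sqrt_unique[symmetric]) (simp_all flip: power_mult)
  also have "\<dots> \<le> sqrt ((norm (fst p)) ^ 4 + 4 * (snd p)\<^sup>2)" by (intro real_sqrt_le_mono) simp
  finally show ?thesis by (simp add: gauge2_def)
qed

lemma gauge2_ge_height: "\<bar>snd p\<bar> \<le> gauge2 p"
proof -
  have "2 * \<bar>snd p\<bar> = sqrt (4 * (snd p)\<^sup>2)" by (simp add: real_sqrt_mult)
  also have "\<dots> \<le> sqrt ((norm (fst p)) ^ 4 + 4 * (snd p)\<^sup>2)" by (intro real_sqrt_le_mono) simp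
  finally show ?thesis by (simp add: gauge2_def add_increasing)
qed

lemma gauge2_nonneg [simp]: "0 \<le> gauge2 p"
  using gauge2_ge_height[of p] by simp

lemma hdist2_nonneg [simp]: "0 \<le> hdist2 p q"
  by (simp add: hdist2_def)

lemma hgap_le_hdist2: "(hgap p q)\<^sup>2 \<le> hdist2 p q"
  using gauge2_ge_norm[of "heis_mult p (heis_inv q)"]
  by (simp add: hgap_def hdist2_def heis_mult_def heis_inv_def)

lemma hgap_le_sqrt_hdist2: "hgap p q \<le> sqrt (hdist2 p q)"
  using hgap_le_hdist2 real_le_rsqrt by blast

lemma gauge2_quadratic: "(gauge2 p)\<^sup>2 = (norm (fst p))\<^sup>2 * gauge2 p + (snd p)\<^sup>2"
proof -
  let ?A = "(norm (fst p))\<^sup>2"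
  let ?S = "sqrt ((norm (fst p)) ^ 4 + 4 * (snd p)\<^sup>2)"
  have S: "?S\<^sup>2 = ?A\<^sup>2 + 4 * (snd p)\<^sup>2" by (simp flip: power_mult)
  have "(gauge2 p)\<^sup>2 = (?A\<^sup>2 + 2 * ?A * ?S + ?S\<^sup>2) / 4"
    by (simp add: gauge2_def power2_eq_square field_simps)
  also have "\<dots> = ?A * gauge2 p + (snd p)\<^sup>2"
    unfolding S by (simp add: gauge2_def power2_eq_square field_simps)
  finally show ?thesis .
qed

text \<open>The gauge is |z|^2 / 2 plus the modulus of the complex number with real part |z|^2 / 2
  and imaginary part the height, so the triangle inequality of the complex plane applies.\<close>

lemma gauge2_lipschitz:
  fixes p q :: "'n::finite heis"
  shows
  "\<bar>gauge2 p - gauge2 q\<bar> \<le> \<bar>(norm (fst p))\<^sup>2 - (norm (fst q))\<^sup>2\<bar> + \<bar>snd p - snd q\<bar>"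
proof -
  let ?c = "\<lambda>p::'n heis. Complex ((norm (fst p))\<^sup>2 / 2) (snd p)"
  have g: "gauge2 p = (norm (fst p))\<^sup>2 / 2 + norm (?c p)" for p :: "'n heis"
  proof -
    have "norm (?c p) = sqrt (((norm (fst p)) ^ 4 + 4 * (snd p)\<^sup>2) / 4)"
      by (simp add: cmod_def power_divide flip: power_mult) 
    then show ?thesis by (simp add: gauge2_def real_sqrt_divide field_simps)
  qed
  have "\<bar>norm (?c p) - norm (?c q)\<bar> \<le> norm (?c p - ?c q)" by (rule norm_triangle_ineq3)
  also have "\<dots> \<le> \<bar>Re (?c p - ?c q)\<bar> + \<bar>Im (?c p - ?c q)\<bar>" by (rule cmod_le)
  also have "\<dots> = \<bar>(norm (fst p))\<^sup>2 - (norm (fst q))\<^sup>2\<bar> / 2 + \<bar>snd p - snd q\<bar>"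
    by (simp flip: diff_divide_distrib)
  finally have "\<bar>norm (?c p) - norm (?c q)\<bar>
      \<le> \<bar>(norm (fst p))\<^sup>2 - (norm (fst q))\<^sup>2\<bar> / 2 + \<bar>snd p - snd q\<bar>" .
  moreover have "\<bar>m - n\<bar> \<le> \<bar>A - B\<bar> / 2 + t \<Longrightarrow> \<bar>A / 2 + m - (B / 2 + n)\<bar> \<le> \<bar>A - B\<bar> + t"
    for m n A B t :: real
  proof -
    assume "\<bar>m - n\<bar> \<le> \<bar>A - B\<bar> / 2 + t"
    moreover have "\<bar>(A - B) / 2 + (m - n)\<bar> \<le> \<bar>A - B\<bar> / 2 + \<bar>m - n\<bar>"
      using abs_triangle_ineq[of "(A - B) / 2" "m - n"] by simp
    moreover have "A / 2 + m - (B / 2 + n) = (A - B) / 2 + (m - n)" by (simp add: field_simps)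
    ultimately show ?thesis by linarith
  qed
  ultimately show ?thesis unfolding g by blast
qed

text \<open>By right invariance, left multiplication by \<open>u\<close> displaces \<open>a\<close>
  by at most \<open>s\<close>. It changes |z|^2 by at most 2 s |z| + s^2 and the height by at most
  s^2 + s |z| / 2; no term involves the full radius of \<open>a\<close>. This is the origin of the
  thickness of shells and of the constant 3.\<close>

lemma gauge2_mult_left:
  assumes s: "0 \<le> s" "gauge2 u \<le> s\<^sup>2"
  shows "\<bar>gauge2 (heis_mult u a) - gauge2 a\<bar> \<le> 3 * s * (norm (fst a) + s)"
proof -
  let ?z = "norm (fst a)" and ?w = "norm (fst u)"
  have w: "?w \<le> s" using gauge2_ge_norm[of u] s by (meson norm_ge_zero order_trans power2_le_imp_le)
  have t: "\<bar>snd u\<bar> \<le> s\<^sup>2" using gauge2_ge_height[of u] s by linarith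
  have e: "(norm (fst u + fst a))\<^sup>2 = ?w\<^sup>2 + 2 * inner (fst u) (fst a) + ?z\<^sup>2"
    by (simp add: power2_norm_eq_inner inner_add_left inner_add_right inner_commute)
  have "\<bar>inner (fst u) (fst a)\<bar> \<le> ?w * ?z" by (rule Cauchy_Schwarz_ineq2)
  also have "\<dots> \<le> s * ?z" using w by (simp add: mult_right_mono)
  finally have i: "\<bar>inner (fst u) (fst a)\<bar> \<le> s * ?z" .
  have "\<bar>Im (cinner (fst u) (fst a))\<bar> \<le> ?w * ?z" by (rule abs_Im_cinner_le)
  also have "\<dots> \<le> s * ?z" using w by (simp add: mult_right_mono)
  finally have j: "\<bar>Im (cinner (fst u) (fst a))\<bar> \<le> s * ?z" .
  have w2: "?w\<^sup>2 \<le> s\<^sup>2" using w by (simp add: power_mono)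
  have "\<bar>gauge2 (heis_mult u a) - gauge2 a\<bar>
      \<le> \<bar>(norm (fst u + fst a))\<^sup>2 - ?z\<^sup>2\<bar> + \<bar>snd u + Im (cinner (fst u) (fst a)) / 2\<bar>"
    using gauge2_lipschitz[of "heis_mult u a" a] by (simp add: heis_mult_def)
  also have "\<dots> \<le> (?w\<^sup>2 + 2 * (s * ?z)) + (s\<^sup>2 + s * ?z / 2)"
    unfolding e using i j t zero_le_power2[of ?w] by linarith
  also have "\<dots> \<le> 3 * s * (?z + s)"
  proof -
    have "0 \<le> s * ?z" using s(1) by simp
    moreover have "3 * s * (?z + s) = 3 * (s * ?z) + 3 * s\<^sup>2" by (simp add: algebra_simps power2_eq_square)
    ultimately show ?thesis using w2 zero_le_power2[of s] by linarith
  qed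
  finally show ?thesis .
qed

text \<open>Moving from \<open>p\<close> to \<open>p'\<close> is left multiplication by
  \<open>heis_mult p' (heis_inv p)\<close>, whose gauge is the squared distance of the two
  points.\<close>

lemma hdist2_perturb:
  assumes "0 \<le> s" "hdist2 p p' \<le> s\<^sup>2"
  shows "\<bar>hdist2 p' x - hdist2 p x\<bar> \<le> 3 * s * (hgap p x + s)"
proof -
  let ?u = "heis_mult p' (heis_inv p)" and ?a = "heis_mult p (heis_inv x)"
  have "heis_mult ?u ?a = heis_mult p' (heis_inv x)" by (simp add: heis_mult_assoc)
  moreover have "gauge2 ?u \<le> s\<^sup>2" using assms(2) hdist2_commute[of p p'] by (simp add: hdist2_def)
  ultimately show ?thesis using gauge2_mult_left[OF assms(1), of ?u ?a]
    by (simp add: hdist2_def) (simp add: hgap_def heis_mult_def heis_inv_def)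
qed

lemma hgap_perturb:
  assumes "0 \<le> s" "hdist2 p p' \<le> s\<^sup>2"
  shows "hgap p x \<le> hgap p' x + s"
proof -
  have "hgap p p' \<le> s" using hgap_le_hdist2[of p p'] assms by (meson hgap_nonneg order_trans power2_le_imp_le)
  then show ?thesis using hgap_triangle[of p x p'] by simp
qed

lemma heis_dist_zero_le: "heis_dist p heis_zero \<le> real k \<longleftrightarrow> gauge2 p \<le> (real k)\<^sup>2"
proof -
  have "heis_dist p heis_zero = sqrt (gauge2 p)"
    by (simp add: heis_dist_def gauge2_def heis_zero_def Let_def real_sqrt_divide)
  then show ?thesis by (metis of_nat_0_le_iff real_sqrt_abs real_sqrt_le_iff abs_of_nonneg)
qed

section \<open>Crowded configurations\<close>

text \<open>Two points are dilated onto the unit sphere: \<alpha>, \<beta> are their horizontal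
  sizes, \<theta>, \<phi> their heights, s is the ratio of the smaller to the larger radius,
  \<kappa> the slack relative to the smaller radius, and \<rho>, \<iota> are the normalised real
  inner product and symplectic form. Without slack the assumptions contradict each other, which is
  the covering property; with slack only pairs survive whose nearer point is almost vertical and
  much nearer.\<close>

lemma cone_core:
  fixes \<alpha> \<beta> \<theta> \<phi> s \<kappa> \<iota> \<rho> :: real
  assumes unit: "\<alpha>\<^sup>2 + \<theta>\<^sup>2 = 1" "\<beta>\<^sup>2 + \<phi>\<^sup>2 = 1"
    and pos: "0 \<le> \<alpha>" "0 \<le> \<beta>" "0 < s" "s \<le> 1" "0 \<le> \<kappa>" "\<kappa> \<le> 1/40"
    and close: "\<bar>\<alpha> - \<beta>\<bar> \<le> 1/100" "\<bar>\<theta> - \<phi>\<bar> \<le> 1/100"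
    and cone: "99/100 * (\<alpha> * \<beta>) \<le> \<rho>" "\<bar>\<iota>\<bar> \<le> \<alpha> * \<beta> / 100"
    and main: "2 * \<rho> - s * \<beta>\<^sup>2 + \<theta> * (2 * s * \<phi> + \<iota>) - s * (s * \<phi> + \<iota> / 2)\<^sup>2 \<le> 2 * \<kappa> * (\<alpha> + s + s * \<kappa>)"
  shows "\<beta> \<le> 2 * \<kappa> \<and> s \<le> 10 * (\<kappa> * \<alpha>)"
proof -
  define P where "P = \<alpha> * \<beta>"
  have sq: "\<alpha>\<^sup>2 \<le> 1" "\<beta>\<^sup>2 \<le> 1" "\<theta>\<^sup>2 \<le> 1" "\<phi>\<^sup>2 \<le> 1"
    using unit zero_le_power2[of \<alpha>] zero_le_power2[of \<beta>] zero_le_power2[of \<theta>] zero_le_power2[of \<phi>] by linarith+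
  then have b: "\<alpha> \<le> 1" "\<beta> \<le> 1" "\<bar>\<theta>\<bar> \<le> 1" "\<bar>\<phi>\<bar> \<le> 1"
    by (metis abs_le_D1 abs_square_le_1)+
  have P: "0 \<le> P" "P \<le> 1" using pos b by (auto simp: P_def mult_le_one)
  have i: "\<bar>\<iota>\<bar> \<le> P / 100" using cone by (simp add: P_def)
  have i1: "\<theta> * \<iota> \<ge> - (P / 100)"
  proof -
    have "\<bar>\<theta> * \<iota>\<bar> \<le> 1 * \<bar>\<iota>\<bar>" unfolding abs_mult using b by (intro mult_right_mono) auto
    then show ?thesis using i by linarith
  qed
  have i2: "s * (s * \<phi> + \<iota> / 2)\<^sup>2 \<le> s * \<phi>\<^sup>2 + P / 100 + P / 400"
  proof -
    have "s * (s * \<phi> + \<iota> / 2)\<^sup>2 = s * (s\<^sup>2 * \<phi>\<^sup>2) + (s\<^sup>2 * \<phi>) * \<iota> + (s * \<iota> / 4) * \<iota>"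
      by (simp add: power2_eq_square algebra_simps)
    moreover have "s * (s\<^sup>2 * \<phi>\<^sup>2) \<le> s * (1 * \<phi>\<^sup>2)"
      using pos by (intro mult_left_mono mult_right_mono) (auto simp: power_le_one)
    moreover have "\<bar>(s\<^sup>2 * \<phi>) * \<iota>\<bar> \<le> 1 * \<bar>\<iota>\<bar>"
      unfolding abs_mult[of "s\<^sup>2 * \<phi>"] using pos b by (intro mult_right_mono) (auto simp: abs_mult mult_le_one power_le_one)
    moreover have "\<bar>(s * \<iota> / 4) * \<iota>\<bar> \<le> (1/4) * \<bar>\<iota>\<bar>"
    proof -
      have "\<bar>s * \<iota>\<bar> \<le> 1" unfolding abs_mult using pos i P by (intro mult_le_one) auto
      then show ?thesis unfolding abs_mult[of "s * \<iota> / 4"] by (intro mult_right_mono) auto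
    qed
    ultimately show ?thesis using i by linarith
  qed
  have d: "2 * \<theta> * \<phi> - \<phi>\<^sup>2 \<ge> \<theta>\<^sup>2 - 1/10000"
  proof -
    have "(\<theta> - \<phi>)\<^sup>2 \<le> (1/100)\<^sup>2" using close(2) by (simp add: abs_le_square_iff[symmetric])
    then show ?thesis by (simp add: power2_eq_square algebra_simps)
  qed
  have d2: "2 * (s * (\<theta> * \<phi>)) - s * \<phi>\<^sup>2 \<ge> s * \<theta>\<^sup>2 - s/10000"
    using mult_left_mono[OF d, of s] pos by (simp add: algebra_simps)
  have k: "2 * \<kappa> * (\<alpha> + s + s * \<kappa>) \<le> 2 * (\<kappa> * \<alpha>) + 4 * (\<kappa> * s)"
  proof -
    have "\<kappa> * s * \<kappa> \<le> \<kappa> * s * 1" using pos by (intro mult_left_mono) auto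
    then show ?thesis by (simp add: algebra_simps)
  qed
  have m: "2 * \<rho> - s * \<beta>\<^sup>2 + 2 * (s * (\<theta> * \<phi>)) + \<theta> * \<iota> - s * (s * \<phi> + \<iota> / 2)\<^sup>2 \<le> 2 * \<kappa> * (\<alpha> + s + s * \<kappa>)"
    using main by (simp add: algebra_simps)
  have r: "99/100 * P \<le> \<rho>" using cone(1) by (simp add: P_def)
  \<comment> \<open>The coefficient is 2 * 99/100 minus the errors 1/100 and 1/100 + 1/400 caused by
    \<iota>, rounded down.\<close>
  have key: "195/100 * P + (s * \<theta>\<^sup>2 - s * \<beta>\<^sup>2 - s / 10000) \<le> 2 * (\<kappa> * \<alpha>) + 4 * (\<kappa> * s)"
    using m i1 i2 d2 k r P by linarith
  have ks: "\<kappa> * s \<le> s / 40" using mult_right_mono[of \<kappa> "1/40" s] pos by simp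
  have ka: "\<kappa> * \<alpha> \<le> 1/40" using mult_mono[of \<kappa> "1/40" \<alpha> 1] pos b by simp
  have k0: "0 \<le> \<kappa> * \<alpha>" using pos by simp
  \<comment> \<open>Near the poles the term with \<open>s * \<theta>\<^sup>2\<close> dominates and
    yields both bounds. Away from them \<beta> exceeds 1/2 and the horizontal product
    \<open>P\<close> outweighs all other terms, which is impossible.\<close>
  show ?thesis
  proof (cases "\<phi>\<^sup>2 \<ge> 3/4")
    case True
    then have be: "\<beta>\<^sup>2 \<le> 1/4" using unit by simp
    have "\<bar>\<phi>\<bar> \<ge> 86/100"
    proof (rule ccontr)
      assume "\<not> ?thesis"
      then have "\<bar>\<phi>\<bar> < 86/100" by simp
      then have "\<bar>\<phi>\<bar>\<^sup>2 < (86/100)\<^sup>2" by (intro power_strict_mono) auto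
      with True show False by (simp add: power2_eq_square)
    qed
    then have "\<bar>\<theta>\<bar> \<ge> 85/100" using close by linarith
    then have "\<bar>\<theta>\<bar>\<^sup>2 \<ge> (85/100)\<^sup>2" by (intro power_mono) auto
    then have "\<theta>\<^sup>2 \<ge> 7/10" by (simp add: power2_eq_square)
    then have "s * \<theta>\<^sup>2 \<ge> s * (7/10)" using pos by (intro mult_left_mono) auto
    moreover have "s * \<beta>\<^sup>2 \<le> s * (1/4)" using pos be by (intro mult_left_mono) auto
    ultimately have e: "195/100 * P + 34/100 * s \<le> 2 * (\<kappa> * \<alpha>)"
      using key ks pos by linarith
    then have "s \<le> 10 * (\<kappa> * \<alpha>)" using P k0 by linarith
    moreover have "\<alpha> > 0" using e pos P by (cases "\<alpha> = 0") auto
    moreover have "\<alpha> * \<beta> \<le> \<alpha> * (2 * \<kappa>)"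
      using e pos P k0 unfolding P_def[symmetric] by (simp add: mult.commute mult.left_commute)
    ultimately show ?thesis using mult_le_cancel_left_pos by blast
  next
    case False
    then have "\<beta>\<^sup>2 > 1/4" using unit by simp
    then have "(1/2)\<^sup>2 < \<beta>\<^sup>2" by (simp add: power2_eq_square)
    then have b2: "\<beta> > 1/2" using pos power2_less_imp_less by blast
    have "P \<ge> (\<beta> - 1/100) * \<beta>" unfolding P_def using close(1)[unfolded abs_le_iff] pos by (intro mult_right_mono) auto
    then have "P \<ge> \<beta>\<^sup>2 - \<beta>/100" by (simp add: power2_eq_square algebra_simps)
    moreover have "s * \<theta>\<^sup>2 \<ge> 0" using pos by simp
    moreover have "s * \<beta>\<^sup>2 \<le> 1 * \<beta>\<^sup>2" using pos by (intro mult_right_mono) auto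
    moreover have "\<beta>\<^sup>2 \<ge> \<beta> / 2" using b2 by (simp add: power2_eq_square)
    ultimately have False using key ks ka pos b2 by linarith
    then show ?thesis ..
  qed
qed

text \<open>The distance \<open>q\<close> is the larger root of u^2 = A u + Y^2, so u^2 is at most A
  u + Y^2 for every u in (0, q]; u = R - g lies there unless it is nonpositive, a trivial case.
  Substituting the quadratic equation for \<open>gauge2 x\<close> leaves an inequality without
  square roots.\<close>

lemma gauge_defect_expand:
  assumes "gauge2 x - g \<le> hdist2 x y" "0 \<le> g"
  shows "gauge2 x * (2 * inner (fst x) (fst y) - (norm (fst y))\<^sup>2)
      + snd x * (2 * snd y + Im (cinner (fst x) (fst y)))
      - (snd y + Im (cinner (fst x) (fst y)) / 2)\<^sup>2 \<le> 2 * gauge2 x * g"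
proof -
  define R q A I where "R = gauge2 x" "q = hdist2 x y" "A = (norm (fst x - fst y))\<^sup>2"
    "I = Im (cinner (fst x) (fst y))"
  define Y where "Y = snd x - snd y - I / 2"
  note defs = \<open>R = _\<close> \<open>q = _\<close> \<open>A = _\<close> \<open>I = _\<close> \<open>Y = _\<close>
  have q: "q\<^sup>2 = A * q + Y\<^sup>2"
    using gauge2_quadratic[of "heis_mult x (heis_inv y)"]
    by (simp add: defs hdist2_def) (simp add: heis_mult_def heis_inv_def)
  have nn: "0 \<le> R" "0 \<le> q" "0 \<le> A" by (simp_all add: defs)
  have claim: "R\<^sup>2 \<le> A * R + Y\<^sup>2 + 2 * R * g"
  proof (cases "R \<le> g")
    case True
    have "R\<^sup>2 \<le> R * g" unfolding power2_eq_square using True nn by (intro mult_left_mono)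
    moreover have "0 \<le> R * g" "0 \<le> A * R" using nn assms by auto
    ultimately show ?thesis using zero_le_power2[of Y] by linarith
  next
    case False
    define u where "u = R - g"
    have u: "0 < u" "u \<le> q" "u \<le> R" using False assms by (simp_all add: u_def defs)
    have "u\<^sup>2 \<le> A * u + Y\<^sup>2"
    proof (rule ccontr)
      assume "\<not> ?thesis"
      then have c: "u * (u - A) > Y\<^sup>2" by (simp add: power2_eq_square algebra_simps)
      then have "u * (u - A) > 0" using zero_le_power2[of Y] by linarith
      then have "u - A > 0" using u by (simp add: zero_less_mult_iff)
      then have "u * (u - A) \<le> q * (q - A)" using u by (intro mult_mono) auto
      also have "\<dots> = Y\<^sup>2" using q by (simp add: power2_eq_square algebra_simps)
      finally show False using c by simp
    qed
    moreover have "A * u \<le> A * R" using u nn by (intro mult_left_mono) auto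
    moreover have "u\<^sup>2 = R\<^sup>2 - 2 * R * g + g\<^sup>2" by (simp add: u_def power2_eq_square algebra_simps)
    ultimately show ?thesis using zero_le_power2[of g] by linarith
  qed
  have "A = (norm (fst x))\<^sup>2 - 2 * inner (fst x) (fst y) + (norm (fst y))\<^sup>2"
    by (simp add: defs power2_norm_eq_inner inner_diff_left inner_diff_right inner_commute)
  moreover have "R\<^sup>2 = (norm (fst x))\<^sup>2 * R + (snd x)\<^sup>2" using gauge2_quadratic[of x] by (simp add: defs)
  ultimately have "R * (2 * inner (fst x) (fst y) - (norm (fst y))\<^sup>2) + (snd x)\<^sup>2 - Y\<^sup>2 \<le> 2 * R * g"
  proof -
    assume A: "A = (norm (fst x))\<^sup>2 - 2 * inner (fst x) (fst y) + (norm (fst y))\<^sup>2"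
      and R: "R\<^sup>2 = (norm (fst x))\<^sup>2 * R + (snd x)\<^sup>2"
    show ?thesis using claim unfolding R unfolding A by (simp add: algebra_simps)
  qed
  moreover have "(snd x)\<^sup>2 - Y\<^sup>2 = snd x * (2 * snd y + I) - (snd y + I / 2)\<^sup>2"
    by (simp add: defs power2_eq_square field_simps)
  ultimately show ?thesis by (simp add: defs)
qed

lemma gauge_unit:
  assumes "gauge2 x > 0"
  shows "(norm (fst x) / sqrt (gauge2 x))\<^sup>2 + (snd x / gauge2 x)\<^sup>2 = 1"
proof -
  have "(norm (fst x) / sqrt (gauge2 x))\<^sup>2 + (snd x / gauge2 x)\<^sup>2
      = ((norm (fst x))\<^sup>2 * gauge2 x + (snd x)\<^sup>2) / (gauge2 x)\<^sup>2"
    using assms by (simp add: power_divide add_divide_distrib) (simp add: power2_eq_square)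
  then show ?thesis using assms by (simp flip: gauge2_quadratic)
qed

text \<open>For unit vectors at distance \<delta> the real inner product is 1 - \<delta>^2 / 2, and
  the symplectic form, which vanishes on the diagonal, is at most \<delta>.\<close>

lemma sgn_close:
  fixes z w :: "complex^'n::finite"
  assumes "norm (sgn z - sgn w) \<le> 1/100"
  shows "99/100 * (norm z * norm w) \<le> inner z w" "\<bar>Im (cinner z w)\<bar> \<le> norm z * norm w / 100"
proof -
  have "99/100 * (norm z * norm w) \<le> inner z w \<and> \<bar>Im (cinner z w)\<bar> \<le> norm z * norm w / 100"
  proof (cases "z = 0 \<or> w = 0")
    case False
    then have n: "norm (sgn z) = 1" "norm (sgn w) = 1" by (auto simp: norm_sgn)
    have z: "z = norm z *\<^sub>R sgn z" "w = norm w *\<^sub>R sgn w" using False by (auto simp: sgn_div_norm)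
    have "(norm (sgn z - sgn w))\<^sup>2 \<le> (1/100)\<^sup>2" using assms by (intro power_mono) auto
    moreover have "(norm (sgn z - sgn w))\<^sup>2 = 2 - 2 * inner (sgn z) (sgn w)"
      using n by (simp add: norm_eq_1 power2_norm_eq_inner inner_diff_left inner_diff_right inner_commute)
    ultimately have i: "99/100 \<le> inner (sgn z) (sgn w)" by (simp add: power2_eq_square)
    have "\<bar>Im (cinner (sgn z) (sgn w - sgn z))\<bar> \<le> norm (sgn z) * norm (sgn w - sgn z)"
      by (rule abs_Im_cinner_le)
    then have j: "\<bar>Im (cinner (sgn z) (sgn w))\<bar> \<le> 1/100"
      using assms by (simp add: n norm_minus_commute)
    have "inner z w = (norm z * norm w) * inner (sgn z) (sgn w)"
      by (subst z(1), subst z(2)) simp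
    moreover have "(norm z * norm w) * (99/100) \<le> (norm z * norm w) * inner (sgn z) (sgn w)"
      using i by (intro mult_left_mono) auto
    moreover have "Im (cinner z w) = (norm z * norm w) * Im (cinner (sgn z) (sgn w))"
      by (subst z(1), subst z(2)) simp
    moreover have "(norm z * norm w) * \<bar>Im (cinner (sgn z) (sgn w))\<bar> \<le> (norm z * norm w) * (1/100)"
      using j by (intro mult_left_mono) auto
    ultimately show ?thesis by (simp add: abs_mult mult.commute)
  qed auto
  then show "99/100 * (norm z * norm w) \<le> inner z w" "\<bar>Im (cinner z w)\<bar> \<le> norm z * norm w / 100" by auto
qed

text \<open>Invariant under dilations: points with nearby shapes lie in a common narrow homogeneous
  cone. The values stay in a bounded set of a finite-dimensional space, so finitely many cones
  suffice.\<close>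

definition shape :: "'n::finite heis \<Rightarrow> (complex^'n) \<times> real \<times> real" where
  "shape x = (sgn (fst x), norm (fst x) / sqrt (gauge2 x), snd x / gauge2 x)"

text \<open>Rescaling reduces this to \<open>cone_core\<close>: after substituting the normalised
  quantities, both sides of \<open>gauge_defect_expand\<close> carry the factor
  \<open>s * r ^ 4\<close>, which cancels.\<close>

lemma same_cone:
  assumes T: "0 \<le> T" and y: "0 < gauge2 y" "1600 * T\<^sup>2 \<le> gauge2 y" and le: "gauge2 y \<le> gauge2 x"
    and shape: "dist (shape x) (shape y) \<le> 1/100"
    and far: "gauge2 x - T * (norm (fst x) + sqrt (gauge2 y) + T) \<le> hdist2 x y"
  shows "norm (fst y) \<le> 2 * T \<and> gauge2 y \<le> 10 * T * norm (fst x)"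
proof -
  define r \<rho> where "r = sqrt (gauge2 x)" "\<rho> = sqrt (gauge2 y)"
  note rdefs = this
  have x: "0 < gauge2 x" using y le by simp
  have rp: "0 < r" "0 < \<rho>" "\<rho> \<le> r" using x y le by (simp_all add: rdefs)
  have r2: "gauge2 x = r\<^sup>2" "gauge2 y = \<rho>\<^sup>2" using x y by (simp_all add: rdefs)
  \<comment> \<open>The constant 1600 in the assumption is 40^2; it makes \<kappa> = T / \<rho> at
    most 1/40.\<close>
  have Tr: "40 * T \<le> \<rho>"
    using y(2) rp T unfolding r2 by (intro power2_le_imp_le[of "40 * T" \<rho>]) (simp_all add: power_mult_distrib)
  define \<alpha> \<beta> \<theta> \<phi> s \<kappa> where "\<alpha> = norm (fst x) / r" "\<beta> = norm (fst y) / \<rho>" "\<theta> = snd x / r\<^sup>2" "\<phi> = snd y / \<rho>\<^sup>2"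
    "s = \<rho> / r" "\<kappa> = T / \<rho>"
  note ds = this
  define \<iota> \<mu> where "\<iota> = Im (cinner (fst x) (fst y)) / (r * \<rho>)" "\<mu> = inner (fst x) (fst y) / (r * \<rho>)"
  note ds2 = this
  have sh: "shape x = (sgn (fst x), \<alpha>, \<theta>)" "shape y = (sgn (fst y), \<beta>, \<phi>)"
    by (simp_all add: shape_def ds rdefs[symmetric] r2 abs_of_pos[OF rp(1)] abs_of_pos[OF rp(2)])
  have c1: "norm (sgn (fst x) - sgn (fst y)) \<le> 1/100"
    using dist_fst_le[of "shape x" "shape y"] shape by (simp add: sh dist_norm)
  have c2: "dist (\<alpha>, \<theta>) (\<beta>, \<phi>) \<le> 1/100"
    using dist_snd_le[of "shape x" "shape y"] shape by (simp add: sh)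
  have c3: "\<bar>\<alpha> - \<beta>\<bar> \<le> 1/100" "\<bar>\<theta> - \<phi>\<bar> \<le> 1/100"
    using dist_fst_le[of "(\<alpha>, \<theta>)" "(\<beta>, \<phi>)"] dist_snd_le[of "(\<alpha>, \<theta>)" "(\<beta>, \<phi>)"] c2 by (simp_all add: dist_real_def)
  have un: "\<alpha>\<^sup>2 + \<theta>\<^sup>2 = 1" "\<beta>\<^sup>2 + \<phi>\<^sup>2 = 1"
    using gauge_unit[OF x] gauge_unit[OF y(1)] by (simp_all add: ds rdefs(1)[symmetric] rdefs(2)[symmetric] r2 abs_of_pos[OF rp(1)] abs_of_pos[OF rp(2)])
  have ab: "\<alpha> * \<beta> = norm (fst x) * norm (fst y) / (r * \<rho>)" by (simp add: ds)
  have cone: "99/100 * (\<alpha> * \<beta>) \<le> \<mu>" "\<bar>\<iota>\<bar> \<le> \<alpha> * \<beta> / 100"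
    unfolding ab ds2 using sgn_close[OF c1] rp by (simp_all add: divide_right_mono abs_mult field_simps)
  have pos: "0 \<le> \<alpha>" "0 \<le> \<beta>" "0 < s" "s \<le> 1" "0 \<le> \<kappa>" "\<kappa> \<le> 1/40"
    using rp T Tr by (simp_all add: ds field_simps)
  have undo: "norm (fst x) = \<alpha> * r" "norm (fst y) = \<beta> * (s * r)" "snd x = \<theta> * r\<^sup>2" "snd y = \<phi> * (s * r)\<^sup>2"
    "\<rho> = s * r" "T = \<kappa> * (s * r)" "Im (cinner (fst x) (fst y)) = \<iota> * (s * r\<^sup>2)"
    "inner (fst x) (fst y) = \<mu> * (s * r\<^sup>2)"
    using rp by (simp_all add: ds ds2 power2_eq_square)
  have "0 \<le> T * (norm (fst x) + sqrt (gauge2 y) + T)" using T y by simp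
  from gauge_defect_expand[OF far this]
  have "r\<^sup>2 * (2 * (\<mu> * (s * r\<^sup>2)) - (\<beta> * (s * r))\<^sup>2) + \<theta> * r\<^sup>2 * (2 * (\<phi> * (s * r)\<^sup>2) + \<iota> * (s * r\<^sup>2))
      - (\<phi> * (s * r)\<^sup>2 + \<iota> * (s * r\<^sup>2) / 2)\<^sup>2 \<le> 2 * r\<^sup>2 * (\<kappa> * (s * r) * (\<alpha> * r + s * r + \<kappa> * (s * r)))"
    unfolding r2(1) rdefs(2)[symmetric] by (simp only: undo)
  also have "\<dots> = (s * r ^ 4) * (2 * \<kappa> * (\<alpha> + s + s * \<kappa>))"
    by (simp add: power2_eq_square power4_eq_xxxx algebra_simps)
  also have "r\<^sup>2 * (2 * (\<mu> * (s * r\<^sup>2)) - (\<beta> * (s * r))\<^sup>2) + \<theta> * r\<^sup>2 * (2 * (\<phi> * (s * r)\<^sup>2) + \<iota> * (s * r\<^sup>2))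
      - (\<phi> * (s * r)\<^sup>2 + \<iota> * (s * r\<^sup>2) / 2)\<^sup>2
      = (s * r ^ 4) * (2 * \<mu> - s * \<beta>\<^sup>2 + \<theta> * (2 * s * \<phi> + \<iota>) - s * (s * \<phi> + \<iota> / 2)\<^sup>2)"
    by (simp add: power2_eq_square power4_eq_xxxx field_simps)
  finally have main: "2 * \<mu> - s * \<beta>\<^sup>2 + \<theta> * (2 * s * \<phi> + \<iota>) - s * (s * \<phi> + \<iota> / 2)\<^sup>2 \<le> 2 * \<kappa> * (\<alpha> + s + s * \<kappa>)"
    using pos rp by (simp add: mult_le_cancel_left_pos)
  from cone_core[OF un pos c3 cone main] have c: "\<beta> \<le> 2 * \<kappa>" "s \<le> 10 * (\<kappa> * \<alpha>)" by auto
  have "norm (fst y) = \<beta> * \<rho>" "T = \<kappa> * \<rho>" using rp by (simp_all add: ds)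
  moreover have "\<beta> * \<rho> \<le> 2 * \<kappa> * \<rho>" using c(1) rp by (intro mult_right_mono) auto
  moreover have "s * (\<rho> * r) \<le> 10 * (\<kappa> * \<alpha>) * (\<rho> * r)" using c(2) rp by (intro mult_right_mono) auto
  moreover have "s * (\<rho> * r) = gauge2 y" "10 * (\<kappa> * \<alpha>) * (\<rho> * r) = 10 * T * norm (fst x)"
    using rp unfolding r2 by (simp_all add: ds power2_eq_square)
  ultimately show ?thesis by simp
qed

text \<open>Up to a slack, every point is at least as far from the points nearer to \<open>p\<close>
  as it is from \<open>p\<close>. For \<open>T = 0\<close> this is the configuration met in
  Besicovitch coverings; the slack leaves room for thickened balls and shells.\<close>

definition crowd :: "'n::finite heis \<Rightarrow> real \<Rightarrow> 'n heis set \<Rightarrow> bool" where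
  "crowd p T S \<longleftrightarrow> finite S \<and> 0 \<le> T \<and> (\<forall>x\<in>S. 0 < hdist2 x p \<and> 1600 * T\<^sup>2 \<le> hdist2 x p) \<and>
     (\<forall>x\<in>S. \<forall>y\<in>S. x \<noteq> y \<and> hdist2 y p \<le> hdist2 x p \<longrightarrow>
        hdist2 x p - T * (hgap x p + sqrt (hdist2 y p) + T) \<le> hdist2 x y)"

lemma crowd_translate:
  assumes "crowd p T S"
  shows "crowd heis_zero T ((\<lambda>x. heis_mult x (heis_inv p)) ` S)"
proof -
  have 1: "hdist2 (heis_mult x (heis_inv p)) heis_zero = hdist2 x p" for x
    by (simp add: hdist2_def)
  have 2: "hgap (heis_mult x (heis_inv p)) heis_zero = hgap x p" for x
    by (simp add: hgap_def heis_mult_def heis_inv_def heis_zero_def)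
  show ?thesis using assms unfolding crowd_def by (auto simp: 1 2 simp del: hdist2_zero hgap_zero)
qed

text \<open>Finitely many narrow cones cover all shapes, and each holds at most two points. Of three
  points u, v, w in order of decreasing radius, the first pair forces the horizontal part of v below
  2 T, and then the second pair gives \<open>gauge2 w\<close> at most 10 T * 2 T, which is
  incompatible with the lower bound 1600 T^2 and positivity.\<close>

lemma crowd_bound: "\<exists>N. \<forall>p T (S::'n::finite heis set). crowd p T S \<longrightarrow> card S \<le> N"
proof -
  let ?B = "cball 0 3 :: ((complex^'n) \<times> real \<times> real) set"
  obtain K where K: "finite K" "?B \<subseteq> (\<Union>c\<in>K. ball c (1/200))"
    using compactE_image[of ?B ?B "\<lambda>c. ball c (1/200)"] by (metis (no_types, lifting) UN_I centre_in_ball compact_cball open_ball subsetI zero_less_divide_1_iff zero_less_numeral)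
  have "card S \<le> 2 * card K" if S: "crowd heis_zero T S" for T and S :: "'n heis set"
  proof -
    have fin: "finite S" and T: "0 \<le> T" and pos: "\<And>x. x \<in> S \<Longrightarrow> 0 < gauge2 x \<and> 1600 * T\<^sup>2 \<le> gauge2 x"
      and far: "\<And>x y. x \<in> S \<Longrightarrow> y \<in> S \<Longrightarrow> x \<noteq> y \<Longrightarrow> gauge2 y \<le> gauge2 x \<Longrightarrow>
        gauge2 x - T * (norm (fst x) + sqrt (gauge2 y) + T) \<le> hdist2 x y"
      using S by (auto simp: crowd_def)
    have inB: "shape x \<in> ?B" if "x \<in> S" for x
    proof -
      have u: "(norm (fst x) / sqrt (gauge2 x))\<^sup>2 + (snd x / gauge2 x)\<^sup>2 = 1"
        using gauge_unit pos[OF that] by blast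
      have "norm (shape x) \<le> norm (sgn (fst x)) + norm (norm (fst x) / sqrt (gauge2 x), snd x / gauge2 x)"
        unfolding shape_def by (rule norm_Pair_le)
      also have "\<dots> \<le> 1 + 1" using u by (intro add_mono) (simp_all add: norm_sgn norm_Pair power_divide)
      finally show ?thesis by simp
    qed
    have cell: "card {x\<in>S. shape x \<in> ball c (1/200)} \<le> 2" (is "card ?C \<le> 2") for c
    proof (rule ccontr)
      assume "\<not> ?thesis"
      then obtain C where C: "C \<subseteq> ?C" "card C = 3" by (metis (no_types, lifting) not_less_eq_eq obtain_subset_with_card_n numeral_3_eq_3 numeral_2_eq_2)
      have d: "dist (shape x) (shape y) \<le> 1/100" if "x \<in> C" "y \<in> C" for x y
      proof -
        have "dist c (shape x) < 1/200" "dist c (shape y) < 1/200" using that C by auto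
        then show ?thesis using dist_triangle3[of "shape x" "shape y" c] by linarith
      qed
      have pair: "norm (fst y) \<le> 2 * T \<and> gauge2 y \<le> 10 * T * norm (fst x)"
        if "x \<in> C" "y \<in> C" "x \<noteq> y" "gauge2 y \<le> gauge2 x" for x y
      proof -
        have S: "x \<in> S" "y \<in> S" using that C by auto
        show ?thesis
          using pos[OF S(2)] far[OF S that(3,4)] d[OF that(1,2)] by (intro same_cone[OF T _ _ that(4)]) auto
      qed
      have "\<exists>u\<in>C. \<exists>v\<in>C. \<exists>w\<in>C. u \<noteq> v \<and> v \<noteq> w \<and> gauge2 v \<le> gauge2 u \<and> gauge2 w \<le> gauge2 v"
      proof -
        obtain u v w where "C = {u, v, w}" "u \<noteq> v" "v \<noteq> w" "u \<noteq> w" using C(2) card_3_iff by metis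
        then show ?thesis by (metis insertI1 insertI2 linear)
      qed
      then obtain u v w where uvw: "u \<in> C" "v \<in> C" "w \<in> C" "u \<noteq> v" "v \<noteq> w" "gauge2 v \<le> gauge2 u" "gauge2 w \<le> gauge2 v"
        by blast
      have "norm (fst v) \<le> 2 * T" "gauge2 w \<le> 10 * T * norm (fst v)" using pair uvw by blast+
      moreover have "10 * T * norm (fst v) \<le> 10 * T * (2 * T)" using T calculation by (intro mult_left_mono) auto
      moreover have "0 < gauge2 w" "1600 * T\<^sup>2 \<le> gauge2 w" using pos[of w] uvw(3) C(1) by blast+
      ultimately show False using zero_le_power2[of T] by (simp add: power2_eq_square)
    qed
    have "S \<subseteq> (\<Union>c\<in>K. {x\<in>S. shape x \<in> ball c (1/200)})" using inB K by fastforce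
    then have "card S \<le> card (\<Union>c\<in>K. {x\<in>S. shape x \<in> ball c (1/200)})"
      using fin K by (intro card_mono) auto
    also have "\<dots> \<le> (\<Sum>c\<in>K. card {x\<in>S. shape x \<in> ball c (1/200)})" by (rule card_UN_le[OF K(1)])
    also have "\<dots> \<le> (\<Sum>c\<in>K. 2)" by (intro sum_mono cell)
    finally show ?thesis by simp
  qed
  moreover have "card ((\<lambda>x. heis_mult x (heis_inv p)) ` S) = card S" for p :: "'n heis" and S
    by (intro card_image inj_onI) (metis heis_mult_inv_cancel_right(2))
  ultimately have "\<forall>p T (S::'n heis set). crowd p T S \<longrightarrow> card S \<le> 2 * card K"
    using crowd_translate by metis
  then show ?thesis by blast
qed

section \<open>Balls and shells in the discrete group\<close>

definition hball :: "'n::finite heis \<Rightarrow> real \<Rightarrow> 'n heis set" where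
  "hball x k = {p \<in> discrete_heis. hdist2 p x \<le> k\<^sup>2}"

definition hshell :: "real \<Rightarrow> 'n::finite heis \<Rightarrow> real \<Rightarrow> 'n heis set" where
  "hshell t x k = {p \<in> discrete_heis. \<bar>hdist2 p x - k\<^sup>2\<bar> \<le> t * (hgap p x + t)}"

definition hnbhd :: "'n::finite heis set \<Rightarrow> real \<Rightarrow> 'n heis set" where
  "hnbhd E s = {p \<in> discrete_heis. \<exists>e\<in>E. hdist2 p e \<le> s\<^sup>2}"

section \<open>The discrete group: closure and growth\<close>

lemma discrete_heis_iff:
  "p \<in> discrete_heis \<longleftrightarrow> (\<forall>j. Re (fst p $ j) \<in> \<int> \<and> Im (fst p $ j) \<in> \<int>) \<and>
     snd p - (\<Sum>j\<in>UNIV. Re (fst p $ j) * Im (fst p $ j)) / 2 \<in> \<int>"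
  by (cases p) (simp add: discrete_heis_def)

lemma heis_zero_discrete [simp]: "heis_zero \<in> discrete_heis"
  by (simp add: discrete_heis_iff heis_zero_def)

text \<open>The half-integral shift of the height is not additive, but half the symplectic term of
  the product cancels its defect up to the integer sum of Im z_j Re w_j.\<close>

lemma heis_mult_discrete [simp]:
  assumes "p \<in> discrete_heis" "q \<in> discrete_heis"
  shows "heis_mult p q \<in> discrete_heis"
proof -
  let ?s = "\<lambda>p::'a heis. \<Sum>j\<in>UNIV. Re (fst p $ j) * Im (fst p $ j)"
  have "snd (heis_mult p q) - ?s (heis_mult p q) / 2
      = (snd p - ?s p / 2) + (snd q - ?s q / 2) - (\<Sum>j\<in>UNIV. Im (fst p $ j) * Re (fst q $ j))"
    by (simp add: heis_mult_def cinner_def algebra_simps sum.distrib sum_subtractf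
        add_divide_distrib diff_divide_distrib)
  also have "\<dots> \<in> \<int>"
  proof (intro Ints_diff[OF Ints_add])
    show "snd p - ?s p / 2 \<in> \<int>" "snd q - ?s q / 2 \<in> \<int>"
      using assms unfolding discrete_heis_iff by blast+
    show "(\<Sum>j\<in>UNIV. Im (fst p $ j) * Re (fst q $ j)) \<in> \<int>"
      using assms by (intro Ints_sum Ints_mult) (auto simp: discrete_heis_iff)
  qed
  finally show ?thesis using assms by (simp add: discrete_heis_iff heis_mult_def)
qed

lemma heis_inv_discrete [simp]: "p \<in> discrete_heis \<Longrightarrow> heis_inv p \<in> discrete_heis"
proof -
  assume p: "p \<in> discrete_heis"
  let ?s = "\<lambda>p::'a heis. \<Sum>j\<in>UNIV. Re (fst p $ j) * Im (fst p $ j)"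
  have "snd (heis_inv p) - ?s (heis_inv p) / 2 = - (snd p - ?s p / 2) - ?s p"
    by (simp add: heis_inv_def)
  also have "\<dots> \<in> \<int>"
  proof (rule Ints_diff)
    show "- (snd p - ?s p / 2) \<in> \<int>" using p unfolding discrete_heis_iff by (blast intro: Ints_minus)
    show "?s p \<in> \<int>" using p by (intro Ints_sum Ints_mult) (auto simp: discrete_heis_iff)
  qed
  finally show ?thesis using p by (simp add: discrete_heis_iff heis_inv_def)
qed

lemma heis_ball_eq: "heis_ball k = hball heis_zero (real k)"
  by (simp add: heis_ball_def hball_def heis_dist_zero_le)

text \<open>All coordinates are integers between -R and R, and twice the height is an integer
  between -2 R^2 and 2 R^2. Any polynomial bound would serve for the doubling windows below.\<close>

lemma hball_zero_card:
  "finite (hball heis_zero (real R) :: 'n::finite heis set)"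
  "card (hball heis_zero (real R) :: 'n heis set) \<le> (2 * R + 1) ^ (2 * CARD('n) + 2)"
proof -
  let ?I = "PiE (UNIV::'n set) (\<lambda>_. {- int R..int R})"
  let ?X = "?I \<times> ?I \<times> {- 2 * (int R)\<^sup>2..2 * (int R)\<^sup>2}"
  let ?f = "\<lambda>(a, b, m). ((\<chi> j. Complex (of_int (a j)) (of_int (b j))) :: complex^'n, of_int m / 2 :: real)"
  have sub: "hball heis_zero (real R) \<subseteq> ?f ` ?X"
  proof
    fix p :: "'n heis" assume p: "p \<in> hball heis_zero (real R)"
    then have d: "p \<in> discrete_heis" and g: "gauge2 p \<le> (real R)\<^sup>2" by (auto simp: hball_def)
    have nz: "norm (fst p) \<le> R"
      using gauge2_ge_norm[of p] g by (meson of_nat_0_le_iff order_trans power2_le_imp_le)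
    have t: "\<bar>snd p\<bar> \<le> (real R)\<^sup>2" using gauge2_ge_height[of p] g by linarith
    have c: "\<bar>Re (fst p $ j)\<bar> \<le> R" "\<bar>Im (fst p $ j)\<bar> \<le> R" for j
      using nz abs_Re_le_cmod[of "fst p $ j"] abs_Im_le_cmod[of "fst p $ j"]
      using Finite_Cartesian_Product.norm_nth_le[of "fst p" j] by linarith+
    define a b where "a j = \<lfloor>Re (fst p $ j)\<rfloor>" and "b j = \<lfloor>Im (fst p $ j)\<rfloor>" for j
    have ab: "of_int (a j) = Re (fst p $ j)" "of_int (b j) = Im (fst p $ j)" for j
      using d by (auto simp: a_def b_def discrete_heis_iff)
    have "2 * (snd p - (\<Sum>j\<in>UNIV. Re (fst p $ j) * Im (fst p $ j)) / 2)
        + (\<Sum>j\<in>UNIV. Re (fst p $ j) * Im (fst p $ j)) \<in> \<int>"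
    proof (rule Ints_add)
      show "2 * (snd p - (\<Sum>j\<in>UNIV. Re (fst p $ j) * Im (fst p $ j)) / 2) \<in> \<int>"
        using d unfolding discrete_heis_iff by (blast intro: Ints_mult Ints_numeral)
      show "(\<Sum>j\<in>UNIV. Re (fst p $ j) * Im (fst p $ j)) \<in> \<int>"
        using d by (intro Ints_sum Ints_mult) (auto simp: discrete_heis_iff)
    qed
    then obtain m where m: "2 * snd p = of_int m" by (auto elim: Ints_cases)
    have "a j \<in> {- int R..int R}" "b j \<in> {- int R..int R}" for j
    proof -
      have "\<bar>real_of_int (a j)\<bar> \<le> real_of_int (int R)" "\<bar>real_of_int (b j)\<bar> \<le> real_of_int (int R)"
        using c[of j] by (simp_all add: ab)
      then show "a j \<in> {- int R..int R}" "b j \<in> {- int R..int R}"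
        unfolding of_int_abs[symmetric] of_int_le_iff by auto
    qed
    moreover have "m \<in> {- 2 * (int R)\<^sup>2..2 * (int R)\<^sup>2}"
    proof -
      have "\<bar>real_of_int m\<bar> \<le> real_of_int (2 * (int R)\<^sup>2)" using t m by simp
      then show ?thesis unfolding of_int_abs[symmetric] of_int_le_iff by auto
    qed
    moreover have "?f (a, b, m) = p"
      using m by (cases p) (auto simp: ab vec_eq_iff field_simps)
    ultimately show "p \<in> ?f ` ?X" by (intro image_eqI[of _ _ "(a, b, m)"]) (auto simp: PiE_iff)
  qed
  have fin: "finite ?X" by (intro finite_cartesian_product finite_PiE) auto
  show "finite (hball heis_zero (real R) :: 'n heis set)" using sub fin by (rule finite_surj[rotated])
  have "card (hball heis_zero (real R) :: 'n heis set) \<le> card ?X"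
    by (rule surj_card_le[OF fin sub])
  also have "\<dots> = (2 * R + 1) ^ CARD('n) * ((2 * R + 1) ^ CARD('n) * (4 * R\<^sup>2 + 1))"
    by (simp add: card_cartesian_product card_PiE nat_add_distrib nat_mult_distrib nat_power_eq
        del: UNIV_I)
  also have "4 * R\<^sup>2 + 1 \<le> (2 * R + 1)\<^sup>2" by (simp add: power2_eq_square algebra_simps)
  then have "(2 * R + 1) ^ CARD('n) * ((2 * R + 1) ^ CARD('n) * (4 * R\<^sup>2 + 1))
      \<le> (2 * R + 1) ^ CARD('n) * ((2 * R + 1) ^ CARD('n) * (2 * R + 1)\<^sup>2)"
    by (intro mult_le_mono2)
  also have "\<dots> = (2 * R + 1) ^ (2 * CARD('n) + 2)" by (simp only: power_add mult_2 mult.assoc)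
  finally show "card (hball heis_zero (real R) :: 'n heis set) \<le> (2 * R + 1) ^ (2 * CARD('n) + 2)" .
qed

lemma hball_translate:
  assumes "x \<in> discrete_heis"
  shows "hball x k = (\<lambda>p. heis_mult p x) ` hball heis_zero k"
proof (intro set_eqI iffI)
  fix p assume p: "p \<in> hball x k"
  let ?q = "heis_mult p (heis_inv x)"
  have "p = heis_mult ?q x" by simp
  moreover have "?q \<in> hball heis_zero k" using p assms by (simp add: hball_def hdist2_def)
  ultimately show "p \<in> (\<lambda>p. heis_mult p x) ` hball heis_zero k" by blast
next
  fix p assume "p \<in> (\<lambda>p. heis_mult p x) ` hball heis_zero k"
  then show "p \<in> hball x k" using assms by (auto simp: hball_def hdist2_def)
qed

lemma hshell_translate:
  assumes "x \<in> discrete_heis"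
  shows "hshell t x k = (\<lambda>p. heis_mult p x) ` hshell t heis_zero k"
proof (intro set_eqI iffI)
  fix p assume p: "p \<in> hshell t x k"
  let ?q = "heis_mult p (heis_inv x)"
  have 1: "p = heis_mult ?q x" by simp
  have "hdist2 p x = hdist2 ?q heis_zero" "hgap p x = hgap ?q heis_zero"
    using hdist2_right_invariant[of ?q x heis_zero] hgap_right_invariant[of ?q x heis_zero] by (simp_all del: hdist2_zero hgap_zero hdist2_right_invariant hgap_right_invariant)
  then have "?q \<in> hshell t heis_zero k" using p assms by (simp add: hshell_def del: hdist2_zero hgap_zero)
  then show "p \<in> (\<lambda>p. heis_mult p x) ` hshell t heis_zero k" using 1 by blast
next
  fix p assume "p \<in> (\<lambda>p. heis_mult p x) ` hshell t heis_zero k"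
  then obtain q where q: "p = heis_mult q x" "q \<in> hshell t heis_zero k" by blast
  have "hdist2 p x = hdist2 q heis_zero" "hgap p x = hgap q heis_zero"
    using hdist2_right_invariant[of q x heis_zero] hgap_right_invariant[of q x heis_zero] q
    by (simp_all del: hdist2_zero hgap_zero hdist2_right_invariant hgap_right_invariant)
  then show "p \<in> hshell t x k" using assms q by (simp add: hshell_def del: hdist2_zero hgap_zero)
qed

lemma hball_mono: "0 \<le> k \<Longrightarrow> k \<le> k' \<Longrightarrow> hball x k \<subseteq> hball x k'"
  unfolding hball_def using power_mono[of k k' 2] by (auto intro: order_trans)

lemma finite_hball [simp]:
  assumes "x \<in> discrete_heis"
  shows "finite (hball x k)"
proof -
  have "hball heis_zero k \<subseteq> (hball heis_zero (real (nat \<lceil>\<bar>k\<bar>\<rceil>)) :: 'a heis set)"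
  proof -
    have "k\<^sup>2 = \<bar>k\<bar>\<^sup>2" by simp
    also have "\<dots> \<le> (real (nat \<lceil>\<bar>k\<bar>\<rceil>))\<^sup>2" by (intro power_mono real_nat_ceiling_ge) auto
    finally show ?thesis by (auto simp: hball_def)
  qed
  then show ?thesis using hball_zero_card(1) assms by (metis finite_imageI finite_subset hball_translate)
qed

lemma finite_hnbhd [simp]:
  assumes "finite E" "E \<subseteq> discrete_heis"
  shows "finite (hnbhd E s)"
proof -
  have "hnbhd E s = (\<Union>e\<in>E. hball e s)" by (auto simp: hnbhd_def hball_def)
  then show ?thesis using assms by auto
qed

lemma hnbhd_mono: "E \<subseteq> E' \<Longrightarrow> 0 \<le> s \<Longrightarrow> s \<le> s' \<Longrightarrow> hnbhd E s \<subseteq> hnbhd E' s'"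
  unfolding hnbhd_def using power_mono[of s s' 2] by (blast intro: order_trans)

lemma hshell_mono: "0 \<le> t \<Longrightarrow> t \<le> t' \<Longrightarrow> hshell t x k \<subseteq> hshell t' x k"
proof
  fix p assume t: "0 \<le> t" "t \<le> t'" and p: "p \<in> hshell t x k"
  then have "t * (hgap p x + t) \<le> t' * (hgap p x + t')" by (intro mult_mono) (auto intro: add_nonneg_nonneg)
  then show "p \<in> hshell t' x k" using p by (simp add: hshell_def)
qed

text \<open>The horizontal gap is at most the distance, so a shell with \<open>t\<close> at most
  k/100 is a small perturbation of a sphere. These crude bounds recover the order of radii from
  distances.\<close>

lemma shell_radius:
  assumes t: "0 \<le> t" "100 * t \<le> k" and q: "\<bar>hdist2 p x - k\<^sup>2\<bar> \<le> t * (hgap p x + t)"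
  shows "k / 2 \<le> sqrt (hdist2 p x)" "sqrt (hdist2 p x) \<le> 2 * k"
proof -
  define X where "X = sqrt (hdist2 p x)"
  have X: "0 \<le> X" "hdist2 p x = X\<^sup>2" by (simp_all add: X_def)
  have "t * (hgap p x + t) \<le> t * (X + t)"
    using hgap_le_sqrt_hdist2[of p x] t by (intro mult_left_mono) (auto simp: X_def)
  then have q': "\<bar>X\<^sup>2 - k\<^sup>2\<bar> \<le> t * X + t\<^sup>2" using q by (simp add: X algebra_simps power2_eq_square)
  have k: "0 \<le> k" using t by simp
  have t2: "t\<^sup>2 \<le> k\<^sup>2 / 10000" using power_mono[of "100 * t" k 2] t by (simp add: power_mult_distrib)
  have tX: "t * X \<le> (k / 100) * X" using t X by (intro mult_right_mono) auto
  show "X \<le> 2 * k"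
  proof (rule ccontr)
    assume "\<not> ?thesis"
    then have c: "2 * k < X" by simp
    have "(2 * k)\<^sup>2 < X\<^sup>2" using c k by (intro power_strict_mono) auto
    moreover have "k * X \<le> (X / 2) * X" using c X by (intro mult_right_mono) auto
    ultimately show False using q' tX t2 by (simp add: power2_eq_square)
  qed
  show "k / 2 \<le> X"
  proof (rule ccontr)
    assume "\<not> ?thesis"
    then have c: "X < k / 2" by simp
    then have "0 < k" using X by linarith
    then have "0 < k\<^sup>2" by simp
    moreover have "X\<^sup>2 \<le> (k / 2)\<^sup>2" using c X by (intro power_mono) auto
    moreover have "k * X \<le> k * (k / 2)" using c k by (intro mult_left_mono) auto
    ultimately show False using q' tX t2 by (simp add: power2_eq_square)
  qed
qed

lemma hshell_subset_hball:
  assumes "0 \<le> t" "100 * t \<le> k"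
  shows "hshell t x k \<subseteq> hball x (2 * k)"
proof
  fix p assume p: "p \<in> hshell t x k"
  then have "sqrt (hdist2 p x) \<le> 2 * k" by (intro shell_radius(2)[OF assms]) (simp add: hshell_def)
  then have "(sqrt (hdist2 p x))\<^sup>2 \<le> (2 * k)\<^sup>2" by (intro power_mono) auto
  then show "p \<in> hball x (2 * k)" using p by (simp add: hball_def hshell_def)
qed

text \<open>The perturbation error has the same form as the thickness of a shell, so a displacement
  by \<open>s\<close> merely increases the parameter by \<open>3 * s\<close>.\<close>

lemma hshell_move:
  assumes t: "0 \<le> t" "0 \<le> s" and p: "p \<in> hshell t x k" and p': "p' \<in> discrete_heis" "hdist2 p p' \<le> s\<^sup>2"
  shows "p' \<in> hshell (t + 3 * s) x k"
proof -
  have 1: "\<bar>hdist2 p x - k\<^sup>2\<bar> \<le> t * (hgap p x + t)" using p by (simp add: hshell_def)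
  have 2: "\<bar>hdist2 p' x - hdist2 p x\<bar> \<le> 3 * s * (hgap p x + s)" by (rule hdist2_perturb[OF t(2) p'(2)])
  have 3: "hgap p x \<le> hgap p' x + s" by (rule hgap_perturb[OF t(2) p'(2)])
  have "t * (hgap p x + t) \<le> t * (hgap p' x + s + t)" using 3 t by (intro mult_left_mono) auto
  moreover have "3 * s * (hgap p x + s) \<le> 3 * s * (hgap p' x + s + s)" using 3 t by (intro mult_left_mono) auto
  moreover have "t * (hgap p' x + s + t) + 3 * s * (hgap p' x + s + s) \<le> (t + 3 * s) * (hgap p' x + (t + 3 * s))"
    using t by (simp add: algebra_simps)
  ultimately have "\<bar>hdist2 p' x - k\<^sup>2\<bar> \<le> (t + 3 * s) * (hgap p' x + (t + 3 * s))"
    using 1 2 by linarith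
  then show ?thesis using p' by (simp add: hshell_def)
qed

text \<open>If every increase of the radius by \<open>s\<close> more than doubled the ball, the size
  would be exponential in the number of increases, against the polynomial bound.\<close>

lemma exists_doubling_window:
  "\<exists>R. card (hball heis_zero (real (R + s)) :: 'n::finite heis set) \<le> 2 * card (hball heis_zero (real R) :: 'n heis set)"
proof (rule ccontr)
  let ?b = "\<lambda>R. card (hball heis_zero (real R) :: 'n heis set)"
  let ?D = "2 * CARD('n) + 2"
  assume "\<not> ?thesis"
  then have gr: "2 * ?b R < ?b (R + s)" for R by (simp add: not_le)
  have "2 ^ j \<le> ?b (j * s)" for j
  proof (induction j)
    case 0
    have "heis_zero \<in> (hball heis_zero (real 0) :: 'n heis set)" by (simp add: hball_def)
    then have "?b 0 > 0" using hball_zero_card(1)[of 0] by (metis card_gt_0_iff empty_iff)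
    then show ?case by simp
  next
    case (Suc j)
    then show ?case using gr[of "j * s"] by (simp add: add.commute)
  qed
  then have "2 ^ j \<le> (2 * (j * s) + 1) ^ ?D" for j using hball_zero_card(2) order_trans by blast
  then have le: "(2::real) ^ j \<le> (2 * (real j * real s) + 1) ^ ?D" for j
    by (metis (mono_tags, opaque_lifting) of_nat_1 of_nat_add of_nat_le_iff of_nat_mult of_nat_numeral of_nat_power)
  have le2: "1 \<le> (2 * real s + 1) ^ ?D * (real j ^ ?D / 2 ^ j)" if "j > 0" for j
  proof -
    have "2 * (real j * real s) + 1 \<le> (2 * real s + 1) * real j" using that by (simp add: algebra_simps)
    then have "(2 * (real j * real s) + 1) ^ ?D \<le> ((2 * real s + 1) * real j) ^ ?D" by (intro power_mono) auto
    with le[of j] have "2 ^ j \<le> ((2 * real s + 1) * real j) ^ ?D" by linarith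
    then have "1 \<le> ((2 * real s + 1) * real j) ^ ?D / 2 ^ j" by (simp only: le_divide_eq) simp
    then show ?thesis by (simp only: power_mult_distrib times_divide_eq_right)
  qed
  have "(\<lambda>j. (2 * real s + 1) ^ ?D * (real j ^ ?D / 2 ^ j)) \<longlonglongrightarrow> (2 * real s + 1) ^ ?D * 0"
    by (intro tendsto_mult tendsto_const) real_asymp
  then have "1 \<le> (2 * real s + 1) ^ ?D * (0::real)"
    by (rule LIMSEQ_le_const) (use le2 in \<open>auto intro!: exI[of _ 1]\<close>)
  then show False by simp
qed

section \<open>Covering and the mass of shells\<close>

text \<open>Choose a point of largest radius, discard everything its ball contains, and repeat. A
  later centre lies outside the earlier ball and has no larger radius, so the separation holds with
  either radius of a pair.\<close>

lemma greedy_cover: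
  fixes r :: "'n::finite heis \<Rightarrow> real"
  assumes "finite E" "\<And>x. x \<in> E \<Longrightarrow> 0 \<le> r x"
  shows "\<exists>J\<subseteq>E. (\<forall>x\<in>J. \<forall>y\<in>J. x \<noteq> y \<longrightarrow> (r x)\<^sup>2 < hdist2 x y) \<and> (\<forall>e\<in>E. \<exists>x\<in>J. hdist2 e x \<le> (r x)\<^sup>2)"
  using assms
proof (induction E rule: finite_psubset_induct)
  case (psubset E)
  show ?case
  proof (cases "E = {}")
    case False
    then obtain x where x: "x \<in> E" "\<And>y. y \<in> E \<Longrightarrow> r y \<le> r x"
      using obtains_MAX[OF psubset.hyps(1), of r] Max_ge psubset.hyps(1) by (metis finite_imageI imageI)
    define E' where "E' = {e\<in>E. \<not> hdist2 e x \<le> (r x)\<^sup>2}"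
    have "x \<notin> E'" by (simp add: E'_def)
    moreover have E'E: "E' \<subseteq> E" by (auto simp: E'_def)
    ultimately have "E' \<subset> E" using x by blast
    from psubset.IH[OF this] psubset.prems obtain J where J: "J \<subseteq> E'"
      "\<forall>x\<in>J. \<forall>y\<in>J. x \<noteq> y \<longrightarrow> (r x)\<^sup>2 < hdist2 x y" "\<forall>e\<in>E'. \<exists>x\<in>J. hdist2 e x \<le> (r x)\<^sup>2"
      unfolding E'_def by blast
    have sep: "(r x)\<^sup>2 < hdist2 y x" "(r y)\<^sup>2 < hdist2 y x" if "y \<in> J" for y
    proof -
      show 1: "(r x)\<^sup>2 < hdist2 y x" using that J by (auto simp: E'_def)
      have "y \<in> E" using that J(1) E'E by blast
      then have "(r y)\<^sup>2 \<le> (r x)\<^sup>2" using x(2)[of y] psubset.prems[of y] by (intro power_mono)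
      then show "(r y)\<^sup>2 < hdist2 y x" using 1 by simp
    qed
    have "\<forall>y\<in>insert x J. \<forall>z\<in>insert x J. y \<noteq> z \<longrightarrow> (r y)\<^sup>2 < hdist2 y z"
      using sep J(2) hdist2_commute by (metis insert_iff)
    moreover have "insert x J \<subseteq> E" using x J by (auto simp: E'_def)
    moreover have "\<forall>e\<in>E. \<exists>y\<in>insert x J. hdist2 e y \<le> (r y)\<^sup>2" using J(3) by (auto simp: E'_def)
    ultimately show ?thesis by blast
  qed simp
qed

text \<open>The centres whose thickened balls contain \<open>p\<close> form a crowd, apart from at
  most one within 40 t of \<open>p\<close>: two such centres would be at squared distance at most 7
  * (40 t)^2 = 11200 t^2, less than the separation (200 t)^2. The case \<open>t = 0\<close> concerns
  ordinary balls.\<close>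

lemma overlap_bound:
  fixes r :: "'n::finite heis \<Rightarrow> real"
  assumes N: "\<And>p T (S::'n heis set). crowd p T S \<Longrightarrow> card S \<le> N"
    and J: "finite J" "\<And>x y. x \<in> J \<Longrightarrow> y \<in> J \<Longrightarrow> x \<noteq> y \<Longrightarrow> (r x)\<^sup>2 < hdist2 x y"
    and t: "0 \<le> t" "\<And>x. x \<in> J \<Longrightarrow> 200 * t \<le> r x"
  shows "card {x\<in>J. hdist2 p x \<le> (r x)\<^sup>2 + t * (hgap p x + t)} \<le> Suc N"
proof -
  let ?A = "{x\<in>J. hdist2 p x \<le> (r x)\<^sup>2 + t * (hgap p x + t)}"
  let ?S = "{x\<in>?A. 1600 * t\<^sup>2 < hdist2 x p}" and ?B = "{x\<in>J. hdist2 x p \<le> 1600 * t\<^sup>2}"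
  have "card ?B \<le> 1"
  proof (rule ccontr)
    assume "\<not> ?thesis"
    then obtain C where "C \<subseteq> ?B" "card C = 2" by (metis (no_types, lifting) not_less_eq_eq obtain_subset_with_card_n numeral_2_eq_2 One_nat_def)
    then obtain x y where "{x, y} \<subseteq> ?B" and "x \<noteq> y" by (auto simp: card_2_iff)
    then have xy: "x \<in> ?B" "y \<in> ?B" "x \<noteq> y" by auto
    let ?s = "40 * t"
    have p: "hdist2 p y \<le> ?s\<^sup>2" "hdist2 p x \<le> ?s\<^sup>2" using xy by (auto simp: hdist2_commute power_mult_distrib)
    have "hgap p x \<le> ?s" using hgap_le_hdist2[of p x] p(2) t(1)
      by (meson hgap_nonneg mult_nonneg_nonneg order_trans power2_le_imp_le zero_le_numeral)
    then have "3 * ?s * (hgap p x + ?s) \<le> 3 * ?s * (?s + ?s)" using t by (intro mult_left_mono) auto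
    then have "hdist2 y x \<le> 7 * ?s\<^sup>2"
      using hdist2_perturb[OF _ p(1), of x] p(2) t(1) by (simp add: power2_eq_square)
    moreover have "(200 * t)\<^sup>2 \<le> (r x)\<^sup>2" using t xy by (intro power_mono) auto
    moreover have "(r x)\<^sup>2 < hdist2 y x" using J(2)[of x y] xy hdist2_commute[of x y] by simp
    ultimately show False using zero_le_power2[of t] by (simp add: power_mult_distrib)
  qed
  moreover have "card ?S \<le> N"
  proof (rule N[of p t])
    show "crowd p t ?S"
      unfolding crowd_def
    proof (intro conjI ballI impI)
      show "finite ?S" using J by simp
      show "0 \<le> t" by fact
    next
      fix x assume x: "x \<in> ?S"
      then show "1600 * t\<^sup>2 \<le> hdist2 x p" by simp
      then show "0 < hdist2 x p"
      proof -
        have "1600 * t\<^sup>2 < hdist2 x p" using x by blast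
        then show ?thesis using zero_le_power2[of t] by linarith
      qed
    next
      fix x y assume x: "x \<in> ?S" and y: "y \<in> ?S" and xy: "x \<noteq> y \<and> hdist2 y p \<le> hdist2 x p"
      have "(r x)\<^sup>2 < hdist2 x y" using x y xy J by auto
      moreover have "hdist2 x p \<le> (r x)\<^sup>2 + t * (hgap x p + t)" using x by (simp add: hdist2_commute hgap_commute)
      moreover have "t * (hgap x p + t) \<le> t * (hgap x p + sqrt (hdist2 y p) + t)"
        using t by (intro mult_left_mono) auto
      ultimately show "hdist2 x p - t * (hgap x p + sqrt (hdist2 y p) + t) \<le> hdist2 x y" by linarith
    qed
  qed
  moreover have "card ?A \<le> card (?B \<union> ?S)" using J by (intro card_mono) auto
  ultimately show ?thesis using card_Un_le[of ?B ?S] by linarith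
qed

text \<open>Pairs of centre and radius of nested shells: each later centre lies on every earlier shell.\<close>
definition chain :: "real \<Rightarrow> ('n::finite heis \<times> real) set \<Rightarrow> bool" where
  "chain t Ch \<longleftrightarrow> (\<forall>y k y' k'. (y, k) \<in> Ch \<longrightarrow> (y', k') \<in> Ch \<longrightarrow> (y, k) \<noteq> (y', k') \<longrightarrow> k' \<le> k \<longrightarrow>
     10 * k' \<le> k \<and> y' \<in> hshell t y k)"

lemma chainD:
  assumes "chain t Ch" "(y, k) \<in> Ch" "(y', k') \<in> Ch" "(y, k) \<noteq> (y', k')" "k' \<le> k"
  shows "10 * k' \<le> k \<and> y' \<in> hshell t y k"
  using assms unfolding chain_def by (elim allE impE) assumption+

lemma chain_mono:
  assumes "chain t Ch" "0 \<le> t" "t \<le> t'"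
  shows "chain t' Ch"
  unfolding chain_def
proof (intro allI impI)
  fix y k y' k' assume a: "(y, k) \<in> Ch" "(y', k') \<in> Ch" "(y, k) \<noteq> (y', k')" "k' \<le> k"
  from chainD[OF assms(1) this] have "10 * k' \<le> k \<and> y' \<in> hshell t y k" .
  then show "10 * k' \<le> k \<and> y' \<in> hshell t' y k" using hshell_mono[OF assms(2,3), of y k] by blast
qed

text \<open>Both \<open>p\<close> and each later centre lie on the shell around an earlier centre y,
  so their squared distances from y agree with k^2 up to the thickness. The centres therefore form a
  crowd around \<open>p\<close>, with slack \<open>2 * t\<close> since the thickness is used
  twice.\<close>

lemma chain_bound:
  fixes p :: "'n::finite heis"
  assumes N: "\<And>p T (S::'n heis set). crowd p T S \<Longrightarrow> card S \<le> N"
    and Ch: "finite Ch" "chain t Ch" and t: "0 < t"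
    and p: "\<And>y k. (y, k) \<in> Ch \<Longrightarrow> 1000 * t \<le> k \<and> p \<in> hshell t y k"
  shows "card Ch \<le> N"
proof -
  have rad: "k / 2 \<le> sqrt (hdist2 q y)" "sqrt (hdist2 q y) \<le> 2 * k" if "(y, k) \<in> Ch" "q \<in> hshell t y k" for y k q
    using shell_radius[of t k q y] that t p[OF that(1)] by (auto simp: hshell_def)
  \<comment> \<open>A repeated centre would lie on its own shell, all of whose points are at
    distance at least k/2.\<close>
  have inj: "inj_on fst Ch"
  proof (rule inj_onI, rule ccontr)
    fix a b assume "a \<in> Ch" "b \<in> Ch" "fst a = fst b" "a \<noteq> b"
    then obtain y k k' where y: "(y, k) \<in> Ch" "(y, k') \<in> Ch" "k' \<le> k" "(y, k) \<noteq> (y, k')"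
      by (metis linear prod.collapse)
    then have "y \<in> hshell t y k" using chainD[OF Ch(2) y(1,2,4,3)] by simp
    from rad(1)[OF y(1) this] show False using p[OF y(1)] t by simp
  qed
  have "crowd p (2 * t) (fst ` Ch)"
    unfolding crowd_def
  proof (intro conjI ballI impI)
    show "finite (fst ` Ch)" "0 \<le> 2 * t" using Ch t by auto
  next
    fix y assume "y \<in> fst ` Ch"
    then obtain k where y: "(y, k) \<in> Ch" by auto
    have k: "500 * t \<le> sqrt (hdist2 p y)" using rad(1)[OF y] p[OF y] by fastforce
    then have "(500 * t)\<^sup>2 \<le> (sqrt (hdist2 p y))\<^sup>2" using t by (intro power_mono) auto
    then have q: "250000 * t\<^sup>2 \<le> hdist2 y p" by (simp add: power_mult_distrib hdist2_commute)
    have t2: "0 < t\<^sup>2" using t by simp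
    have "1600 * (2 * t)\<^sup>2 = 6400 * t\<^sup>2" by (simp add: power_mult_distrib)
    then show "1600 * (2 * t)\<^sup>2 \<le> hdist2 y p" using q t2 by linarith
    show "0 < hdist2 y p" using q t2 by linarith
  next
    fix y y' assume "y \<in> fst ` Ch" "y' \<in> fst ` Ch" and yy: "y \<noteq> y' \<and> hdist2 y' p \<le> hdist2 y p"
    then obtain k k' where y: "(y, k) \<in> Ch" "(y', k') \<in> Ch" by auto
    have py: "p \<in> hshell t y k" "p \<in> hshell t y' k'" using p y by auto
    \<comment> \<open>Distances to \<open>p\<close> equal the radii up to a factor 2 and distinct
      radii differ by a factor 10, so the nearer centre has the smaller radius.\<close>
    have "k' \<le> k"
    proof (rule ccontr)
      assume "\<not> ?thesis"
      then have "10 * k \<le> k'" using chainD[OF Ch(2) y(2,1)] yy by auto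
      moreover have "k' / 2 \<le> sqrt (hdist2 p y')" "sqrt (hdist2 p y) \<le> 2 * k" using rad y py by blast+
      moreover have "sqrt (hdist2 p y') \<le> sqrt (hdist2 p y)" using yy by (simp add: hdist2_commute)
      moreover have "0 < k" using p[OF y(1)] t by linarith
      ultimately show False by linarith
    qed
    then have "y' \<in> hshell t y k" using chainD[OF Ch(2) y] yy by auto
    then have 1: "k\<^sup>2 - t * (hgap y' y + t) \<le> hdist2 y y'" by (simp add: hshell_def abs_le_iff hdist2_commute)
    have 2: "hdist2 y p \<le> k\<^sup>2 + t * (hgap y p + t)" using py(1) by (simp add: hshell_def abs_le_iff hdist2_commute hgap_commute)
    have "hgap y' y \<le> hgap y p + sqrt (hdist2 y' p)"
      using hgap_triangle[of y' y p] hgap_le_sqrt_hdist2[of y' p] hgap_commute[of p y] by linarith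
    then have "t * (hgap y' y + t) + t * (hgap y p + t) \<le> t * (hgap y p + sqrt (hdist2 y' p) + t) + t * (hgap y p + t)"
      using t by (intro add_mono mult_left_mono) auto
    also have "\<dots> \<le> 2 * t * (hgap y p + sqrt (hdist2 y' p) + 2 * t)"
      using t by (simp add: algebra_simps)
    finally show "hdist2 y p - 2 * t * (hgap y p + sqrt (hdist2 y' p) + 2 * t) \<le> hdist2 y y'"
      using 1 2 by linarith
  qed
  from N[OF this] show ?thesis by (simp add: card_image[OF inj])
qed

lemma sum_overlap:
  fixes \<nu> :: "'a \<Rightarrow> real"
  assumes \<nu>: "\<And>p. 0 \<le> \<nu> p" and J: "finite J" and V: "finite V" "\<And>x. x \<in> J \<Longrightarrow> S x \<subseteq> V"
    and C: "\<And>p. p \<in> V \<Longrightarrow> card {x\<in>J. p \<in> S x} \<le> C"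
  shows "(\<Sum>x\<in>J. sum \<nu> (S x)) \<le> real C * sum \<nu> V"
proof -
  have "(\<Sum>x\<in>J. sum \<nu> (S x)) = (\<Sum>x\<in>J. \<Sum>p\<in>V. if p \<in> S x then \<nu> p else 0)"
  proof (rule sum.cong[OF refl])
    fix x assume "x \<in> J"
    then have "{p \<in> V. p \<in> S x} = S x" using V(2) by blast
    then show "sum \<nu> (S x) = (\<Sum>p\<in>V. if p \<in> S x then \<nu> p else 0)"
      using sum.inter_filter[OF V(1), of \<nu> "\<lambda>p. p \<in> S x"] by simp
  qed
  also have "\<dots> = (\<Sum>p\<in>V. \<Sum>x\<in>J. if p \<in> S x then \<nu> p else 0)" by (rule sum.swap)
  also have "\<dots> = (\<Sum>p\<in>V. real (card {x\<in>J. p \<in> S x}) * \<nu> p)"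
    using J by (intro sum.cong) (auto simp: sum.If_cases Int_def)
  also have "\<dots> \<le> (\<Sum>p\<in>V. real C * \<nu> p)" using C \<nu> by (intro sum_mono mult_right_mono) auto
  finally show ?thesis by (simp add: sum_distrib_left)
qed

lemma sum_le_cover:
  fixes \<nu> :: "'a \<Rightarrow> real"
  assumes "\<And>p. 0 \<le> \<nu> p" "finite J" "\<And>x. x \<in> J \<Longrightarrow> finite (S x)" "E \<subseteq> (\<Union>x\<in>J. S x)"
  shows "sum \<nu> E \<le> (\<Sum>x\<in>J. sum \<nu> (S x))"
proof -
  have "sum \<nu> E \<le> sum \<nu> (\<Union>x\<in>J. S x)" using assms by (intro sum_mono2) auto
  also have "\<dots> \<le> (\<Sum>x\<in>J. sum \<nu> (S x))"
    using assms(2) assms(3)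
  proof (induction J rule: finite_induct)
    case (insert x J)
    have "sum \<nu> (S x \<union> (\<Union>x\<in>J. S x)) \<le> sum \<nu> (S x) + sum \<nu> (\<Union>x\<in>J. S x)"
      using insert assms(1) sum.union_inter[of "S x" "\<Union>x\<in>J. S x" \<nu>] sum_nonneg[of "S x \<inter> (\<Union>x\<in>J. S x)" \<nu>]
      by simp
    then show ?case using insert by simp
  qed simp
  finally show ?thesis .
qed

section \<open>Induction over scales: sets with many heavy shells have small mass\<close>

definition heavy_shell :: "('n::finite heis \<Rightarrow> real) \<Rightarrow> real \<Rightarrow> real \<Rightarrow> real \<Rightarrow> real \<Rightarrow> 'n heis \<Rightarrow> bool" where
  "heavy_shell \<nu> \<epsilon> t a b e \<longleftrightarrow>
     (\<exists>k. a \<le> k \<and> k \<le> b \<and> \<epsilon> * sum \<nu> (hball e k) \<le> sum \<nu> (hshell t e k))"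

text \<open>Level \<open>i\<close> consists of the radii between \<open>10000 * c i\<close> and \<open>c (Suc i)\<close>; every radius in
  the chain exceeds all levels.\<close>
definition heavy_config where
  "heavy_config \<nu> \<epsilon> t c n Ch E \<longleftrightarrow> (\<forall>p::'n::finite heis. 0 \<le> \<nu> p) \<and> t \<le> c 0 \<and> (\<forall>i<n. 10000 * c i \<le> c (Suc i)) \<and>
     finite E \<and> E \<subseteq> discrete_heis \<and> finite Ch \<and> chain (8 * c 0) Ch \<and>
     (\<forall>(y, k)\<in>Ch. 10000 * c n \<le> k \<and> E \<subseteq> hshell (8 * c 0) y k) \<and>
     (\<forall>e\<in>E. \<forall>i<n. heavy_shell \<nu> \<epsilon> t (10000 * c i) (c (Suc i)) e)"

lemma levels_mono:
  fixes c :: "nat \<Rightarrow> real"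
  assumes "0 < c 0" "\<forall>i<n. 10000 * c i \<le> c (Suc i)" "i \<le> j" "j \<le> n"
  shows "0 < c i" "c i \<le> c j"
proof -
  have pos: "0 < c i" if "i \<le> n" for i using that
  proof (induction i)
    case (Suc i)
    then have "0 < c i" "10000 * c i \<le> c (Suc i)" using assms(2) by auto
    then show ?case by linarith
  qed (use assms in simp)
  show "0 < c i" using pos assms by simp
  show "c i \<le> c j" using assms(3,4)
  proof (induction j rule: dec_induct)
    case (step m)
    then have "0 < c m" "10000 * c m \<le> c (Suc m)" "c i \<le> c m" using pos[of m] assms(2) by auto
    then show ?case by linarith
  qed simp
qed

text \<open>Raising the base scale only thickens the shells of the chain, and lowering the top scale
  only relaxes the demand on its radii, so any block of consecutive levels may be kept.\<close>

lemma heavy_config_shift: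
  assumes cfg: "heavy_config \<nu> \<epsilon> t c n Ch E" and t: "0 < t" and off: "off + n' \<le> n" and D: "D \<subseteq> E"
  shows "heavy_config \<nu> \<epsilon> t (\<lambda>m. c (off + m)) n' Ch D"
proof -
  have c: "0 < c 0" "\<forall>i<n. 10000 * c i \<le> c (Suc i)" using cfg t by (auto simp: heavy_config_def)
  have c1: "0 < c 0" "c 0 \<le> c off" using levels_mono[OF c, of 0 off] off by auto
  have c2: "c (off + n') \<le> c n" using levels_mono[OF c, of "off + n'" n] off by auto
  have m: "hshell (8 * c 0) y k \<subseteq> hshell (8 * c off) y k" for y k using c1 by (intro hshell_mono) auto
  show ?thesis
    unfolding heavy_config_def
  proof (intro conjI)
    show "chain (8 * c (off + 0)) Ch" using cfg c1 chain_mono[of "8 * c 0" Ch "8 * c off"] by (simp add: heavy_config_def)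
    show "\<forall>(y, k)\<in>Ch. 10000 * c (off + n') \<le> k \<and> D \<subseteq> hshell (8 * c (off + 0)) y k"
    proof clarify
      fix y k assume "(y, k) \<in> Ch"
      then have "10000 * c n \<le> k" "E \<subseteq> hshell (8 * c 0) y k" using cfg by (auto simp: heavy_config_def)
      then show "10000 * c (off + n') \<le> k \<and> D \<subseteq> hshell (8 * c (off + 0)) y k" using c2 D m[of y k] by auto
    qed
    show "t \<le> c (off + 0)" using cfg c1 by (auto simp: heavy_config_def)
    show "finite D" "D \<subseteq> discrete_heis" using cfg D by (auto simp: heavy_config_def finite_subset)
    show "\<forall>e\<in>D. \<forall>i<n'. heavy_shell \<nu> \<epsilon> t (10000 * c (off + i)) (c (off + Suc i)) e"
    proof (intro ballI allI impI)
      fix e i assume "e \<in> D" "i < n'"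
      then have "e \<in> E" "off + i < n" using D off by auto
      then show "heavy_shell \<nu> \<epsilon> t (10000 * c (off + i)) (c (off + Suc i)) e"
        using cfg by (auto simp: heavy_config_def)
    qed
  qed (use cfg off in \<open>auto simp: heavy_config_def\<close>)
qed

text \<open>Every point of \<open>E0\<close> lies on all shells of the chain, hence so does the new
  centre \<open>x\<close>. It comes from a larger set than \<open>E\<close> because a centre does
  not lie on its own shell. The strict inequality \<open>k < k'\<close> makes the new radius the
  last in the order of the chain.\<close>

lemma heavy_config_insert:
  assumes cfg: "heavy_config \<nu> \<epsilon> t c n Ch E" and cfg0: "heavy_config \<nu> \<epsilon> t c m Ch E0" and x: "x \<in> E0"
    and k: "10000 * c n \<le> k" "0 \<le> k" "\<And>y' k'. (y', k') \<in> Ch \<Longrightarrow> 10 * k \<le> k' \<and> k < k'" and E: "E \<subseteq> hshell (8 * c 0) x k"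
  shows "heavy_config \<nu> \<epsilon> t c n (insert (x, k) Ch) E" "card (insert (x, k) Ch) = Suc (card Ch)"
proof -
  have x': "x \<in> hshell (8 * c 0) y k'" if "(y, k') \<in> Ch" for y k' using cfg0 x that by (auto simp: heavy_config_def)
  have "chain (8 * c 0) (insert (x, k) Ch)"
    unfolding chain_def
  proof (intro allI impI)
    fix y j y' j' assume a: "(y, j) \<in> insert (x, k) Ch" "(y', j') \<in> insert (x, k) Ch" "(y, j) \<noteq> (y', j')" "j' \<le> j"
    show "10 * j' \<le> j \<and> y' \<in> hshell (8 * c 0) y j"
    proof (cases "(y, j) = (x, k)")
      case True
      then show ?thesis using a k(3)[of y' j'] by auto
    next
      case False
      then have yj: "(y, j) \<in> Ch" using a by auto
      show ?thesis
      proof (cases "(y', j') = (x, k)")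
        case True
        then show ?thesis using yj k(3) x' by auto
      next
        case False
        then have y': "(y', j') \<in> Ch" using a by auto
        have "chain (8 * c 0) Ch" using cfg by (simp add: heavy_config_def)
        from chainD[OF this yj y' a(3,4)] show ?thesis .
      qed
    qed
  qed
  then show "heavy_config \<nu> \<epsilon> t c n (insert (x, k) Ch) E" using cfg k E by (simp add: heavy_config_def)
  have "(x, k) \<notin> Ch" using k(3) by blast
  then show "card (insert (x, k) Ch) = Suc (card Ch)" using cfg by (simp add: heavy_config_def)
qed

text \<open>Removing from \<open>E\<close> what lies on the thickened shells keeps the shells chosen at lower levels disjoint
  from those of the present level.\<close>
lemma heavy_config_peel:
  fixes E :: "'n::finite heis set"
  assumes N: "\<And>p T (S::'n heis set). crowd p T S \<Longrightarrow> card S \<le> N"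
    and \<epsilon>: "0 < \<epsilon>" and t: "0 < t" and \<eta>: "0 \<le> \<eta>"
    and thin: "\<And>Ch D. heavy_config \<nu> \<epsilon> t (\<lambda>m. c (off + m)) n' Ch D \<Longrightarrow> N < card Ch + d \<Longrightarrow>
      sum \<nu> D \<le> \<eta> * sum \<nu> (hnbhd D (2 * c (off + n')))"
    and cfg: "heavy_config \<nu> \<epsilon> t c (Suc (off + n')) Ch E" and card: "N < card Ch + Suc d"
  shows "\<exists>E' Z. E' \<subseteq> E \<and> Z \<subseteq> hnbhd E (2 * c (Suc (off + n'))) \<and> Z \<inter> hnbhd E' (2 * c off) = {} \<and>
    \<epsilon> * sum \<nu> E \<le> real (Suc N) * sum \<nu> Z \<and>
    sum \<nu> E \<le> sum \<nu> E' + \<eta> * real (Suc N) * sum \<nu> (hnbhd E (2 * c (Suc (off + n'))))"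
proof -
  define i where "i = off + n'"
  have \<nu>: "\<And>p. 0 \<le> \<nu> p" and t0: "t \<le> c 0" and lev: "\<forall>i<Suc (off + n'). 10000 * c i \<le> c (Suc i)"
    and finE: "finite E" and EG: "E \<subseteq> discrete_heis" and finCh: "finite Ch"
    using cfg by (auto simp: heavy_config_def)
  have c0: "0 < c 0" using t t0 by simp
  note mono = levels_mono[OF c0 lev]
  have cpos: "0 < c off" "c 0 \<le> c off" "c off \<le> c i" "0 < c i" "0 < c (Suc i)" "10000 * c i \<le> c (Suc i)"
    using mono[of off off] mono[of 0 off] mono[of off i] mono[of i i] mono[of "Suc i" "Suc i"] lev
    by (auto simp: i_def)
  let ?V = "hnbhd E (2 * c (Suc i))"
  have finV: "finite ?V" using finE EG by simp
  have "\<forall>e\<in>E. heavy_shell \<nu> \<epsilon> t (10000 * c i) (c (Suc i)) e" using cfg by (auto simp: heavy_config_def i_def)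
  then obtain k where k: "\<And>e. e \<in> E \<Longrightarrow> 10000 * c i \<le> k e \<and> k e \<le> c (Suc i) \<and>
      \<epsilon> * sum \<nu> (hball e (k e)) \<le> sum \<nu> (hshell t e (k e))"
    unfolding heavy_shell_def by metis
  have k0: "0 \<le> k e" if "e \<in> E" for e using k[OF that] cpos by linarith
  have "\<exists>J\<subseteq>E. (\<forall>x\<in>J. \<forall>y\<in>J. x \<noteq> y \<longrightarrow> (k x)\<^sup>2 < hdist2 x y) \<and> (\<forall>e\<in>E. \<exists>x\<in>J. hdist2 e x \<le> (k x)\<^sup>2)"
    by (rule greedy_cover[OF finE k0])
  then obtain J where J1: "J \<subseteq> E" and J2: "\<forall>x\<in>J. \<forall>y\<in>J. x \<noteq> y \<longrightarrow> (k x)\<^sup>2 < hdist2 x y"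
    and J3: "\<forall>e\<in>E. \<exists>x\<in>J. hdist2 e x \<le> (k x)\<^sup>2"
    by (elim exE conjE)
  note J = J1 J2[rule_format] J3[rule_format]
  have finJ: "finite J" using J finE finite_subset by blast
  have JG: "x \<in> discrete_heis" if "x \<in> J" for x using that J EG by blast
  \<comment> \<open>The largest thickness that occurs: \<open>8 * c off\<close> for a slab plus
    \<open>3 * (2 * c i)\<close> for its neighbourhood. As \<open>200 * ?u\<close> is below
    \<open>10000 * c i\<close>, \<open>overlap_bound\<close> applies to all selected radii.\<close>
  let ?u = "14 * c i"
  have over: "card {x\<in>J. p \<in> S x} \<le> Suc N"
    if S: "\<And>x. x \<in> J \<Longrightarrow> S x \<subseteq> hshell ?u x (k x)" for p and S :: "'n heis \<Rightarrow> 'n heis set"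
  proof -
    have "card {x\<in>J. p \<in> S x} \<le> card {x\<in>J. hdist2 p x \<le> (k x)\<^sup>2 + ?u * (hgap p x + ?u)}"
    proof (rule card_mono)
      show "{x\<in>J. p \<in> S x} \<subseteq> {x\<in>J. hdist2 p x \<le> (k x)\<^sup>2 + ?u * (hgap p x + ?u)}"
      proof clarify
        fix a b assume ab: "(a, b) \<in> J" "p \<in> S (a, b)"
        then have "p \<in> hshell ?u (a, b) (k (a, b))" using S by blast
        then show "hdist2 p (a, b) \<le> (k (a, b))\<^sup>2 + ?u * (hgap p (a, b) + ?u)"
          unfolding hshell_def abs_le_iff by simp
      qed
    qed (use finJ in simp)
    also have "\<dots> \<le> Suc N"
    proof (rule overlap_bound[OF N finJ J(2)])
      fix x assume "x \<in> J"
      then have "10000 * c i \<le> k x" using k J(1) by blast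
      then show "200 * ?u \<le> k x" using cpos by linarith
    qed (use cpos in auto)
    finally show ?thesis .
  qed
  define Z where "Z = (\<Union>x\<in>J. hshell t x (k x))"
  have tu: "t \<le> ?u" using t0 cpos by linarith
  have shell_sub: "hshell s x (k x) \<subseteq> ?V" if "x \<in> J" "0 \<le> s" "s \<le> ?u" for x s
  proof
    fix p assume p: "p \<in> hshell s x (k x)"
    have kx: "10000 * c i \<le> k x" "k x \<le> c (Suc i)" using k[of x] that(1) J1 by blast+
    then have "100 * s \<le> k x" using that cpos by linarith
    then have "p \<in> hball x (2 * k x)" using hshell_subset_hball that p by blast
    moreover have "hball x (2 * k x) \<subseteq> hball x (2 * c (Suc i))" using kx cpos by (intro hball_mono) auto
    ultimately have "p \<in> hball x (2 * c (Suc i))" by blast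
    then show "p \<in> ?V" using that J(1) unfolding hball_def hnbhd_def by blast
  qed
  have ZV: "Z \<subseteq> ?V" unfolding Z_def using shell_sub[of _ t] t tu by auto
  have gain: "\<epsilon> * sum \<nu> E \<le> real (Suc N) * sum \<nu> Z"
  proof -
    have "sum \<nu> E \<le> (\<Sum>x\<in>J. sum \<nu> (hball x (k x)))"
    proof (rule sum_le_cover[OF \<nu> finJ])
      show "E \<subseteq> (\<Union>x\<in>J. hball x (k x))" using J(3) EG by (fastforce simp: hball_def)
    qed (use JG in simp)
    then have "\<epsilon> * sum \<nu> E \<le> (\<Sum>x\<in>J. \<epsilon> * sum \<nu> (hball x (k x)))"
      using \<epsilon> by (simp flip: sum_distrib_left)
    also have "\<dots> \<le> (\<Sum>x\<in>J. sum \<nu> (hshell t x (k x)))" using k J1 by (intro sum_mono) blast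
    also have "\<dots> \<le> real (Suc N) * sum \<nu> Z"
    proof (rule sum_overlap[OF \<nu> finJ])
      show "finite Z" using ZV finV finite_subset by blast
      show "card {x \<in> J. p \<in> hshell t x (k x)} \<le> Suc N" for p
        using t tu by (intro over hshell_mono) auto
    qed (auto simp: Z_def)
    finally show ?thesis .
  qed
  \<comment> \<open>A point of \<open>E\<close> within \<open>2 * c off\<close> of a shell of
    thickness \<open>t\<close> lies in the shell of thickness \<open>t + 3 * (2 * c off)\<close>,
    hence in this slab, since \<open>t\<close> is at most \<open>c off\<close>.\<close>
  define D where "D x = E \<inter> hshell (8 * c off) x (k x)" for x
  define E' where "E' = E - (\<Union>x\<in>J. D x)"
  have disj: "Z \<inter> hnbhd E' (2 * c off) = {}"
  proof (rule ccontr)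
    assume "\<not> ?thesis"
    then obtain p e x where p: "x \<in> J" "p \<in> hshell t x (k x)" "e \<in> E'" "hdist2 p e \<le> (2 * c off)\<^sup>2"
      unfolding Z_def hnbhd_def by blast
    have eE: "e \<in> E" using p by (simp add: E'_def)
    have "e \<in> hshell (t + 3 * (2 * c off)) x (k x)"
      using p eE EG cpos t by (intro hshell_move[of t "2 * c off" p]) auto
    moreover have "hshell (t + 3 * (2 * c off)) x (k x) \<subseteq> hshell (8 * c off) x (k x)"
      using t t0 cpos by (intro hshell_mono) auto
    ultimately have "e \<in> D x" using eE by (auto simp: D_def)
    then show False using p by (auto simp: E'_def)
  qed
  \<comment> \<open>The slab lies near the shell of \<open>x\<close>, so \<open>(x, k x)\<close>
    prolongs the chain, and the assumption for longer chains applies to the lower levels.\<close>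
  have thinD: "sum \<nu> (D x) \<le> \<eta> * sum \<nu> (hnbhd (D x) (2 * c i))" if x: "x \<in> J" for x
  proof -
    have kx: "10000 * c i \<le> k x" "k x \<le> c (Suc i)" using k[of x] x J1 by blast+
    have cfg0: "heavy_config \<nu> \<epsilon> t (\<lambda>m. c (off + m)) n' Ch E"
      by (rule heavy_config_shift[OF cfg t]) auto
    have cfg1: "heavy_config \<nu> \<epsilon> t (\<lambda>m. c (off + m)) n' Ch (D x)"
      by (rule heavy_config_shift[OF cfg t]) (auto simp: D_def)
    have big: "10 * k x \<le> k' \<and> k x < k'" if "(y', k') \<in> Ch" for y' k'
    proof -
      have "10000 * c (Suc i) \<le> k'" using cfg that by (auto simp: heavy_config_def i_def)
      then show ?thesis using kx cpos by linarith
    qed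
    have xE: "x \<in> E" using x J by blast
    have "10000 * c (off + n') \<le> k x" using kx by (simp add: i_def)
    moreover have "D x \<subseteq> hshell (8 * c (off + 0)) x (k x)" by (auto simp: D_def)
    ultimately have "heavy_config \<nu> \<epsilon> t (\<lambda>m. c (off + m)) n' (insert (x, k x) Ch) (D x)"
      and "card (insert (x, k x) Ch) = Suc (card Ch)"
      using heavy_config_insert[OF cfg1 cfg0 xE, of "k x"] big k0[OF xE] by blast+
    then show ?thesis using thin[of "insert (x, k x) Ch" "D x"] card by (simp add: i_def)
  qed
  have nbD: "hnbhd (D x) (2 * c i) \<subseteq> hshell ?u x (k x)" if x: "x \<in> J" for x
  proof
    fix p assume "p \<in> hnbhd (D x) (2 * c i)"
    then obtain e where e: "p \<in> discrete_heis" "e \<in> D x" "hdist2 e p \<le> (2 * c i)\<^sup>2"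
      by (auto simp: hnbhd_def hdist2_commute)
    have "p \<in> hshell (8 * c off + 3 * (2 * c i)) x (k x)"
      using e cpos by (intro hshell_move[of _ "2 * c i" e]) (auto simp: D_def)
    moreover have "hshell (8 * c off + 3 * (2 * c i)) x (k x) \<subseteq> hshell ?u x (k x)"
      using cpos by (intro hshell_mono) auto
    ultimately show "p \<in> hshell ?u x (k x)" by blast
  qed
  have loss: "sum \<nu> (\<Union>x\<in>J. D x) \<le> \<eta> * real (Suc N) * sum \<nu> ?V"
  proof -
    have "sum \<nu> (\<Union>x\<in>J. D x) \<le> (\<Sum>x\<in>J. sum \<nu> (D x))"
      by (rule sum_le_cover[OF \<nu> finJ]) (use finE in \<open>auto simp: D_def\<close>)
    also have "\<dots> \<le> (\<Sum>x\<in>J. \<eta> * sum \<nu> (hnbhd (D x) (2 * c i)))" by (intro sum_mono thinD)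
    also have "\<dots> = \<eta> * (\<Sum>x\<in>J. sum \<nu> (hnbhd (D x) (2 * c i)))" by (simp add: sum_distrib_left)
    also have "\<dots> \<le> \<eta> * (real (Suc N) * sum \<nu> ?V)"
    proof (intro mult_left_mono \<eta> sum_overlap[OF \<nu> finJ finV])
      show "hnbhd (D x) (2 * c i) \<subseteq> ?V" if "x \<in> J" for x
        using nbD[OF that] shell_sub[OF that, of ?u] cpos by auto
      show "card {x \<in> J. p \<in> hnbhd (D x) (2 * c i)} \<le> Suc N" for p by (rule over[OF nbD])
    qed
    finally show ?thesis by (simp add: mult.assoc)
  qed
  have "sum \<nu> E = sum \<nu> E' + sum \<nu> (\<Union>x\<in>J. D x)"
    unfolding E'_def by (rule sum.subset_diff) (use finE in \<open>auto simp: D_def\<close>)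
  then have "sum \<nu> E \<le> sum \<nu> E' + \<eta> * real (Suc N) * sum \<nu> ?V" using loss by linarith
  moreover have "E' \<subseteq> E" by (auto simp: E'_def)
  ultimately show ?thesis using ZV disj gain unfolding i_def by blast
qed

text \<open>Each block of \<open>Suc n'\<close> levels allows one peeling: its top level supplies
  the shells, and the \<open>n'\<close> levels below show that the removed slabs are thin. The gains
  of the blocks are disjoint and fit into one neighbourhood of \<open>E\<close>. Every loss shrinks
  the set from which all remaining blocks gain, whence the quadratic error.\<close>

lemma heavy_config_blocks:
  fixes \<nu> :: "'n::finite heis \<Rightarrow> real"
  assumes N: "\<And>p T (S::'n heis set). crowd p T S \<Longrightarrow> card S \<le> N"
    and \<epsilon>: "0 < \<epsilon>" and t: "0 < t" and \<eta>: "0 \<le> \<eta>"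
    and thin: "\<And>c Ch D. heavy_config \<nu> \<epsilon> t c n' Ch D \<Longrightarrow> N < card Ch + d \<Longrightarrow>
      sum \<nu> D \<le> \<eta> * sum \<nu> (hnbhd D (2 * c n'))"
    and cfg: "heavy_config \<nu> \<epsilon> t c (m * Suc n') Ch E" and card: "N < card Ch + Suc d"
  shows "real m * \<epsilon> * sum \<nu> E \<le> real (Suc N) * (1 + (real m)\<^sup>2 * \<epsilon> * \<eta>) * sum \<nu> (hnbhd E (2 * c (m * Suc n')))"
  using cfg
proof (induction m arbitrary: E)
  case 0
  then have "0 \<le> \<nu> p" for p unfolding heavy_config_def by blast
  then show ?case by (simp add: sum_nonneg)
next
  case (Suc m)
  define off where "off = m * Suc n'"
  have eq: "Suc m * Suc n' = Suc (off + n')" by (simp add: off_def)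
  note cfg = Suc.prems[unfolded eq]
  let ?V = "hnbhd E (2 * c (Suc (off + n')))"
  have "\<exists>E' Z. E' \<subseteq> E \<and> Z \<subseteq> ?V \<and> Z \<inter> hnbhd E' (2 * c off) = {} \<and>
      \<epsilon> * sum \<nu> E \<le> real (Suc N) * sum \<nu> Z \<and>
      sum \<nu> E \<le> sum \<nu> E' + \<eta> * real (Suc N) * sum \<nu> ?V"
  proof (rule heavy_config_peel[where d = d, OF _ \<epsilon> t \<eta> _ cfg card])
    show "card S \<le> N" if "crowd p T S" for p T and S :: "'n heis set" using that by (rule N)
    show "sum \<nu> D \<le> \<eta> * sum \<nu> (hnbhd D (2 * c (off + n')))"
      if "heavy_config \<nu> \<epsilon> t (\<lambda>m. c (off + m)) n' Ch D" "N < card Ch + d" for Ch D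
      using that by (rule thin)
  qed
  then obtain E' Z where E': "E' \<subseteq> E" and Z: "Z \<subseteq> ?V" "Z \<inter> hnbhd E' (2 * c off) = {}"
    and gain: "\<epsilon> * sum \<nu> E \<le> real (Suc N) * sum \<nu> Z"
    and loss: "sum \<nu> E \<le> sum \<nu> E' + \<eta> * real (Suc N) * sum \<nu> ?V"
    by (elim exE conjE)
  have \<nu>: "\<And>p. 0 \<le> \<nu> p" and finE: "finite E" and EG: "E \<subseteq> discrete_heis" and t0: "t \<le> c 0"
    and lev: "\<forall>i<Suc (off + n'). 10000 * c i \<le> c (Suc i)"
    using cfg by (auto simp: heavy_config_def)
  have c0: "0 < c 0" using t t0 by simp
  have co: "0 < c off" "c off \<le> c (Suc (off + n'))"
    using levels_mono[OF c0 lev, of off "Suc (off + n')"] by auto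
  have finV: "finite ?V" using finE EG by simp
  let ?W = "hnbhd E' (2 * c off)"
  have W: "?W \<subseteq> ?V" using E' co by (intro hnbhd_mono) auto
  have "heavy_config \<nu> \<epsilon> t (\<lambda>i. c (0 + i)) (m * Suc n') Ch E'"
    by (rule heavy_config_shift[OF cfg t _ E']) (simp add: off_def)
  then have IH: "real m * \<epsilon> * sum \<nu> E' \<le> real (Suc N) * (1 + (real m)\<^sup>2 * \<epsilon> * \<eta>) * sum \<nu> ?W"
    using Suc.IH[of E'] by (simp add: off_def)
  have finZ: "finite Z" "finite ?W" using Z W finV finite_subset by blast+
  have "sum \<nu> Z + sum \<nu> ?W = sum \<nu> (Z \<union> ?W)" using finZ Z(2) by (simp add: sum.union_disjoint)
  also have "\<dots> \<le> sum \<nu> ?V" using finV Z W \<nu> by (intro sum_mono2) auto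
  finally have zw: "sum \<nu> Z + sum \<nu> ?W \<le> sum \<nu> ?V" .
  define C A v z w e e' where "C = real (Suc N)" "A = 1 + (real m)\<^sup>2 * \<epsilon> * \<eta>"
    "v = sum \<nu> ?V" "z = sum \<nu> Z" "w = sum \<nu> ?W" "e = sum \<nu> E" "e' = sum \<nu> E'"
  note ds = this
  have nn: "0 \<le> v" "0 \<le> z" "0 \<le> w" "0 \<le> e" using \<nu> by (auto simp: ds intro: sum_nonneg)
  have A: "1 \<le> A" using \<epsilon> \<eta> by (simp add: ds)
  have C: "0 \<le> C" by (simp add: ds)
  have 1: "\<epsilon> * e \<le> C * A * z"
  proof -
    have "\<epsilon> * e \<le> C * z" using gain by (simp add: ds)
    also have "\<dots> = C * z * 1" by simp
    also have "\<dots> \<le> C * z * A" using A C nn by (intro mult_left_mono) auto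
    finally show ?thesis by (simp add: algebra_simps)
  qed
  have 2: "real m * \<epsilon> * e \<le> C * A * w + real m * \<epsilon> * (\<eta> * C * v)"
  proof -
    have "real m * \<epsilon> * e \<le> real m * \<epsilon> * (e' + \<eta> * C * v)" using loss \<epsilon> by (intro mult_left_mono) (auto simp: ds)
    also have "\<dots> = real m * \<epsilon> * e' + real m * \<epsilon> * (\<eta> * C * v)" by (simp add: algebra_simps)
    finally show ?thesis using IH by (simp add: ds)
  qed
  have 3: "C * A * z + C * A * w \<le> C * A * v"
  proof -
    have "C * A * (z + w) \<le> C * A * v" using zw A C by (intro mult_left_mono) (auto simp: ds)
    then show ?thesis by (simp add: algebra_simps)
  qed
  have "real (Suc m) * \<epsilon> * e = \<epsilon> * e + real m * \<epsilon> * e" by (simp add: algebra_simps)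
  also have "\<dots> \<le> C * A * v + real m * \<epsilon> * (\<eta> * C * v)" using 1 2 3 by linarith
  also have "\<dots> = C * (1 + ((real m)\<^sup>2 + real m) * (\<epsilon> * \<eta>)) * v" by (simp add: ds algebra_simps)
  also have "\<dots> \<le> C * (1 + (real (Suc m))\<^sup>2 * (\<epsilon> * \<eta>)) * v"
  proof -
    have "(real m)\<^sup>2 + real m \<le> (real (Suc m))\<^sup>2" by (simp add: power2_eq_square algebra_simps)
    then have "((real m)\<^sup>2 + real m) * (\<epsilon> * \<eta>) \<le> (real (Suc m))\<^sup>2 * (\<epsilon> * \<eta>)" using \<epsilon> \<eta> by (intro mult_right_mono) auto
    then show ?thesis using C nn by (intro mult_right_mono mult_left_mono) auto
  qed
  finally show ?case unfolding eq by (simp add: ds mult.assoc)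
qed

text \<open>Induction on \<open>d\<close>, a bound for how many centres the chain may still acquire
  before exceeding N. Once it is longer than N, \<open>chain_bound\<close> leaves no point common to
  its shells and \<open>E\<close> is empty; otherwise the bound for longer chains feeds
  \<open>heavy_config_blocks\<close>.\<close>

lemma heavy_config_thin_aux:
  assumes N: "\<And>p T (S::'n::finite heis set). crowd p T S \<Longrightarrow> card S \<le> N"
    and \<epsilon>: "0 < \<epsilon>" and t: "0 < t"
  shows "0 < \<eta> \<Longrightarrow> \<exists>n. \<forall>(\<nu>::'n heis \<Rightarrow> real) c Ch E. heavy_config \<nu> \<epsilon> t c n Ch E \<and> N < card Ch + d \<longrightarrow>
      sum \<nu> E \<le> \<eta> * sum \<nu> (hnbhd E (2 * c n))"
proof (induction d arbitrary: \<eta>)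
  case 0
  have "sum \<nu> E \<le> \<eta> * sum \<nu> (hnbhd E (2 * c 0))"
    if cfg: "heavy_config \<nu> \<epsilon> t c 0 Ch E" and card: "N < card Ch" for \<nu> :: "'n heis \<Rightarrow> real" and c Ch E
  proof -
    have \<nu>: "0 \<le> \<nu> p" for p using cfg unfolding heavy_config_def by blast
    have "E = {}"
    proof (rule ccontr)
      assume "E \<noteq> {}"
      then obtain p where p: "p \<in> E" by blast
      have c0: "0 < c 0" using cfg t by (simp add: heavy_config_def)
      have "card Ch \<le> N"
      proof (rule chain_bound[where Ch = Ch and t = "8 * c 0" and p = p, OF N])
        fix y k assume "(y, k) \<in> Ch"
        then have "10000 * c 0 \<le> k" "E \<subseteq> hshell (8 * c 0) y k" using cfg by (auto simp: heavy_config_def)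
        then show "1000 * (8 * c 0) \<le> k \<and> p \<in> hshell (8 * c 0) y k" using c0 p by auto
      qed (use cfg c0 in \<open>auto simp: heavy_config_def\<close>)
      then show False using card by simp
    qed
    then show ?thesis using 0 by (simp add: hnbhd_def)
  qed
  then show ?case by (intro exI[of _ 0]) auto
next
  case (Suc d)
  define C where "C = real (Suc N)"
  have C: "0 < C" by (simp add: C_def)
  \<comment> \<open>So many blocks that 2 C / (m \<epsilon>) falls below \<eta>. The tolerance
    \<open>\<eta>'\<close> chosen next makes the quadratic error term equal to 1, so the accumulated
    losses cost just the factor 2.\<close>
  obtain m :: nat where m: "2 * C / (\<eta> * \<epsilon>) < real m" using reals_Archimedean2 by blast
  have me: "0 < \<eta> * \<epsilon>" using Suc.prems \<epsilon> by simp
  then have m0: "0 < real m" using m C by (meson divide_pos_pos less_trans mult_pos_pos zero_less_numeral)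
  have m2: "2 * C \<le> \<eta> * (real m * \<epsilon>)" using m me by (simp add: field_simps)
  define \<eta>' where "\<eta>' = 1 / ((real m)\<^sup>2 * \<epsilon>)"
  have \<eta>': "0 < \<eta>'" using m0 \<epsilon> by (simp add: \<eta>'_def)
  from Suc.IH[OF \<eta>'] obtain n' where n': "\<And>(\<nu>::'n heis \<Rightarrow> real) c Ch E.
      heavy_config \<nu> \<epsilon> t c n' Ch E \<Longrightarrow> N < card Ch + d \<Longrightarrow> sum \<nu> E \<le> \<eta>' * sum \<nu> (hnbhd E (2 * c n'))"
    by blast
  have "sum \<nu> E \<le> \<eta> * sum \<nu> (hnbhd E (2 * c (m * Suc n')))"
    if cfg: "heavy_config \<nu> \<epsilon> t c (m * Suc n') Ch E" and card: "N < card Ch + Suc d"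
    for \<nu> :: "'n heis \<Rightarrow> real" and c Ch E
  proof -
    let ?v = "sum \<nu> (hnbhd E (2 * c (m * Suc n')))"
    have v: "0 \<le> ?v" using cfg by (auto simp: heavy_config_def intro: sum_nonneg)
    have "real m * \<epsilon> * sum \<nu> E \<le> C * (1 + (real m)\<^sup>2 * \<epsilon> * \<eta>') * ?v"
      unfolding C_def
    proof (rule heavy_config_blocks[where d = d, OF _ \<epsilon> t _ _ cfg card])
      show "card S \<le> N" if "crowd p T S" for p T and S :: "'n heis set" using that by (rule N)
      show "sum \<nu> D \<le> \<eta>' * sum \<nu> (hnbhd D (2 * c n'))"
        if "heavy_config \<nu> \<epsilon> t c n' Ch D" "N < card Ch + d" for c Ch D
        using that by (rule n')
    qed (use \<eta>' in simp)
    also have "(real m)\<^sup>2 * \<epsilon> * \<eta>' = 1" using m0 \<epsilon> by (simp add: \<eta>'_def)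
    also have "C * (1 + 1) * ?v = 2 * C * ?v" by simp
    also have "\<dots> \<le> \<eta> * (real m * \<epsilon>) * ?v" using m2 v by (intro mult_right_mono)
    finally have "(real m * \<epsilon>) * sum \<nu> E \<le> (real m * \<epsilon>) * (\<eta> * ?v)" by (simp add: algebra_simps)
    then show ?thesis using m0 \<epsilon> by (simp add: mult_le_cancel_left_pos)
  qed
  then show ?case by blast
qed

text \<open>The number of levels depends neither on the weight nor on the scales nor on the set;
  this uniformity is what transference requires.\<close>

lemma heavy_config_thin:
  assumes "0 < \<epsilon>" "0 < t" "0 < \<eta>"
  shows "\<exists>n. \<forall>(\<nu>::'n::finite heis \<Rightarrow> real) c E. heavy_config \<nu> \<epsilon> t c n {} E \<longrightarrow>
      sum \<nu> E \<le> \<eta> * sum \<nu> (hnbhd E (2 * c n))"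
proof -
  obtain N where N: "\<And>p T (S::'n heis set). crowd p T S \<Longrightarrow> card S \<le> N" using crowd_bound by blast
  have "\<exists>n. \<forall>(\<nu>::'n heis \<Rightarrow> real) c Ch E. heavy_config \<nu> \<epsilon> t c n Ch E \<and> N < card Ch + Suc N \<longrightarrow>
      sum \<nu> E \<le> \<eta> * sum \<nu> (hnbhd E (2 * c n))"
    by (rule heavy_config_thin_aux[OF _ assms]) (rule N)
  then show ?thesis by (metis add.left_neutral card.empty lessI)
qed

section \<open>Transference to the action\<close>

text \<open>For arbitrary \<open>t\<close> and \<open>k\<close>, the inequality between arithmetic
  and geometric mean absorbs the thickness into half of the squared distance.\<close>

lemma finite_hshell [simp]:
  assumes x: "x \<in> discrete_heis" and t: "0 \<le> t"
  shows "finite (hshell t x k)"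
proof (rule finite_subset)
  show "hshell t x k \<subseteq> hball x (2 * (\<bar>k\<bar> + 100 * t))"
  proof
    fix p assume p: "p \<in> hshell t x k"
    define h where "h = hgap p x"
    have h: "0 \<le> h" "h\<^sup>2 \<le> hdist2 p x" using hgap_le_hdist2[of p x] by (simp_all add: h_def)
    have q: "hdist2 p x \<le> k\<^sup>2 + t * h + t\<^sup>2"
      using p by (simp add: hshell_def h_def abs_le_iff power2_eq_square algebra_simps)
    have "t * h \<le> h\<^sup>2 / 2 + t\<^sup>2 / 2" using zero_le_power2[of "t - h"] by (simp add: power2_eq_square algebra_simps)
    then have "hdist2 p x \<le> 2 * k\<^sup>2 + 3 * t\<^sup>2" using q h by linarith
    also have "\<dots> \<le> (2 * (\<bar>k\<bar> + 100 * t))\<^sup>2"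
    proof -
      have "(2 * (\<bar>k\<bar> + 100 * t))\<^sup>2 = 4 * k\<^sup>2 + 800 * (\<bar>k\<bar> * t) + 40000 * t\<^sup>2"
        by (simp add: power2_eq_square algebra_simps)
      moreover have "0 \<le> \<bar>k\<bar> * t" using t by simp
      ultimately show ?thesis using zero_le_power2[of k] zero_le_power2[of t] by linarith
    qed
    finally show "p \<in> hball x (2 * (\<bar>k\<bar> + 100 * t))" using p by (simp add: hball_def hshell_def)
  qed
qed (use x in simp)

text \<open>The action and the cocycle \<open>V\<close> of Radon-Nikodym derivatives may be arbitrary off the discrete group,
  as long as they stay measurable and positive.\<close>
locale heis_flow = prob_space M for M :: "'x measure" +
  fixes act :: "'n::finite heis \<Rightarrow> 'x \<Rightarrow> 'x" and V :: "'n heis \<Rightarrow> 'x \<Rightarrow> real"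
  assumes act_measurable [measurable]: "act g \<in> M \<rightarrow>\<^sub>M M"
    and act_zero: "x \<in> space M \<Longrightarrow> act heis_zero x = x"
    and act_mult: "g \<in> discrete_heis \<Longrightarrow> h \<in> discrete_heis \<Longrightarrow> x \<in> space M \<Longrightarrow>
      act (heis_mult g h) x = act g (act h x)"
    and V_measurable [measurable]: "V g \<in> borel_measurable M"
    and V_pos: "0 < V g x"
    and V_mult: "g \<in> discrete_heis \<Longrightarrow> h \<in> discrete_heis \<Longrightarrow> x \<in> space M \<Longrightarrow>
      V (heis_mult g h) x = V g (act h x) * V h x"
    and V_change: "g \<in> discrete_heis \<Longrightarrow> \<phi> \<in> borel_measurable M \<Longrightarrow>
      (\<integral>\<^sup>+x. \<phi> (act g x) * ennreal (V g x) \<partial>M) = (\<integral>\<^sup>+x. \<phi> x \<partial>M)"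
begin

lemma act_space [simp]: "x \<in> space M \<Longrightarrow> act g x \<in> space M"
  using act_measurable[of g] by (rule measurable_space)

lemma V_nonneg [simp]: "0 \<le> V g x"
  using V_pos less_imp_le by blast

lemma V_zero: "x \<in> space M \<Longrightarrow> V heis_zero x = 1"
  using V_mult[of heis_zero heis_zero x] V_pos[of heis_zero x] by (simp add: act_zero)

lemma act_inv [simp]:
  assumes "g \<in> discrete_heis" "x \<in> space M"
  shows "act (heis_inv g) (act g x) = x" "act g (act (heis_inv g) x) = x"
  using act_mult[of "heis_inv g" g x] act_mult[of g "heis_inv g" x] assms by (simp_all add: act_zero)

lemma V_inv:
  assumes "g \<in> discrete_heis" "x \<in> space M"
  shows "V (heis_inv g) (act g x) * V g x = 1"
  using V_mult[of "heis_inv g" g x] assms by (simp add: V_zero)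

text \<open>Right translation of a finite set by \<open>g\<close> amounts to moving the base point
  from \<open>x\<close> to \<open>act g x\<close>, and the cocycle identity accounts for the factor
  \<open>V g x\<close>. Balls and shells around any centre thus reduce to those around the
  identity.\<close>

lemma sum_translate:
  assumes g: "g \<in> discrete_heis" and x: "x \<in> space M" and F: "F \<subseteq> discrete_heis"
  shows "(\<Sum>p\<in>(\<lambda>p. heis_mult p g) ` F. \<phi> (act p x) * V p x) = V g x * (\<Sum>p\<in>F. \<phi> (act p (act g x)) * V p (act g x))"
proof -
  have inj: "inj_on (\<lambda>p. heis_mult p g) F" by (rule inj_onI) (metis heis_mult_inv_cancel_right(1))
  have "(\<Sum>p\<in>F. \<phi> (act (heis_mult p g) x) * V (heis_mult p g) x)
      = (\<Sum>p\<in>F. V g x * (\<phi> (act p (act g x)) * V p (act g x)))"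
    using F g x by (intro sum.cong refl) (auto simp: act_mult V_mult subset_iff)
  then show ?thesis by (simp add: sum.reindex[OF inj] sum_distrib_left)
qed

lemma hball_subset [simp]: "hball x k \<subseteq> discrete_heis"
  and hshell_subset [simp]: "hshell t x k \<subseteq> discrete_heis"
  and hnbhd_subset [simp]: "hnbhd E s \<subseteq> discrete_heis"
  by (auto simp: hball_def hshell_def hnbhd_def)

lemma hball_weight:
  "g \<in> discrete_heis \<Longrightarrow> x \<in> space M \<Longrightarrow>
    (\<Sum>p\<in>hball g k. \<phi> (act p x) * V p x) = V g x * (\<Sum>p\<in>hball heis_zero k. \<phi> (act p (act g x)) * V p (act g x))"
  unfolding hball_translate[of g] by (rule sum_translate) auto

lemma hball_mass:
  "g \<in> discrete_heis \<Longrightarrow> x \<in> space M \<Longrightarrow>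
    (\<Sum>p\<in>hball g k. V p x) = V g x * (\<Sum>p\<in>hball heis_zero k. V p (act g x))"
  using hball_weight[of g x "\<lambda>_. 1" k] by simp

lemma hshell_mass:
  "g \<in> discrete_heis \<Longrightarrow> x \<in> space M \<Longrightarrow>
    (\<Sum>p\<in>hshell t g k. V p x) = V g x * (\<Sum>p\<in>hshell t heis_zero k. V p (act g x))"
  unfolding hshell_translate[of g] using sum_translate[of g x "hshell t heis_zero k" "\<lambda>_. 1"] by simp

lemma zero_in_hball: "heis_zero \<in> hball heis_zero k"
  by (simp add: hball_def)

lemma mass_pos: "0 < (\<Sum>p\<in>hball heis_zero (real k). V p x)"
proof (rule sum_pos)
  show "hball heis_zero (real k) \<noteq> ({} :: 'n heis set)"
    using zero_in_hball by blast
qed (auto simp: V_pos)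

text \<open>The principle of Calderon: the orbit inequality is summed over a large ball and
  integrated, and by \<open>V_change\<close> every group element contributes the same integral on
  either side. What remains is the ratio of the sizes of the enlarged ball and the ball, which a
  doubling window bounds by 2.\<close>

lemma transference:
  assumes Y: "Y \<in> sets M" and e [measurable]: "e \<in> borel_measurable M" and e0: "\<And>x. 0 \<le> e x" and a: "0 \<le> a"
    and le: "\<And>x F. x \<in> space M \<Longrightarrow> finite F \<Longrightarrow> F \<subseteq> discrete_heis \<Longrightarrow>
      (\<Sum>g\<in>{g\<in>F. act g x \<in> Y}. V g x) \<le> a * (\<Sum>p\<in>hnbhd F (real s). e (act p x) * V p x)"
  shows "emeasure M Y \<le> ennreal (2 * a) * (\<integral>\<^sup>+x. ennreal (e x) \<partial>M)"
proof -
  note Y [measurable]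
  \<comment> \<open>Enlarging the ball by \<open>s\<close> costs at most
    \<open>3 * s * (R + s)\<close> in the squared distance, which is within (R + 3 s)^2 - R^2; hence
    the window of length \<open>3 * s\<close>.\<close>
  obtain R where R: "card (hball heis_zero (real (R + 3 * s)) :: 'n heis set) \<le> 2 * card (hball heis_zero (real R) :: 'n heis set)"
    using exists_doubling_window by blast
  let ?F = "hball heis_zero (real R) :: 'n heis set"
  let ?F' = "hball heis_zero (real (R + 3 * s)) :: 'n heis set"
  have sub: "hnbhd ?F (real s) \<subseteq> ?F'"
  proof
    fix p assume p: "p \<in> hnbhd ?F (real s)"
    then obtain q where q: "q \<in> ?F" "hdist2 q p \<le> (real s)\<^sup>2" by (auto simp: hnbhd_def hdist2_commute)
    have qR: "hdist2 q heis_zero \<le> (real R)\<^sup>2" using q by (simp add: hball_def)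
    have g: "hgap q heis_zero \<le> real R" using hgap_le_hdist2[of q heis_zero] qR by (meson hgap_nonneg of_nat_0_le_iff order_trans power2_le_imp_le)
    have "hdist2 p heis_zero \<le> hdist2 q heis_zero + 3 * real s * (hgap q heis_zero + real s)"
      using hdist2_perturb[OF _ q(2), of heis_zero] by (simp del: hdist2_zero hgap_zero)
    also have "\<dots> \<le> (real R)\<^sup>2 + 3 * real s * (real R + real s)"
      using qR g by (intro add_mono mult_left_mono) auto
    also have "\<dots> \<le> (real (R + 3 * s))\<^sup>2" by (simp add: power2_eq_square algebra_simps)
    finally show "p \<in> ?F'" using p by (simp add: hball_def hnbhd_def)
  qed
  let ?I = "\<integral>\<^sup>+x. ennreal (e x) \<partial>M"
  have F: "finite ?F" "finite ?F'" by simp_all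
  have "of_nat (card ?F) * emeasure M Y = (\<Sum>g\<in>?F. \<integral>\<^sup>+x. indicator Y (act g x) * ennreal (V g x) \<partial>M)"
    by (simp add: V_change hball_def)
  also have "\<dots> = (\<integral>\<^sup>+x. (\<Sum>g\<in>?F. indicator Y (act g x) * ennreal (V g x)) \<partial>M)"
    by (rule nn_integral_sum[symmetric]) measurable
  also have "\<dots> \<le> (\<integral>\<^sup>+x. ennreal a * (\<Sum>p\<in>?F'. ennreal (e (act p x)) * ennreal (V p x)) \<partial>M)"
  proof (rule nn_integral_mono)
    fix x assume x: "x \<in> space M"
    have "(\<Sum>g\<in>?F. indicator Y (act g x) * ennreal (V g x)) = ennreal (\<Sum>g\<in>{g\<in>?F. act g x \<in> Y}. V g x)"
      using F by (simp add: sum.inter_filter sum_ennreal[symmetric] if_distrib)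
    also have "\<dots> \<le> ennreal (a * (\<Sum>p\<in>hnbhd ?F (real s). e (act p x) * V p x))"
      using F by (intro ennreal_leI le x) auto
    also have "\<dots> \<le> ennreal (a * (\<Sum>p\<in>?F'. e (act p x) * V p x))"
      using a e0 F sub by (intro ennreal_leI mult_left_mono sum_mono2) auto
    also have "\<dots> = ennreal a * (\<Sum>p\<in>?F'. ennreal (e (act p x)) * ennreal (V p x))"
      using a e0 by (simp add: ennreal_mult sum_nonneg sum_ennreal[symmetric])
    finally show "(\<Sum>g\<in>?F. indicator Y (act g x) * ennreal (V g x))
        \<le> ennreal a * (\<Sum>p\<in>?F'. ennreal (e (act p x)) * ennreal (V p x))" .
  qed
  also have "\<dots> = ennreal a * (\<Sum>p\<in>?F'. \<integral>\<^sup>+x. ennreal (e (act p x)) * ennreal (V p x) \<partial>M)"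
    by (simp add: nn_integral_cmult nn_integral_sum)
  also have "(\<Sum>p\<in>?F'. \<integral>\<^sup>+x. ennreal (e (act p x)) * ennreal (V p x) \<partial>M) = (\<Sum>p\<in>?F'. ?I)"
    by (intro sum.cong refl V_change[where \<phi> = "\<lambda>x. ennreal (e x)"]) (auto simp: hball_def)
  also have "(\<Sum>p\<in>?F'. ?I) = of_nat (card ?F') * ?I" by simp
  also have "ennreal a * (of_nat (card ?F') * ?I) \<le> ennreal a * (of_nat (2 * card ?F) * ?I)"
    using R by (intro mult_left_mono mult_right_mono of_nat_mono) auto
  also have "\<dots> = of_nat (card ?F) * (ennreal (2 * a) * ?I)"
    using a by (simp add: ennreal_mult mult_ac)
  finally have le: "of_nat (card ?F) * emeasure M Y \<le> of_nat (card ?F) * (ennreal (2 * a) * ?I)" .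
  have "card ?F \<noteq> 0" using F(1) zero_in_hball card_0_eq by blast
  then show ?thesis using le by (subst (asm) ennreal_mult_le_mult_iff) auto
qed

text \<open>Along an orbit, balls with large ratio around the bad group elements are thinned out by
  \<open>greedy_cover\<close> and overlap at most N + 1 times; transference contributes the factor
  2. Radii are cut off at K, so that all balls stay in a neighbourhood of fixed size, and K tends to
  infinity at the end.\<close>

lemma maximal_inequality:
  fixes \<phi> :: "'x \<Rightarrow> real"
  assumes N: "\<And>p T (S::'n heis set). crowd p T S \<Longrightarrow> card S \<le> N"
    and \<phi> [measurable]: "\<phi> \<in> borel_measurable M" and \<phi>0: "\<And>x. 0 \<le> \<phi> x" and l: "0 < l"
  shows "emeasure M {x\<in>space M. \<exists>k. l * (\<Sum>g\<in>hball heis_zero (real k). V g x) \<le> (\<Sum>g\<in>hball heis_zero (real k). \<phi> (act g x) * V g x)}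
    \<le> ennreal (2 * (real (Suc N) / l)) * (\<integral>\<^sup>+x. ennreal (\<phi> x) \<partial>M)" (is "emeasure M {x\<in>space M. \<exists>k. ?P k x} \<le> ?r")
proof -
  define Y where "Y K = {x\<in>space M. \<exists>k\<in>{..K}. ?P k x}" for K
  have Ym [measurable]: "Y K \<in> sets M" for K unfolding Y_def by measurable
  have bound: "emeasure M (Y K) \<le> ?r" for K
  proof (rule transference[OF Ym \<phi> \<phi>0, where s = K])
    show "0 \<le> real (Suc N) / l" using l by simp
    fix x F assume x: "x \<in> space M" and F: "finite F" "F \<subseteq> (discrete_heis :: 'n heis set)"
    let ?E = "{g\<in>F. act g x \<in> Y K}"
    have "\<forall>g\<in>?E. \<exists>k. k \<le> K \<and> ?P k (act g x)" by (auto simp: Y_def)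
    from bchoice[OF this] obtain k where "\<forall>g\<in>?E. k g \<le> K \<and> ?P (k g) (act g x)" by (elim exE)
    note k = this[rule_format]
    have finE: "finite ?E" using F by simp
    have "\<exists>J\<subseteq>?E. (\<forall>x\<in>J. \<forall>y\<in>J. x \<noteq> y \<longrightarrow> (real (k x))\<^sup>2 < hdist2 x y) \<and> (\<forall>e\<in>?E. \<exists>x\<in>J. hdist2 e x \<le> (real (k x))\<^sup>2)"
      by (rule greedy_cover[OF finE]) simp
    then obtain J where J1: "J \<subseteq> ?E" and J2: "\<forall>x\<in>J. \<forall>y\<in>J. x \<noteq> y \<longrightarrow> (real (k x))\<^sup>2 < hdist2 x y"
      and J3: "\<forall>e\<in>?E. \<exists>x\<in>J. hdist2 e x \<le> (real (k x))\<^sup>2"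
      by (elim exE conjE)
    have finJ: "finite J" using J1 finE finite_subset by blast
    have JG: "g \<in> discrete_heis" if "g \<in> J" for g using that J1 F by blast
    let ?B = "\<lambda>g. hball g (real (k g))"
    have heavy: "l * (\<Sum>p\<in>?B g. V p x) \<le> (\<Sum>p\<in>?B g. \<phi> (act p x) * V p x)" if g: "g \<in> J" for g
    proof -
      have "?P (k g) (act g x)" using k g J1 by blast
      then have "V g x * (l * (\<Sum>p\<in>hball heis_zero (real (k g)). V p (act g x)))
          \<le> V g x * (\<Sum>p\<in>hball heis_zero (real (k g)). \<phi> (act p (act g x)) * V p (act g x))"
        by (intro mult_left_mono) auto
      then show ?thesis unfolding hball_mass[OF JG[OF g] x] hball_weight[OF JG[OF g] x] by (simp add: mult_ac)
    qed
    have "l * (\<Sum>g\<in>?E. V g x) \<le> l * (\<Sum>g\<in>J. \<Sum>p\<in>?B g. V p x)"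
    proof (intro mult_left_mono sum_le_cover finJ)
      show "?E \<subseteq> (\<Union>g\<in>J. ?B g)"
      proof
        fix e assume e: "e \<in> ?E"
        then have "e \<in> discrete_heis" using F by blast
        then show "e \<in> (\<Union>g\<in>J. ?B g)" using J3 e unfolding hball_def by blast
      qed
    qed (use JG l in auto)
    also have "\<dots> = (\<Sum>g\<in>J. l * (\<Sum>p\<in>?B g. V p x))" by (simp add: sum_distrib_left)
    also have "\<dots> \<le> (\<Sum>g\<in>J. \<Sum>p\<in>?B g. \<phi> (act p x) * V p x)" by (intro sum_mono heavy)
    also have "\<dots> \<le> real (Suc N) * (\<Sum>p\<in>hnbhd F (real K). \<phi> (act p x) * V p x)"
    proof (rule sum_overlap)
      show "?B g \<subseteq> hnbhd F (real K)" if g: "g \<in> J" for g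
      proof -
        have "g \<in> F" "k g \<le> K" using g J1 k[of g] by blast+
        then have "hball g (real (k g)) \<subseteq> hball g (real K)" by (intro hball_mono) auto
        then show ?thesis using \<open>g \<in> F\<close> unfolding hball_def hnbhd_def by blast
      qed
      show "card {g \<in> J. p \<in> ?B g} \<le> Suc N" for p
      proof -
        have "card {g \<in> J. hdist2 p g \<le> (real (k g))\<^sup>2 + 0 * (hgap p g + 0)} \<le> Suc N"
        proof (rule overlap_bound)
          show "card S \<le> N" if "crowd q T S" for q T and S :: "'n heis set" using that by (rule N)
          show "(real (k y))\<^sup>2 < hdist2 y z" if "y \<in> J" "z \<in> J" "y \<noteq> z" for y z using J2 that by blast
        qed (use finJ in auto)
        moreover have "card {g \<in> J. p \<in> ?B g} \<le> card {g \<in> J. hdist2 p g \<le> (real (k g))\<^sup>2 + 0 * (hgap p g + 0)}"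
          using finJ by (intro card_mono) (auto simp: hball_def)
        ultimately show ?thesis by linarith
      qed
    qed (use \<phi>0 finJ F in auto)
    finally show "(\<Sum>g\<in>?E. V g x) \<le> real (Suc N) / l * (\<Sum>p\<in>hnbhd F (real K). \<phi> (act p x) * V p x)"
      using l by (simp add: field_simps)
  qed
  have "{x\<in>space M. \<exists>k. ?P k x} = (\<Union>K. Y K)" by (auto simp: Y_def)
  moreover have "incseq Y" by (force simp: Y_def incseq_def)
  ultimately have "emeasure M {x\<in>space M. \<exists>k. ?P k x} = (SUP K. emeasure M (Y K))"
    by (simp add: SUP_emeasure_incseq[symmetric] image_subset_iff)
  also have "\<dots> \<le> ?r" by (rule SUP_least) (rule bound)
  finally show ?thesis .
qed

text \<open>If the set had positive measure, scales could be chosen so that at least half of it has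
  a heavy shell in each of n prescribed windows, while thinness of heavy configurations and
  transference bound this part by \<open>2 * \<eta>\<close>, a quarter of the measure.\<close>

lemma heavy_shell_null:
  assumes \<epsilon>: "0 < \<epsilon>" and t: "0 < t"
  defines "heavy k x \<equiv> \<epsilon> * (\<Sum>g\<in>hball heis_zero (real k). V g x) \<le> (\<Sum>g\<in>hshell t heis_zero (real k). V g x)"
  shows "emeasure M {x\<in>space M. \<exists>\<^sub>\<infinity>k. heavy k x} = 0"
proof (rule ccontr)
  define X where "X = {x\<in>space M. \<exists>\<^sub>\<infinity>k. heavy k x}"
  have [measurable]: "Measurable.pred M (heavy k)" for k unfolding heavy_def by measurable
  have [measurable]: "X \<in> sets M" unfolding X_def INFM_nat by measurable
  assume "emeasure M {x\<in>space M. \<exists>\<^sub>\<infinity>k. heavy k x} \<noteq> 0"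
  then have X: "0 < measure M X"
    by (simp add: emeasure_eq_measure zero_less_measure_iff flip: X_def)
  define \<eta> where "\<eta> = measure M X / 8"
  have \<eta>: "0 < \<eta>" using X by (simp add: \<eta>_def)
  obtain n where n: "\<And>(\<nu>::'n heis \<Rightarrow> real) c E. heavy_config \<nu> \<epsilon> t c n {} E \<Longrightarrow>
      sum \<nu> E \<le> \<eta> * sum \<nu> (hnbhd E (2 * c n))"
    using heavy_config_thin[OF \<epsilon> t \<eta>] by blast
  define H where "H a b = {x\<in>space M. \<exists>k. 10000 * a \<le> real k \<and> real k \<le> b \<and> heavy k x}" for a b :: real
  have [measurable]: "H a b \<in> sets M" for a b unfolding H_def by measurable
  define \<delta> where "\<delta> = measure M X / (2 * real (Suc n))"
  have \<delta>: "0 < \<delta>" using X by (simp add: \<delta>_def)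
  \<comment> \<open>Points of \<open>X\<close> have heavy shells at arbitrarily large radii, so what
    \<open>H a b\<close> misses decreases to the empty set as b grows; finiteness of the measure
    gives continuity from above.\<close>
  have "\<exists>b. 10000 * a \<le> b \<and> measure M (X - H a b) < \<delta>" for a
  proof -
    have "(\<lambda>m. measure M (X - H a (real m))) \<longlonglongrightarrow> measure M (\<Inter>m. X - H a (real m))"
    proof (rule finite_Lim_measure_decseq)
      show "decseq (\<lambda>m. X - H a (real m))" by (force simp: decseq_def H_def)
    qed auto
    moreover have "(\<Inter>m. X - H a (real m)) = {}"
    proof -
      have "\<exists>m. x \<in> H a (real m)" if x: "x \<in> X" for x
      proof -
        have "\<exists>k\<ge>nat \<lceil>10000 * a\<rceil>. heavy k x" using x unfolding X_def INFM_nat_le by blast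
        then obtain k where "nat \<lceil>10000 * a\<rceil> \<le> k" "heavy k x" by blast
        moreover from this(1) have "10000 * a \<le> real k" by linarith
        ultimately show ?thesis using x by (intro exI[of _ k]) (auto simp: H_def X_def)
      qed
      then show ?thesis by blast
    qed
    ultimately have "(\<lambda>m. measure M (X - H a (real m))) \<longlonglongrightarrow> 0" by (simp only: measure_empty)
    then have "eventually (\<lambda>m. measure M (X - H a (real m)) < \<delta>) sequentially" using \<delta> by (rule order_tendstoD)
    moreover have "eventually (\<lambda>m. 10000 * a \<le> real m) sequentially"
      using filterlim_real_sequentially unfolding filterlim_at_top by blast
    ultimately have "eventually (\<lambda>m. 10000 * a \<le> real m \<and> measure M (X - H a (real m)) < \<delta>) sequentially"
      by (rule eventually_conj[rotated])
    then show ?thesis using eventually_happens by force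
  qed
  then obtain nxt where nxt: "\<And>a. 10000 * a \<le> nxt a" "\<And>a. measure M (X - H a (nxt a)) < \<delta>" by metis
  define c where "c = rec_nat t (\<lambda>_. nxt)"
  have c: "c 0 = t" "c (Suc i) = nxt (c i)" for i by (simp_all add: c_def)
  define Y where "Y = X \<inter> (\<Inter>i\<in>{..<n}. H (c i) (c (Suc i)))"
  have [measurable]: "Y \<in> sets M"
  proof (cases "n = 0")
    case False
    then show ?thesis unfolding Y_def by (intro sets.Int sets.finite_INT) auto
  qed (simp add: Y_def)
  have "measure M X - measure M Y \<le> measure M (X - Y)"
  proof -
    have "Y \<subseteq> X" by (auto simp: Y_def)
    then show ?thesis using finite_measure_Diff[of X Y] by simp
  qed
  also have "X - Y = (\<Union>i\<in>{..<n}. X - H (c i) (c (Suc i)))" by (auto simp: Y_def)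
  also have "measure M \<dots> \<le> (\<Sum>i<n. measure M (X - H (c i) (c (Suc i))))"
    by (rule finite_measure_subadditive_finite) auto
  also have "\<dots> \<le> (\<Sum>i<n. \<delta>)" unfolding c using nxt(2) by (intro sum_mono less_imp_le)
  also have "\<dots> \<le> measure M X / 2"
    using X by (simp add: \<delta>_def field_simps)
  finally have Y2: "measure M X / 2 \<le> measure M Y" by simp
  obtain s :: nat where s: "2 * c n \<le> real s" using real_arch_simple by blast
  have cpos: "0 < c i" for i
  proof (induction i)
    case (Suc i)
    have "10000 * c i \<le> c (Suc i)" by (simp only: c nxt(1))
    with Suc show ?case by linarith
  qed (use t in \<open>simp add: c\<close>)
  have "emeasure M Y \<le> ennreal (2 * \<eta>) * (\<integral>\<^sup>+x. ennreal 1 \<partial>M)"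
  proof (rule transference[where s = s])
    fix x F assume x: "x \<in> space M" and F: "finite F" "F \<subseteq> (discrete_heis :: 'n heis set)"
    let ?E = "{g\<in>F. act g x \<in> Y}"
    have "heavy_config (\<lambda>p. V p x) \<epsilon> t c n {} ?E"
      unfolding heavy_config_def
    proof (intro conjI)
      show "\<forall>e\<in>?E. \<forall>i<n. heavy_shell (\<lambda>p. V p x) \<epsilon> t (10000 * c i) (c (Suc i)) e"
      proof (intro ballI allI impI)
        fix g i assume g: "g \<in> ?E" and i: "i < n"
        then have gG: "g \<in> discrete_heis" and "act g x \<in> H (c i) (c (Suc i))" using F by (auto simp: Y_def)
        then obtain k where k: "10000 * c i \<le> real k" "real k \<le> c (Suc i)" "heavy k (act g x)" by (auto simp: H_def)
        have "V g x * (\<epsilon> * (\<Sum>p\<in>hball heis_zero (real k). V p (act g x)))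
            \<le> V g x * (\<Sum>p\<in>hshell t heis_zero (real k). V p (act g x))"
          using k(3) by (intro mult_left_mono) (auto simp: heavy_def)
        then have "\<epsilon> * (\<Sum>p\<in>hball g (real k). V p x) \<le> (\<Sum>p\<in>hshell t g (real k). V p x)"
          by (simp add: hball_mass[OF gG x] hshell_mass[OF gG x] mult_ac)
        then show "heavy_shell (\<lambda>p. V p x) \<epsilon> t (10000 * c i) (c (Suc i)) g"
          unfolding heavy_shell_def using k by blast
      qed
      show "\<forall>i<n. 10000 * c i \<le> c (Suc i)" unfolding c using nxt(1) by blast
    qed (use F in \<open>auto simp: c chain_def\<close>)
    then have "(\<Sum>p\<in>?E. V p x) \<le> \<eta> * (\<Sum>p\<in>hnbhd ?E (2 * c n). V p x)" by (rule n)
    also have "\<dots> \<le> \<eta> * (\<Sum>p\<in>hnbhd F (real s). V p x)"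
      using F s \<eta> cpos[of n] by (intro mult_left_mono sum_mono2 hnbhd_mono) auto
    finally show "(\<Sum>g\<in>?E. V g x) \<le> \<eta> * (\<Sum>p\<in>hnbhd F (real s). 1 * V p x)" by simp
  qed (use \<eta> in auto)
  then have "measure M Y \<le> 2 * \<eta>" using \<eta> by (simp add: emeasure_eq_measure prob_space)
  then show False using Y2 X by (simp add: \<eta>_def)
qed

text \<open>This replaces the invariance of a Folner sequence.\<close>
lemma shell_ratio_tendsto:
  "AE x in M. \<forall>t>0. (\<lambda>k. (\<Sum>g\<in>hshell t heis_zero (real k). V g x) / (\<Sum>g\<in>hball heis_zero (real k). V g x)) \<longlonglongrightarrow> 0"
proof -
  let ?B = "\<lambda>k x. \<Sum>g\<in>hball heis_zero (real k). V g x"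
  let ?S = "\<lambda>t k x. \<Sum>g\<in>hshell t heis_zero (real k). V g x"
  \<comment> \<open>Countably many thicknesses and proportions suffice, since shells increase with
    the thickness.\<close>
  have "AE x in M. \<not> (\<exists>\<^sub>\<infinity>k. inverse (real (Suc m)) * ?B k x \<le> ?S (real (Suc t)) k x)" for m t
  proof (rule AE_I)
    show "emeasure M {x\<in>space M. \<exists>\<^sub>\<infinity>k. inverse (real (Suc m)) * ?B k x \<le> ?S (real (Suc t)) k x} = 0"
      by (rule heavy_shell_null) auto
    show "{x\<in>space M. \<exists>\<^sub>\<infinity>k. inverse (real (Suc m)) * ?B k x \<le> ?S (real (Suc t)) k x} \<in> sets M"
      unfolding INFM_nat by measurable
  qed auto
  then have "AE x in M. \<forall>m t. \<not> (\<exists>\<^sub>\<infinity>k. inverse (real (Suc m)) * ?B k x \<le> ?S (real (Suc t)) k x)"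
    by (simp add: AE_all_countable)
  then show ?thesis
  proof (rule AE_mp, intro AE_I2 impI allI)
    fix x t assume x: "\<forall>m t. \<not> (\<exists>\<^sub>\<infinity>k. inverse (real (Suc m)) * ?B k x \<le> ?S (real (Suc t)) k x)" and t: "0 < (t::real)"
    obtain T where T: "t \<le> real (Suc T)" using real_arch_simple[of t] by (metis of_nat_Suc add_increasing zero_le_one order_trans le_add_same_cancel2)
    show "(\<lambda>k. ?S t k x / ?B k x) \<longlonglongrightarrow> 0"
    proof (rule LIMSEQ_I)
      fix r :: real assume "0 < r"
      then obtain m where m: "inverse (real (Suc m)) < r" using reals_Archimedean by blast
      have "eventually (\<lambda>k. \<not> inverse (real (Suc m)) * ?B k x \<le> ?S (real (Suc T)) k x) sequentially"
        using x by (simp add: not_frequently cofinite_eq_sequentially)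
      then obtain K where K: "\<And>k. k \<ge> K \<Longrightarrow> ?S (real (Suc T)) k x < inverse (real (Suc m)) * ?B k x"
        by (auto simp: eventually_sequentially not_le)
      show "\<exists>no. \<forall>k\<ge>no. norm (?S t k x / ?B k x - 0) < r"
      proof (intro exI allI impI)
        fix k assume k: "K \<le> k"
        have fin: "finite (hshell (real (Suc T)) heis_zero (real k) :: 'n heis set)" by (rule finite_hshell) simp_all
        have "?S t k x \<le> ?S (real (Suc T)) k x"
          using t T by (intro sum_mono2 fin hshell_mono) auto
        also have "\<dots> < r * ?B k x" using K[OF k] mult_strict_right_mono[OF m mass_pos[where k = k and x = x]] by linarith
        finally have "?S t k x / ?B k x < r" using mass_pos[where k = k and x = x] by (simp add: field_simps)
        moreover have "0 \<le> ?S t k x / ?B k x" by (intro divide_nonneg_nonneg sum_nonneg) auto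
        ultimately show "norm (?S t k x / ?B k x - 0) < r" by simp
      qed
    qed
  qed
qed

section \<open>Functions satisfying the ratio theorem\<close>

definition ratio :: "nat \<Rightarrow> ('x \<Rightarrow> real) \<Rightarrow> 'x \<Rightarrow> real" where
  "ratio k f x = (\<Sum>g\<in>hball heis_zero (real k). f (act g x) * V g x) / (\<Sum>g\<in>hball heis_zero (real k). V g x)"

definition ratio_converges :: "('x \<Rightarrow> real) \<Rightarrow> bool" where
  "ratio_converges f \<longleftrightarrow> (AE x in M. (\<lambda>k. ratio k f x) \<longlonglongrightarrow> integral\<^sup>L M f)"

lemma ratio_measurable [measurable]:
  assumes [measurable]: "f \<in> borel_measurable M"
  shows "ratio k f \<in> borel_measurable M"
  unfolding ratio_def by measurable

lemma ratio_add: "ratio k (\<lambda>x. f x + h x) x = ratio k f x + ratio k h x"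
  by (simp add: ratio_def sum.distrib add_divide_distrib ring_distribs)

lemma ratio_diff: "ratio k (\<lambda>x. f x - h x) x = ratio k f x - ratio k h x"
  by (simp add: ratio_def sum_subtractf diff_divide_distrib ring_distribs)

lemma ratio_const: "ratio k (\<lambda>_. c) x = c"
  using mass_pos[of x k] by (simp add: ratio_def flip: sum_distrib_left)

lemma abs_ratio_le: "\<bar>ratio k f x\<bar> \<le> ratio k (\<lambda>x. \<bar>f x\<bar>) x"
proof -
  have "\<bar>\<Sum>g\<in>hball heis_zero (real k). f (act g x) * V g x\<bar> \<le> (\<Sum>g\<in>hball heis_zero (real k). \<bar>f (act g x)\<bar> * V g x)"
    by (rule order_trans[OF sum_abs]) (simp add: abs_mult)
  then show ?thesis using mass_pos[of x k] by (simp add: ratio_def abs_divide divide_right_mono)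
qed

lemma ratio_converges_add:
  assumes "ratio_converges f" "ratio_converges h" "integrable M f" "integrable M h"
  shows "ratio_converges (\<lambda>x. f x + h x)"
  using assms(1,2) unfolding ratio_converges_def
  by eventually_elim (use assms(3,4) in \<open>simp add: ratio_add tendsto_add\<close>)

lemma ratio_converges_const: "ratio_converges (\<lambda>_. c)"
  by (simp add: ratio_converges_def ratio_const prob_space)

text \<open>The principle of Banach: the maximal inequality makes the ratios of f - h uniformly
  small outside a set of small measure, so convergence passes to limits in L1.\<close>

lemma ratio_converges_closed:
  assumes f [measurable]: "integrable M f"
    and approx: "\<And>\<delta>. 0 < \<delta> \<Longrightarrow> \<exists>h. integrable M h \<and> ratio_converges h \<and> (\<integral>x. \<bar>f x - h x\<bar> \<partial>M) < \<delta>"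
  shows "ratio_converges f"
proof -
  obtain N where N: "\<And>p T (S::'n heis set). crowd p T S \<Longrightarrow> card S \<le> N" using crowd_bound by blast
  define Bad where "Bad l = {x\<in>space M. \<exists>\<^sub>\<infinity>k. 3 * l \<le> \<bar>ratio k f x - integral\<^sup>L M f\<bar>}" for l :: real
  have fm [measurable]: "f \<in> borel_measurable M" using f by simp
  have [measurable]: "Bad l \<in> sets M" for l unfolding Bad_def INFM_nat by measurable
  have small: "measure M (Bad l) \<le> \<delta>" if l: "0 < l" and \<delta>: "0 < \<delta>" for l \<delta>
  proof -
    define C where "C = 2 * (real (Suc N) / l)"
    have C: "0 < C" using l by (simp add: C_def)
    \<comment> \<open>The bound by l controls the difference of the integrals, and the bound by
      \<delta> / C the exceptional set of the maximal inequality. Together with the limit for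
      \<open>h\<close> there are three errors below l, whence \<open>3 * l\<close> in
      \<open>Bad\<close>.\<close>
    obtain h where h: "integrable M h" "ratio_converges h" and d: "(\<integral>x. \<bar>f x - h x\<bar> \<partial>M) < min l (\<delta> / C)"
      using approx[of "min l (\<delta> / C)"] l \<delta> C by auto
    have hm [measurable]: "h \<in> borel_measurable M" using h by simp
    define W where "W = {x\<in>space M. \<exists>k. l * (\<Sum>g\<in>hball heis_zero (real k). V g x) \<le> (\<Sum>g\<in>hball heis_zero (real k). \<bar>f (act g x) - h (act g x)\<bar> * V g x)}"
    have [measurable]: "W \<in> sets M" unfolding W_def by measurable
    have int: "integrable M (\<lambda>x. \<bar>f x - h x\<bar>)" using f h by simp
    have "emeasure M W \<le> ennreal C * (\<integral>\<^sup>+x. ennreal \<bar>f x - h x\<bar> \<partial>M)"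
      unfolding W_def C_def
      by (rule maximal_inequality[where \<phi> = "\<lambda>x. \<bar>f x - h x\<bar>" and l = l, OF N]) (use l in auto)
    also have "\<dots> = ennreal (C * (\<integral>x. \<bar>f x - h x\<bar> \<partial>M))"
      using int C by (simp add: nn_integral_eq_integral ennreal_mult integral_nonneg)
    also have "\<dots> \<le> ennreal \<delta>" using d C by (intro ennreal_leI) (simp add: field_simps)
    finally have W: "measure M W \<le> \<delta>" using \<delta> by (simp add: emeasure_eq_measure)
    have "AE x in M. x \<in> Bad l \<longrightarrow> x \<in> W"
      using h(2)[unfolded ratio_converges_def]
    proof (rule AE_mp, intro AE_I2 impI)
      fix x assume x: "x \<in> space M" and lim: "(\<lambda>k. ratio k h x) \<longlonglongrightarrow> integral\<^sup>L M h" and bad: "x \<in> Bad l"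
      show "x \<in> W"
      proof (rule ccontr)
        assume nW: "x \<notin> W"
        have a: "\<bar>ratio k f x - ratio k h x\<bar> < l" for k
        proof -
          have "\<bar>ratio k f x - ratio k h x\<bar> \<le> ratio k (\<lambda>x. \<bar>f x - h x\<bar>) x"
            using abs_ratio_le[of k "\<lambda>x. f x - h x" x] by (simp add: ratio_diff)
          also have "\<dots> < l" using nW x mass_pos[of x k] by (auto simp: W_def ratio_def field_simps not_le)
          finally show ?thesis .
        qed
        have "\<bar>integral\<^sup>L M f - integral\<^sup>L M h\<bar> \<le> (\<integral>x. \<bar>f x - h x\<bar> \<partial>M)"
          using integral_abs_bound[of M "\<lambda>x. f x - h x"] f h by simp
        then have b: "\<bar>integral\<^sup>L M f - integral\<^sup>L M h\<bar> < l" using d by simp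
        have "eventually (\<lambda>k. \<bar>ratio k h x - integral\<^sup>L M h\<bar> < l) sequentially"
          using lim l unfolding tendsto_iff dist_real_def by blast
        then have "eventually (\<lambda>k. \<not> 3 * l \<le> \<bar>ratio k f x - integral\<^sup>L M f\<bar>) sequentially"
        proof eventually_elim
          case (elim k)
          then show ?case using a[of k] b by linarith
        qed
        then show False using bad by (simp add: Bad_def frequently_def cofinite_eq_sequentially)
      qed
    qed
    then have "measure M (Bad l) \<le> measure M W" by (intro finite_measure_mono_AE) auto
    then show ?thesis using W by simp
  qed
  have "measure M (Bad l) = 0" if l: "0 < l" for l
    using field_le_epsilon[of "measure M (Bad l)" 0] small[OF l] by (simp add: order.antisym)
  then have "AE x in M. x \<notin> Bad (inverse (real (Suc m)))" for m
    by (intro AE_not_in) (simp add: null_sets_def emeasure_eq_measure)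
  then have "AE x in M. \<forall>m. x \<notin> Bad (inverse (real (Suc m)))" by (simp add: AE_all_countable)
  then show ?thesis
    unfolding ratio_converges_def
  proof (rule AE_mp, intro AE_I2 impI)
    fix x assume x: "x \<in> space M" and nb: "\<forall>m. x \<notin> Bad (inverse (real (Suc m)))"
    show "(\<lambda>k. ratio k f x) \<longlonglongrightarrow> integral\<^sup>L M f"
      unfolding tendsto_iff dist_real_def
    proof (intro allI impI)
      fix r :: real assume "0 < r"
      then obtain m where m: "inverse (real (Suc m)) < r / 3" using reals_Archimedean[of "r / 3"] by auto
      have "eventually (\<lambda>k. \<not> 3 * inverse (real (Suc m)) \<le> \<bar>ratio k f x - integral\<^sup>L M f\<bar>) sequentially"
        using nb x by (auto simp: Bad_def not_frequently cofinite_eq_sequentially)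
      then show "eventually (\<lambda>k. \<bar>ratio k f x - integral\<^sup>L M f\<bar> < r) sequentially"
        by eventually_elim (use m in linarith)
    qed
  qed
qed

section \<open>Coboundaries satisfy the ratio theorem\<close>

lemma push_integral:
  assumes g: "g \<in> discrete_heis" and f: "integrable M f"
  shows "integrable M (\<lambda>x. f (act g x) * V g x)"
    and "(\<integral>x. f (act g x) * V g x \<partial>M) = integral\<^sup>L M f"
proof -
  have fm [measurable]: "f \<in> borel_measurable M" using f by simp
  have n: "(\<integral>\<^sup>+x. ennreal (s * f (act g x) * V g x) \<partial>M) = (\<integral>\<^sup>+x. ennreal (s * f x) \<partial>M)" for s
    using V_change[OF g, of "\<lambda>x. ennreal (s * f x)"] by (simp add: ennreal_mult'')
  have "(\<integral>\<^sup>+x. ennreal (norm (f (act g x) * V g x)) \<partial>M) = (\<integral>\<^sup>+x. ennreal (norm (f x)) \<partial>M)"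
    using V_change[OF g, of "\<lambda>x. ennreal (norm (f x))"] by (simp add: abs_mult ennreal_mult'')
  then show int: "integrable M (\<lambda>x. f (act g x) * V g x)" using f by (simp add: integrable_iff_bounded)
  show "(\<integral>x. f (act g x) * V g x \<partial>M) = integral\<^sup>L M f"
    using n[of 1] n[of "-1"] by (simp add: real_lebesgue_integral_def[OF int] real_lebesgue_integral_def[OF f])
qed

text \<open>By the cocycle identity the sum over a ball is a difference of sums of the same function
  over the left translate by \<open>u\<close> and over the ball itself. Their symmetric difference
  lies in a shell whose thickness depends only on \<open>u\<close>, and boundedness of
  \<open>h\<close> leaves the proportion of mass in that shell.\<close>

lemma ratio_converges_coboundary_bounded:
  assumes u: "u \<in> discrete_heis" and h: "integrable M h" and b: "\<And>x. \<bar>h x\<bar> \<le> H"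
  shows "ratio_converges (\<lambda>x. h (act u x) * V u x - h x)"
proof -
  have int0: "integral\<^sup>L M (\<lambda>x. h (act u x) * V u x - h x) = 0"
    using push_integral[OF u h] h by simp
  \<comment> \<open>The maximum with 1 keeps \<open>t\<close> positive even when \<open>u\<close> is
    the identity.\<close>
  define s where "s = max 1 (sqrt (gauge2 u))"
  have s: "1 \<le> s" "gauge2 u \<le> s\<^sup>2"
  proof -
    show "1 \<le> s" by (simp add: s_def)
    have "(sqrt (gauge2 u))\<^sup>2 \<le> s\<^sup>2" by (intro power_mono) (auto simp: s_def)
    then show "gauge2 u \<le> s\<^sup>2" by simp
  qed
  define t where "t = 3 * s"
  have H: "0 \<le> H" using b[of undefined] by linarith
  let ?B = "\<lambda>k. hball heis_zero (real k) :: 'n heis set"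
  let ?S = "\<lambda>k. hshell t heis_zero (real k) :: 'n heis set"
  have bound: "\<bar>ratio k (\<lambda>x. h (act u x) * V u x - h x) x\<bar> \<le> H * ((\<Sum>g\<in>?S k. V g x) / (\<Sum>g\<in>?B k. V g x))"
    if x: "x \<in> space M" for k x
  proof -
    let ?uB = "heis_mult u ` ?B k"
    define \<psi> where "\<psi> g = h (act g x) * V g x" for g
    have inj: "inj_on (heis_mult u) (?B k)" by (rule inj_onI) (metis heis_mult_inv_cancel(1))
    have 1: "(\<Sum>g\<in>?B k. (h (act u (act g x)) * V u (act g x) - h (act g x)) * V g x) = sum \<psi> ?uB - sum \<psi> (?B k)"
    proof -
      have "sum \<psi> ?uB = (\<Sum>g\<in>?B k. h (act u (act g x)) * V u (act g x) * V g x)"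
        unfolding sum.reindex[OF inj] using x u
        by (intro sum.cong refl) (auto simp: \<psi>_def act_mult V_mult hball_def)
      then show ?thesis by (simp add: \<psi>_def sum_subtractf[symmetric] left_diff_distrib)
    qed
    have sh1: "?uB - ?B k \<subseteq> ?S k"
    proof
      fix p assume p: "p \<in> ?uB - ?B k"
      then obtain g where g: "p = heis_mult u g" "g \<in> ?B k" by blast
      have pd: "p \<in> discrete_heis" using g u by (simp add: hball_def)
      have "g = heis_mult (heis_inv u) p" using g by simp
      then have "\<bar>gauge2 g - gauge2 p\<bar> \<le> t * (norm (fst p) + s)"
        using gauge2_mult_left[of s "heis_inv u" p] s by (simp add: gauge2_inv t_def)
      moreover have "t * (norm (fst p) + s) \<le> t * (norm (fst p) + t)" using s by (intro mult_left_mono) (auto simp: t_def)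
      moreover have "gauge2 g \<le> (real k)\<^sup>2" "(real k)\<^sup>2 < gauge2 p" using p g pd by (auto simp: hball_def)
      ultimately show "p \<in> ?S k" using pd by (simp add: hshell_def)
    qed
    have sh2: "?B k - ?uB \<subseteq> ?S k"
    proof
      fix p assume p: "p \<in> ?B k - ?uB"
      let ?q = "heis_mult (heis_inv u) p"
      have pd: "p \<in> discrete_heis" using p by (simp add: hball_def)
      have "heis_mult u ?q \<notin> ?uB" using p by simp
      then have "?q \<notin> ?B k" by blast
      then have "(real k)\<^sup>2 < gauge2 ?q" using pd u by (simp add: hball_def)
      moreover have "\<bar>gauge2 ?q - gauge2 p\<bar> \<le> t * (norm (fst p) + s)"
        using gauge2_mult_left[of s "heis_inv u" p] s by (simp add: gauge2_inv t_def)
      moreover have "t * (norm (fst p) + s) \<le> t * (norm (fst p) + t)" using s by (intro mult_left_mono) (auto simp: t_def)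
      moreover have "gauge2 p \<le> (real k)\<^sup>2" using p by (simp add: hball_def)
      ultimately show "p \<in> ?S k" using pd by (simp add: hshell_def)
    qed
    have fin: "finite (?B k)" "finite ?uB" "finite (?S k)" using s by (simp_all add: t_def)
    have bb: "\<bar>\<psi> g\<bar> \<le> H * V g x" for g using b by (simp add: \<psi>_def abs_mult mult_right_mono)
    have "sum \<psi> ?uB - sum \<psi> (?B k) = sum \<psi> (?uB - ?B k) - sum \<psi> (?B k - ?uB)"
      using fin sum.Int_Diff[of ?uB \<psi> "?B k"] sum.Int_Diff[of "?B k" \<psi> ?uB] by (simp add: Int_commute)
    also have "\<bar>\<dots>\<bar> \<le> (\<Sum>g\<in>?uB - ?B k. \<bar>\<psi> g\<bar>) + (\<Sum>g\<in>?B k - ?uB. \<bar>\<psi> g\<bar>)"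
      by (rule order_trans[OF abs_triangle_ineq4 add_mono[OF sum_abs sum_abs]])
    also have "\<dots> = (\<Sum>g\<in>(?uB - ?B k) \<union> (?B k - ?uB). \<bar>\<psi> g\<bar>)"
      using fin by (intro sum.union_disjoint[symmetric]) auto
    also have "\<dots> \<le> (\<Sum>g\<in>?S k. \<bar>\<psi> g\<bar>)" using fin sh1 sh2 by (intro sum_mono2) auto
    also have "\<dots> \<le> (\<Sum>g\<in>?S k. H * V g x)" by (intro sum_mono bb)
    finally have "\<bar>sum \<psi> ?uB - sum \<psi> (?B k)\<bar> \<le> H * (\<Sum>g\<in>?S k. V g x)" by (simp add: sum_distrib_left)
    then show ?thesis unfolding ratio_def 1 using mass_pos[of x k] by (simp add: abs_divide divide_right_mono)
  qed
  show ?thesis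
    unfolding ratio_converges_def int0 using shell_ratio_tendsto
  proof (rule AE_mp, intro AE_I2 impI)
    fix x assume x: "x \<in> space M"
      and lim: "\<forall>t>0. (\<lambda>k. (\<Sum>g\<in>hshell t heis_zero (real k). V g x) / (\<Sum>g\<in>hball heis_zero (real k). V g x)) \<longlonglongrightarrow> 0"
    have "0 < t" using s by (simp add: t_def)
    then have lim0: "(\<lambda>k. H * ((\<Sum>g\<in>?S k. V g x) / (\<Sum>g\<in>?B k. V g x))) \<longlonglongrightarrow> 0"
      by (intro tendsto_mult_right_zero lim[rule_format])
    show "(\<lambda>k. ratio k (\<lambda>x. h (act u x) * V u x - h x) x) \<longlonglongrightarrow> 0"
    proof (rule Lim_null_comparison[OF always_eventually lim0], rule allI)
      show "norm (ratio k (\<lambda>x. h (act u x) * V u x - h x) x) \<le> H * ((\<Sum>g\<in>?S k. V g x) / (\<Sum>g\<in>?B k. V g x))" for k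
        unfolding real_norm_def by (rule bound[OF x])
    qed
  qed
qed

text \<open>Truncations converge to \<open>h\<close> in L1, and passing to the coboundary at most
  doubles the L1 norm because \<open>push_integral\<close> preserves integrals.\<close>

lemma ratio_converges_coboundary:
  assumes u: "u \<in> discrete_heis" and h: "integrable M h"
  shows "ratio_converges (\<lambda>x. h (act u x) * V u x - h x)"
proof (rule ratio_converges_closed)
  show "integrable M (\<lambda>x. h (act u x) * V u x - h x)" using push_integral(1)[OF u h] h by simp
  fix \<delta> :: real assume \<delta>: "0 < \<delta>"
  have hm [measurable]: "h \<in> borel_measurable M" using h by simp
  define c where "c m x = max (- real m) (min (real m) (h x))" for m x
  have cm [measurable]: "c m \<in> borel_measurable M" for m unfolding c_def by measurable
  have cb: "\<bar>c m x\<bar> \<le> real m" for m x by (auto simp: c_def)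
  have ci: "integrable M (c m)" for m
    by (rule integrable_const_bound[where B = "real m"]) (use cb in auto)
  have "(\<lambda>m. \<integral>x. \<bar>h x - c m x\<bar> \<partial>M) \<longlonglongrightarrow> (\<integral>x. 0 \<partial>M)"
  proof (rule integral_dominated_convergence[where w = "\<lambda>x. \<bar>h x\<bar>"])
    show "AE x in M. (\<lambda>m. \<bar>h x - c m x\<bar>) \<longlonglongrightarrow> 0"
    proof (rule AE_I2)
      fix x
      obtain m0 :: nat where "\<bar>h x\<bar> \<le> real m0" using real_arch_simple by blast
      then have "eventually (\<lambda>m. \<bar>h x - c m x\<bar> = 0) sequentially"
        by (intro eventually_sequentiallyI[of m0]) (auto simp: c_def)
      then show "(\<lambda>m. \<bar>h x - c m x\<bar>) \<longlonglongrightarrow> 0" by (rule tendsto_eventually)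
    qed
  qed (use h in \<open>auto simp: c_def\<close>)
  then have "eventually (\<lambda>m. (\<integral>x. \<bar>h x - c m x\<bar> \<partial>M) < \<delta> / 2) sequentially"
    using \<delta> by (intro order_tendstoD(2)[where y = 0]) auto
  then obtain m where m: "(\<integral>x. \<bar>h x - c m x\<bar> \<partial>M) < \<delta> / 2" using eventually_happens by force
  define e where "e x = \<bar>h x - c m x\<bar>" for x
  have ei: "integrable M e" unfolding e_def using h ci by simp
  let ?cob = "\<lambda>h x. h (act u x) * V u x - h x"
  have "(\<integral>x. \<bar>?cob h x - ?cob (c m) x\<bar> \<partial>M) \<le> (\<integral>x. e (act u x) * V u x + e x \<partial>M)"
  proof (rule integral_mono)
    show "integrable M (\<lambda>x. \<bar>?cob h x - ?cob (c m) x\<bar>)"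
      using push_integral(1)[OF u h] push_integral(1)[OF u ci] h ci by simp
    show "integrable M (\<lambda>x. e (act u x) * V u x + e x)" using push_integral(1)[OF u ei] ei by simp
    fix x
    have "?cob h x - ?cob (c m) x = (h (act u x) - c m (act u x)) * V u x - (h x - c m x)" by (simp add: algebra_simps)
    also have "\<bar>\<dots>\<bar> \<le> \<bar>(h (act u x) - c m (act u x)) * V u x\<bar> + \<bar>h x - c m x\<bar>" by (rule abs_triangle_ineq4)
    finally show "\<bar>?cob h x - ?cob (c m) x\<bar> \<le> e (act u x) * V u x + e x" by (simp add: e_def abs_mult)
  qed
  also have "\<dots> = 2 * integral\<^sup>L M e" using push_integral[OF u ei] ei by simp
  also have "\<dots> < \<delta>" using m by (simp add: e_def[abs_def])
  finally have "(\<integral>x. \<bar>?cob h x - ?cob (c m) x\<bar> \<partial>M) < \<delta>" .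
  moreover have "ratio_converges (?cob (c m))" by (rule ratio_converges_coboundary_bounded[OF u ci cb])
  moreover have "integrable M (?cob (c m))" using push_integral(1)[OF u ci] ci by simp
  ultimately show "\<exists>h'. integrable M h' \<and> ratio_converges h' \<and> (\<integral>x. \<bar>?cob h x - h' x\<bar> \<partial>M) < \<delta>" by blast
qed

end

section \<open>Ergodicity and functions of integral zero\<close>

lemma countable_discrete_heis: "countable (discrete_heis :: 'n::finite heis set)"
proof -
  have "(discrete_heis :: 'n heis set) \<subseteq> (\<Union>R::nat. hball heis_zero (real R))"
  proof
    fix p :: "'n heis" assume p: "p \<in> discrete_heis"
    obtain R :: nat where R: "sqrt (gauge2 p) \<le> real R" using real_arch_simple by blast
    have "(sqrt (gauge2 p))\<^sup>2 \<le> (real R)\<^sup>2" using R by (intro power_mono) auto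
    then show "p \<in> (\<Union>R::nat. hball heis_zero (real R))" using p by (auto simp: hball_def)
  qed
  then show ?thesis 
    by (rule countable_subset) (intro countable_UN[OF countableI_type] countable_finite finite_hball heis_zero_discrete)
qed

context heis_flow
begin

text \<open>Exhaustion: mass of the positive part is moved onto the negative part along \<open>act (\<gamma> i)\<close> as far as
  possible, one group element after the other. By ergodicity nothing is left over in the limit.\<close>
lemma ratio_converges_centered:
  assumes erg: "\<And>A. A \<in> sets M \<Longrightarrow> (\<And>g. g \<in> discrete_heis \<Longrightarrow> act g -` A \<inter> space M = A) \<Longrightarrow>
      emeasure M A = 0 \<or> emeasure M (space M - A) = 0"
    and f: "integrable M f" and f0: "integral\<^sup>L M f = 0"
  shows "ratio_converges f"
proof -
  define \<gamma> where "\<gamma> = from_nat_into (discrete_heis :: 'n heis set)"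
  have ne: "(discrete_heis :: 'n heis set) \<noteq> {}" using heis_zero_discrete by blast
  have \<gamma>: "\<gamma> i \<in> discrete_heis" for i unfolding \<gamma>_def by (rule from_nat_into[OF ne])
  have \<gamma>_onto: "\<exists>i. \<gamma> i = g" if "g \<in> discrete_heis" for g
    using from_nat_into_surj[OF countable_discrete_heis that] by (simp add: \<gamma>_def)
  \<comment> \<open>The mass to be moved from \<open>x\<close> to \<open>act (\<gamma> i) x\<close>:
    what is left at the source, limited by the room at the target. The factor \<open>V\<close> turns
    a density at the target into one at the source; the inverse factor in \<open>PQ\<close> reverts
    this.\<close>
  define mv where "mv i P x = min (fst P x) (snd P (act (\<gamma> i) x) * V (\<gamma> i) x)"
    for i and P :: "('x \<Rightarrow> real) \<times> ('x \<Rightarrow> real)" and x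
  define PQ where "PQ = rec_nat (\<lambda>x. max 0 (f x), \<lambda>x. max 0 (- f x))
    (\<lambda>i P. (\<lambda>x. fst P x - mv i P x, \<lambda>y. snd P y - mv i P (act (heis_inv (\<gamma> i)) y) * V (heis_inv (\<gamma> i)) y))"
  define p q m where "p i = fst (PQ i)" and "q i = snd (PQ i)" and "m i = mv i (PQ i)" for i
  have p0: "p 0 x = max 0 (f x)" and q0: "q 0 x = max 0 (- f x)" for x by (simp_all add: p_def q_def PQ_def)
  have pS: "p (Suc i) x = p i x - m i x" and qS: "q (Suc i) y = q i y - m i (act (heis_inv (\<gamma> i)) y) * V (heis_inv (\<gamma> i)) y"
    for i x y by (simp_all add: p_def q_def m_def PQ_def)
  have mi: "m i x = min (p i x) (q i (act (\<gamma> i) x) * V (\<gamma> i) x)" for i x by (simp add: m_def p_def q_def mv_def)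
  have inv: "integrable M (p i) \<and> integrable M (q i)" for i
  proof (induction i)
    case 0
    have "integrable M (\<lambda>x. max 0 (f x))" "integrable M (\<lambda>x. max 0 (- f x))" using f by (intro integrable_max; simp)+
    then show ?case by (simp add: p0[abs_def] q0[abs_def])
  next
    case (Suc i)
    have "integrable M (m i)" unfolding mi[abs_def] using Suc push_integral(1)[OF \<gamma>[of i]] by (intro integrable_min) auto
    then show ?case unfolding pS[abs_def] qS[abs_def]
      using Suc push_integral(1)[OF heis_inv_discrete[OF \<gamma>[of i]]] by auto
  qed
  then have pint [measurable]: "integrable M (p i)" and qint [measurable]: "integrable M (q i)" for i by auto
  have mint: "integrable M (m i)" for i
    unfolding mi[abs_def] using qint pint push_integral(1)[OF \<gamma>[of i]] by (intro integrable_min) auto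
  have m_back: "m i x * V (heis_inv (\<gamma> i)) (act (\<gamma> i) x) \<le> q i (act (\<gamma> i) x)" if x: "x \<in> space M" for i x
  proof -
    have "m i x * V (heis_inv (\<gamma> i)) (act (\<gamma> i) x) \<le> (q i (act (\<gamma> i) x) * V (\<gamma> i) x) * V (heis_inv (\<gamma> i)) (act (\<gamma> i) x)"
      by (intro mult_right_mono) (auto simp: mi)
    also have "\<dots> = q i (act (\<gamma> i) x)" using V_inv[OF \<gamma>[of i] x] by (simp add: mult.assoc mult.commute[of "V (\<gamma> i) x"])
    finally show ?thesis .
  qed
  have nn: "0 \<le> p i x \<and> 0 \<le> q i x" if "x \<in> space M" for i x using that
  proof (induction i arbitrary: x)
    case 0
    then show ?case by (simp add: p0 q0)
  next
    case (Suc i)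
    let ?x' = "act (heis_inv (\<gamma> i)) x"
    have "m i ?x' * V (heis_inv (\<gamma> i)) (act (\<gamma> i) ?x') \<le> q i (act (\<gamma> i) ?x')"
      by (rule m_back) (use Suc in simp)
    then show ?case using Suc \<gamma>[of i] by (simp add: pS qS mi)
  qed
  have mnn: "0 \<le> m i x" if "x \<in> space M" for i x
    using nn[OF that] nn[of "act (\<gamma> i) x" i] that by (simp add: mi)
  have pdec: "p (Suc i) x \<le> p i x" and qdec: "q (Suc i) x \<le> q i x" if x: "x \<in> space M" for i x
    using mnn[OF x] mnn[of "act (heis_inv (\<gamma> i)) x" i] x by (simp_all add: pS qS)
  have pdec': "p j x \<le> p i x" and qdec': "q j x \<le> q i x" if "x \<in> space M" "i \<le> j" for i j x
    using lift_Suc_antimono_le[of "\<lambda>i. p i x", OF pdec[OF that(1)] that(2)]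
      lift_Suc_antimono_le[of "\<lambda>i. q i x", OF qdec[OF that(1)] that(2)] by auto
  \<comment> \<open>The minimum defining the move is attained: either the source gives away all it
    has, or the target is filled.\<close>
  have emptied: "p (Suc i) x = 0 \<or> q (Suc i) (act (\<gamma> i) x) = 0" if x: "x \<in> space M" for i x
  proof (cases "m i x = p i x")
    case False
    then have "m i x = q i (act (\<gamma> i) x) * V (\<gamma> i) x" by (auto simp: mi min_def)
    then have "m i x * V (heis_inv (\<gamma> i)) (act (\<gamma> i) x) = q i (act (\<gamma> i) x)"
      using V_inv[OF \<gamma>[of i] x] by (simp add: mult.assoc mult.commute[of "V (\<gamma> i) x"])
    then show ?thesis using x \<gamma>[of i] by (simp add: qS)
  qed (simp add: pS)
  define pl ql where "pl x = lim (\<lambda>i. p i x)" and "ql x = lim (\<lambda>i. q i x)" for x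
  have plim: "(\<lambda>i. p i x) \<longlonglongrightarrow> pl x" and qlim: "(\<lambda>i. q i x) \<longlonglongrightarrow> ql x" if x: "x \<in> space M" for x
  proof -
    have "convergent (\<lambda>i. p i x)"
      by (rule decseq_convergent[of "\<lambda>i. p i x" 0]) (use pdec'[OF x] nn[OF x] in \<open>auto simp: decseq_def convergent_def\<close>)
    then show "(\<lambda>i. p i x) \<longlonglongrightarrow> pl x" unfolding pl_def by (simp add: convergent_LIMSEQ_iff)
    have "convergent (\<lambda>i. q i x)"
      by (rule decseq_convergent[of "\<lambda>i. q i x" 0]) (use qdec'[OF x] nn[OF x] in \<open>auto simp: decseq_def convergent_def\<close>)
    then show "(\<lambda>i. q i x) \<longlonglongrightarrow> ql x" unfolding ql_def by (simp add: convergent_LIMSEQ_iff)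
  qed
  have le_p: "pl x \<le> p i x" "0 \<le> pl x" and le_q: "ql x \<le> q i x" "0 \<le> ql x" if x: "x \<in> space M" for i x
    using LIMSEQ_le_const2[OF plim[OF x], of "p i x"] LIMSEQ_le_const2[OF qlim[OF x], of "q i x"]
      LIMSEQ_le_const[OF plim[OF x], of 0] LIMSEQ_le_const[OF qlim[OF x], of 0] pdec'[OF x] qdec'[OF x] nn[OF x] by blast+
  have [measurable]: "pl \<in> borel_measurable M" "ql \<in> borel_measurable M"
    using pint qint by (auto intro!: borel_measurable_LIMSEQ_real[of M p pl] borel_measurable_LIMSEQ_real[of M q ql] plim qlim)
  \<comment> \<open>Every group element is used at some stage, and \<open>p\<close> and
    \<open>q\<close> never increase. Positive mass left at one point of an orbit therefore excludes
    negative mass left anywhere on that orbit.\<close>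
  have disjoint: "ql (act g x) = 0" if x: "x \<in> space M" and g: "g \<in> discrete_heis" and pos: "0 < pl x" for g x
  proof -
    obtain i where i: "\<gamma> i = g" using \<gamma>_onto[OF g] by blast
    have "0 < p (Suc i) x" using le_p(1)[OF x, of "Suc i"] pos by linarith
    then have "q (Suc i) (act g x) = 0" using emptied[OF x, of i] i by auto
    then show ?thesis using le_q(1)[of "act g x" "Suc i"] le_q(2)[of "act g x"] x by simp
  qed
  \<comment> \<open>The union of the orbits on which positive mass is left. It is invariant: if it
    is null, then \<open>pl\<close> vanishes almost everywhere, and if it is conull,
    \<open>ql\<close> does.\<close>
  define U where "U = (\<Union>g\<in>discrete_heis. {x\<in>space M. 0 < pl (act g x)})"
  have Um: "U \<in> sets M" unfolding U_def by (intro sets.countable_UN'' countable_discrete_heis) measurable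
  have "emeasure M U = 0 \<or> emeasure M (space M - U) = 0"
  proof (rule erg[OF Um])
    fix g :: "'n heis" assume g: "g \<in> discrete_heis"
    show "act g -` U \<inter> space M = U"
    proof (intro set_eqI iffI)
      fix x assume "x \<in> act g -` U \<inter> space M"
      then obtain h where x: "x \<in> space M" and h: "h \<in> discrete_heis" "0 < pl (act h (act g x))" by (auto simp: U_def)
      then have "0 < pl (act (heis_mult h g) x)" using g by (simp add: act_mult)
      then show "x \<in> U" unfolding U_def using x h g heis_mult_discrete by blast
    next
      fix x assume "x \<in> U"
      then obtain h where x: "x \<in> space M" and h: "h \<in> discrete_heis" "0 < pl (act h x)" by (auto simp: U_def)
      have k: "heis_mult h (heis_inv g) \<in> discrete_heis" using h g by simp
      have "act (heis_mult h (heis_inv g)) (act g x) = act h x" using h g x by (simp add: act_mult)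
      then have "0 < pl (act (heis_mult h (heis_inv g)) (act g x))" using h by simp
      then have "act g x \<in> U" unfolding U_def by (intro UN_I[OF k]) (simp add: x)
      then show "x \<in> act g -` U \<inter> space M" using x by simp
    qed
  qed
  then have "(AE x in M. pl x = 0) \<or> (AE x in M. ql x = 0)"
  proof
    assume "emeasure M U = 0"
    then have "AE x in M. x \<notin> U" using Um by (intro AE_not_in) (simp add: null_sets_def)
    then have "AE x in M. pl x = 0"
    proof (rule AE_mp, intro AE_I2 impI)
      fix x assume x: "x \<in> space M" "x \<notin> U"
      then have "\<not> 0 < pl (act heis_zero x)" unfolding U_def using heis_zero_discrete by blast
      then show "pl x = 0" using le_p(2)[OF x(1)] x by (simp add: act_zero)
    qed
    then show ?thesis ..
  next
    assume "emeasure M (space M - U) = 0"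
    then have "AE x in M. x \<notin> space M - U" using Um by (intro AE_not_in) (simp add: null_sets_def)
    then have "AE x in M. ql x = 0"
    proof (rule AE_mp, intro AE_I2 impI)
      fix x assume x: "x \<in> space M" "x \<notin> space M - U"
      then obtain g where g: "g \<in> discrete_heis" "0 < pl (act g x)" by (auto simp: U_def)
      then show "ql x = 0" using disjoint[of "act g x" "heis_inv g"] x by simp
    qed
    then show ?thesis ..
  qed
  moreover have pconv: "(\<lambda>i. integral\<^sup>L M (p i)) \<longlonglongrightarrow> integral\<^sup>L M pl"
  proof (rule integral_dominated_convergence[where w = "p 0"])
    show "AE x in M. (\<lambda>i. p i x) \<longlonglongrightarrow> pl x" using plim by (intro AE_I2)
    show "AE x in M. norm (p i x) \<le> p 0 x" for i using nn pdec' by (intro AE_I2) auto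
  qed (use pint in auto)
  moreover have qconv: "(\<lambda>i. integral\<^sup>L M (q i)) \<longlonglongrightarrow> integral\<^sup>L M ql"
  proof (rule integral_dominated_convergence[where w = "q 0"])
    show "AE x in M. (\<lambda>i. q i x) \<longlonglongrightarrow> ql x" using qlim by (intro AE_I2)
    show "AE x in M. norm (q i x) \<le> q 0 x" for i using nn qdec' by (intro AE_I2) auto
  qed (use qint in auto)
  \<comment> \<open>Every move takes the same amount from both parts, and they start with equal
    integrals because \<open>f\<close> has integral zero. Hence both integrals tend to 0 as soon as
    one of the limits vanishes.\<close>
  moreover have pq: "integral\<^sup>L M (p i) = integral\<^sup>L M (q i)" for i
  proof (induction i)
    case 0
    have "integral\<^sup>L M (p 0) - integral\<^sup>L M (q 0) = (\<integral>x. p 0 x - q 0 x \<partial>M)" using pint qint by simp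
    also have "\<dots> = integral\<^sup>L M f" by (intro Bochner_Integration.integral_cong) (auto simp: p0 q0)
    finally show ?case using f0 by simp
  next
    case (Suc i)
    have "integral\<^sup>L M (p (Suc i)) = integral\<^sup>L M (p i) - integral\<^sup>L M (m i)"
      unfolding pS[abs_def] using pint mint by simp
    moreover have "integral\<^sup>L M (q (Suc i)) = integral\<^sup>L M (q i) - integral\<^sup>L M (m i)"
      unfolding qS[abs_def] using qint push_integral[OF heis_inv_discrete[OF \<gamma>[of i]] mint[of i]] by simp
    ultimately show ?case using Suc by simp
  qed
  ultimately have pto0: "(\<lambda>i. integral\<^sup>L M (p i)) \<longlonglongrightarrow> 0"
  proof (elim disjE)
    assume "AE x in M. pl x = 0"
    then have "integral\<^sup>L M pl = 0" by (rule integral_eq_zero_AE)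
    then show ?thesis using pconv by simp
  next
    assume "AE x in M. ql x = 0"
    then have "integral\<^sup>L M ql = 0" by (rule integral_eq_zero_AE)
    then show ?thesis using qconv pq by simp
  qed
  \<comment> \<open>The i-th move changes p - q by a coboundary of \<open>m i\<close> along the
    inverse of \<open>\<gamma> i\<close>, so the part already transported is a finite sum of
    coboundaries.\<close>
  have approx: "ratio_converges (\<lambda>x. f x - (p i x - q i x))" for i
  proof (induction i)
    case 0
    have "(\<lambda>x. f x - (p 0 x - q 0 x)) = (\<lambda>_. 0)" by (auto simp: p0 q0 fun_eq_iff)
    then show ?case by (simp add: ratio_converges_const)
  next
    case (Suc i)
    let ?g = "heis_inv (\<gamma> i)"
    have g: "?g \<in> discrete_heis" using \<gamma> by simp
    have nint: "integrable M (\<lambda>x. - m i x)" using mint by simp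
    have cob: "ratio_converges (\<lambda>x. (- m i (act ?g x)) * V ?g x - (- m i x))"
      by (rule ratio_converges_coboundary[OF g nint])
    have cint: "integrable M (\<lambda>x. (- m i (act ?g x)) * V ?g x - (- m i x))"
      using push_integral(1)[OF g nint] nint by (intro Bochner_Integration.integrable_diff)
    have "ratio_converges (\<lambda>x. (f x - (p i x - q i x)) + ((- m i (act ?g x)) * V ?g x - (- m i x)))"
      by (rule ratio_converges_add[OF Suc cob _ cint]) (use f pint qint in simp)
    moreover have "(\<lambda>x. (f x - (p i x - q i x)) + ((- m i (act ?g x)) * V ?g x - (- m i x)))
        = (\<lambda>x. f x - (p (Suc i) x - q (Suc i) x))"
      by (simp add: pS qS fun_eq_iff algebra_simps)
    ultimately show ?case by simp
  qed
  show ?thesis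
  proof (rule ratio_converges_closed[OF f])
    fix \<delta> :: real assume "0 < \<delta>"
    then have "eventually (\<lambda>i. integral\<^sup>L M (p i) < \<delta> / 2) sequentially"
      using pto0 by (intro order_tendstoD(2)[where y = 0]) auto
    then obtain i where i: "integral\<^sup>L M (p i) < \<delta> / 2" using eventually_happens by force
    have "(\<integral>x. \<bar>f x - (f x - (p i x - q i x))\<bar> \<partial>M) \<le> (\<integral>x. p i x + q i x \<partial>M)"
    proof (rule integral_mono)
      show "integrable M (\<lambda>x. \<bar>f x - (f x - (p i x - q i x))\<bar>)" using f pint qint by simp
      show "integrable M (\<lambda>x. p i x + q i x)" using pint qint by simp
      show "\<bar>f x - (f x - (p i x - q i x))\<bar> \<le> p i x + q i x" if "x \<in> space M" for x using nn[OF that, of i] by (simp add: abs_le_iff)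
    qed
    also have "\<dots> < \<delta>" using i pq[of i] pint qint by simp
    finally have "(\<integral>x. \<bar>f x - (f x - (p i x - q i x))\<bar> \<partial>M) < \<delta>" .
    then show "\<exists>h. integrable M h \<and> ratio_converges h \<and> (\<integral>x. \<bar>f x - h x\<bar> \<partial>M) < \<delta>"
      using approx[of i] f pint qint by (intro exI[of _ "\<lambda>x. f x - (p i x - q i x)"]) simp
  qed
qed

lemma ratio_theorem:
  assumes erg: "\<And>A. A \<in> sets M \<Longrightarrow> (\<And>g. g \<in> discrete_heis \<Longrightarrow> act g -` A \<inter> space M = A) \<Longrightarrow>
      emeasure M A = 0 \<or> emeasure M (space M - A) = 0"
    and f: "integrable M f"
  shows "ratio_converges f"
proof -
  let ?c = "integral\<^sup>L M f"
  have "ratio_converges (\<lambda>x. f x - ?c)"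
    by (rule ratio_converges_centered[OF erg]) (use f in \<open>auto simp: prob_space\<close>)
  from ratio_converges_add[OF this ratio_converges_const[of ?c]] show ?thesis using f by simp
qed

end

section \<open>The cocycle of Radon-Nikodym derivatives\<close>

lemma nonsingular_heis_actionD:
  fixes act :: "'n::finite heis \<Rightarrow> 'x \<Rightarrow> 'x"
  assumes "nonsingular_heis_action M act" "g \<in> discrete_heis"
  shows "act g \<in> M \<rightarrow>\<^sub>M M" "\<And>x. x \<in> space M \<Longrightarrow> act heis_zero x = x"
    "\<And>h x. h \<in> discrete_heis \<Longrightarrow> x \<in> space M \<Longrightarrow> act (heis_mult g h) x = act g (act h x)"
    "\<And>A. A \<in> sets M \<Longrightarrow> emeasure M (act g ` A) = 0 \<longleftrightarrow> emeasure M A = 0"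
    "\<And>x. x \<in> space M \<Longrightarrow> act (heis_inv g) (act g x) = x"
    "\<And>x. x \<in> space M \<Longrightarrow> act g (act (heis_inv g) x) = x"
    "\<And>x. x \<in> space M \<Longrightarrow> act g x \<in> space M"
proof -
  note * = assms(1)[unfolded nonsingular_heis_action_def]
  show m: "act g \<in> M \<rightarrow>\<^sub>M M" using * assms(2) by blast
  show z: "\<And>x. x \<in> space M \<Longrightarrow> act heis_zero x = x" using * by blast
  have mult: "act (heis_mult a b) x = act a (act b x)"
    if "a \<in> discrete_heis" "b \<in> discrete_heis" "x \<in> space M" for a b x
    using * that by blast
  then show "\<And>h x. h \<in> discrete_heis \<Longrightarrow> x \<in> space M \<Longrightarrow> act (heis_mult g h) x = act g (act h x)"
    using assms(2) by blast
  show "\<And>A. A \<in> sets M \<Longrightarrow> emeasure M (act g ` A) = 0 \<longleftrightarrow> emeasure M A = 0" using * assms(2) by blast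
  show "act (heis_inv g) (act g x) = x" "act g (act (heis_inv g) x) = x" if "x \<in> space M" for x
    using mult[of "heis_inv g" g x] mult[of g "heis_inv g" x] z[OF that] assms(2) that by simp_all
  show "\<And>x. x \<in> space M \<Longrightarrow> act g x \<in> space M" using m by (rule measurable_space)
qed

context
  fixes M :: "'x measure" and act :: "'n::finite heis \<Rightarrow> 'x \<Rightarrow> 'x"
  assumes prob: "prob_space M" and ns: "nonsingular_heis_action M act"
begin

interpretation prob_space M by (rule prob)

lemmas actD = nonsingular_heis_actionD[OF ns]

lemma heis_omega_measurable [measurable]: "heis_omega M act g \<in> borel_measurable M"
  unfolding heis_omega_def[abs_def] by measurable

text \<open>Change of variables for the measure of images under \<open>g\<close>. Preimages under
  the inverse are images under \<open>g\<close>, so nonsingularity gives absolute continuity; the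
  derivative of a finite measure is finite almost everywhere, so \<open>enn2real\<close> loses
  nothing.\<close>

lemma heis_omega_change:
  assumes g: "g \<in> discrete_heis" and \<phi> [measurable]: "\<phi> \<in> borel_measurable M"
  shows "(\<integral>\<^sup>+x. \<phi> (act g x) * ennreal (heis_omega M act g x) \<partial>M) = (\<integral>\<^sup>+x. \<phi> x \<partial>M)"
proof -
  note gi = heis_inv_discrete[OF g]
  note [measurable] = actD(1)[OF g] actD(1)[OF gi]
  define K where "K = distr M M (act (heis_inv g))"
  have ac: "absolutely_continuous M K"
    unfolding absolutely_continuous_def
  proof
    fix A assume A: "A \<in> null_sets M"
    then have As: "A \<in> sets M" by auto
    have "act (heis_inv g) -` A \<inter> space M = act g ` A"
    proof (intro set_eqI iffI)
      fix x assume "x \<in> act (heis_inv g) -` A \<inter> space M"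
      then show "x \<in> act g ` A" using actD(6)[OF g, of x] by (metis IntD1 IntD2 imageI vimageD)
    next
      fix x assume "x \<in> act g ` A"
      then show "x \<in> act (heis_inv g) -` A \<inter> space M"
        using actD(5,7)[OF g] sets.sets_into_space[OF As] by auto
    qed
    then show "A \<in> null_sets K"
      using A actD(4)[OF g As] As by (simp add: K_def emeasure_distr null_sets_def)
  qed
  have dens: "density M (RN_deriv M K) = K" by (rule density_RN_deriv[OF ac]) (simp add: K_def)
  interpret K: prob_space K unfolding K_def by (rule prob_space_distr) measurable
  have fin: "AE x in M. RN_deriv M K x \<noteq> \<infinity>"
    by (rule RN_deriv_finite[OF _ ac]) (auto simp: K_def K.sigma_finite_measure_axioms[unfolded K_def])
  have "(\<integral>\<^sup>+x. \<phi> (act g x) * ennreal (heis_omega M act g x) \<partial>M) = (\<integral>\<^sup>+x. RN_deriv M K x * \<phi> (act g x) \<partial>M)"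
    using fin by (intro nn_integral_cong_AE) (auto simp: heis_omega_def K_def less_top mult.commute elim!: eventually_mono)
  also have "\<dots> = (\<integral>\<^sup>+x. \<phi> (act g x) \<partial>density M (RN_deriv M K))" by (rule nn_integral_density[symmetric]) measurable
  also have "\<dots> = (\<integral>\<^sup>+x. \<phi> (act g x) \<partial>K)" by (simp only: dens)
  also have "\<dots> = (\<integral>\<^sup>+x. \<phi> (act g (act (heis_inv g) x)) \<partial>M)" unfolding K_def by (rule nn_integral_distr) measurable
  also have "\<dots> = (\<integral>\<^sup>+x. \<phi> x \<partial>M)" by (intro nn_integral_cong) (simp add: actD(6)[OF g])
  finally show ?thesis .
qed

lemma heis_omega_zero: "AE x in M. heis_omega M act heis_zero x = 1"
proof -
  have "AE x in M. ennreal (heis_omega M act heis_zero x) = 1"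
  proof (rule density_unique_finite_measure)
    fix A assume A [measurable]: "A \<in> sets M"
    have "(\<integral>\<^sup>+x. ennreal (heis_omega M act heis_zero x) * indicator A x \<partial>M)
        = (\<integral>\<^sup>+x. indicator A (act heis_zero x) * ennreal (heis_omega M act heis_zero x) \<partial>M)"
      by (intro nn_integral_cong) (simp add: actD(2)[OF heis_zero_discrete] mult.commute)
    also have "\<dots> = (\<integral>\<^sup>+x. indicator A x \<partial>M)" by (rule heis_omega_change) auto
    finally show "(\<integral>\<^sup>+x. ennreal (heis_omega M act heis_zero x) * indicator A x \<partial>M) = (\<integral>\<^sup>+x. 1 * indicator A x \<partial>M)"
      by simp
  qed auto
  then show ?thesis by eventually_elim simp
qed

lemma heis_omega_nonneg: "0 \<le> heis_omega M act g x"
  by (simp add: heis_omega_def)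

text \<open>Both sides are densities of the same measure. To see this, a test set is carried along
  by the inverse of the product, so that the change of variables can be applied once for the product
  and once for each factor.\<close>

lemma heis_omega_mult:
  assumes g: "g \<in> discrete_heis" and h: "h \<in> discrete_heis"
  shows "AE x in M. heis_omega M act (heis_mult g h) x = heis_omega M act g (act h x) * heis_omega M act h x"
proof -
  let ?w = "heis_omega M act"
  note gh = heis_mult_discrete[OF g h]
  note [measurable] = actD(1)[OF g] actD(1)[OF h] actD(1)[OF gh] actD(1)[OF heis_inv_discrete[OF gh]] actD(1)[OF heis_inv_discrete[OF h]]
  have "AE x in M. ennreal (?w (heis_mult g h) x) = ennreal (?w g (act h x) * ?w h x)"
  proof (rule density_unique_finite_measure)
    fix A assume A [measurable]: "A \<in> sets M"
    define \<phi> where "\<phi> y = (indicator A (act (heis_inv (heis_mult g h)) y) :: ennreal)" for y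
    have [measurable]: "\<phi> \<in> borel_measurable M" unfolding \<phi>_def by measurable
    have \<phi>: "\<phi> (act (heis_mult g h) x) = indicator A x" "\<phi> (act g (act h x)) = indicator A x" if "x \<in> space M" for x
      using that actD(5)[OF gh that] actD(3)[OF g h that] by (simp_all add: \<phi>_def)
    have "(\<integral>\<^sup>+x. ennreal (?w (heis_mult g h) x) * indicator A x \<partial>M)
        = (\<integral>\<^sup>+x. \<phi> (act (heis_mult g h) x) * ennreal (?w (heis_mult g h) x) \<partial>M)"
      by (intro nn_integral_cong) (simp add: \<phi> mult.commute)
    also have "\<dots> = (\<integral>\<^sup>+x. \<phi> x \<partial>M)" by (rule heis_omega_change[OF gh]) measurable
    also have "\<dots> = (\<integral>\<^sup>+x. \<phi> (act g x) * ennreal (?w g x) \<partial>M)" by (rule heis_omega_change[OF g, symmetric]) measurable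
    also have "\<dots> = (\<integral>\<^sup>+x. (\<phi> (act g (act h x)) * ennreal (?w g (act h x))) * ennreal (?w h x) \<partial>M)"
      by (rule heis_omega_change[OF h, symmetric]) measurable
    also have "\<dots> = (\<integral>\<^sup>+x. ennreal (?w g (act h x) * ?w h x) * indicator A x \<partial>M)"
      by (intro nn_integral_cong) (simp add: \<phi> ennreal_mult heis_omega_nonneg mult_ac)
    finally show "(\<integral>\<^sup>+x. ennreal (?w (heis_mult g h) x) * indicator A x \<partial>M)
        = (\<integral>\<^sup>+x. ennreal (?w g (act h x) * ?w h x) * indicator A x \<partial>M)" .
  qed auto
  then show ?thesis by eventually_elim (simp add: heis_omega_nonneg)
qed

text \<open>The cocycle identity holds simultaneously for all pairs on an invariant conull set; off that set the
  cocycle is replaced by the constant \<open>1\<close>.\<close>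
lemma heis_flow_exists:
  "\<exists>V. heis_flow M (\<lambda>g. if g \<in> discrete_heis then act g else (\<lambda>x. x)) V \<and>
     (AE x in M. \<forall>g\<in>discrete_heis. V g x = heis_omega M act g x)"
proof -
  let ?w = "heis_omega M act" and ?G = "discrete_heis :: 'n heis set"
  let ?act = "\<lambda>g. if g \<in> ?G then act g else (\<lambda>x. x)"
  define \<gamma> where "\<gamma> = from_nat_into ?G"
  have "?G \<noteq> {}" using heis_zero_discrete by blast
  then have \<gamma>: "\<gamma> i \<in> ?G" for i unfolding \<gamma>_def by (rule from_nat_into)
  have onto: "\<exists>i. \<gamma> i = g" if "g \<in> ?G" for g
    using from_nat_into_surj[OF countable_discrete_heis that] by (simp add: \<gamma>_def)
  have [measurable]: "act (\<gamma> i) \<in> M \<rightarrow>\<^sub>M M" for i by (rule actD(1)[OF \<gamma>])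
  define X where "X = {x\<in>space M. ?w heis_zero x = 1 \<and>
      (\<forall>i j. ?w (heis_mult (\<gamma> i) (\<gamma> j)) x = ?w (\<gamma> i) (act (\<gamma> j) x) * ?w (\<gamma> j) x)}"
  have [measurable]: "X \<in> sets M" unfolding X_def by measurable
  have AEX: "AE x in M. x \<in> X"
  proof -
    have "AE x in M. \<forall>i j. ?w (heis_mult (\<gamma> i) (\<gamma> j)) x = ?w (\<gamma> i) (act (\<gamma> j) x) * ?w (\<gamma> j) x"
      using heis_omega_mult[OF \<gamma> \<gamma>] by (simp add: AE_all_countable)
    with heis_omega_zero AE_space show ?thesis by eventually_elim (simp add: X_def)
  qed
  have Xs: "x \<in> space M" and X1: "?w heis_zero x = 1" if "x \<in> X" for x using that by (auto simp: X_def)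
  have X2: "?w (heis_mult g h) x = ?w g (act h x) * ?w h x" if "x \<in> X" "g \<in> ?G" "h \<in> ?G" for x g h
    using that onto[OF that(2)] onto[OF that(3)] by (auto simp: X_def)
  \<comment> \<open>The cocycle identity for the inverse of \<open>g\<close> and \<open>g\<close>
    expresses 1 as a product with the factor \<open>?w g x\<close>.\<close>
  have wpos: "0 < ?w g x" if "x \<in> X" "g \<in> ?G" for x g
    using X2[OF that(1) heis_inv_discrete[OF that(2)] that(2)] X1[OF that(1)] heis_omega_nonneg[of g x]
    by (metis heis_mult_inv(2) less_eq_real_def mult_zero_right zero_neq_one)
  \<comment> \<open>The identities at \<open>act h x\<close> follow from those at \<open>x\<close>
    by associativity, after cancelling the positive factor \<open>?w h x\<close>.\<close>
  have Xinv: "act h x \<in> X" if x: "x \<in> X" and h: "h \<in> ?G" for x h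
  proof -
    have "?w heis_zero (act h x) = 1" using X2[OF x heis_zero_discrete h] wpos[OF x h] by simp
    moreover have "?w (heis_mult a b) (act h x) = ?w a (act b (act h x)) * ?w b (act h x)"
      if a: "a \<in> ?G" and b: "b \<in> ?G" for a b
    proof -
      have "?w (heis_mult a b) (act h x) * ?w h x = ?w (heis_mult a (heis_mult b h)) x"
        using X2[OF x heis_mult_discrete[OF a b] h] by (simp add: heis_mult_assoc)
      also have "\<dots> = ?w a (act b (act h x)) * ?w b (act h x) * ?w h x"
        using X2[OF x a heis_mult_discrete[OF b h]] X2[OF x b h] actD(3)[OF b h Xs[OF x]] by simp
      finally show ?thesis using wpos[OF x h] by simp
    qed
    ultimately show ?thesis using actD(7)[OF h Xs[OF x]] \<gamma> by (simp add: X_def)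
  qed
  define V where "V g x = (if g \<in> ?G \<and> x \<in> X then ?w g x else 1)" for g x
  have "heis_flow M ?act V"
  proof (unfold_locales)
    show "?act g \<in> M \<rightarrow>\<^sub>M M" for g using actD(1)[of g] by simp
    show "?act heis_zero x = x" if "x \<in> space M" for x using actD(2)[OF heis_zero_discrete that] by simp
    show "?act (heis_mult g h) x = ?act g (?act h x)" if "g \<in> ?G" "h \<in> ?G" "x \<in> space M" for g h x
      using actD(3)[OF that] that by simp
    show "V g \<in> borel_measurable M" for g
      by (cases "g \<in> ?G") (simp_all add: V_def[abs_def])
    show "0 < V g x" for g x by (simp add: V_def wpos)
    show "V (heis_mult g h) x = V g (?act h x) * V h x" if g: "g \<in> ?G" and h: "h \<in> ?G" and x: "x \<in> space M" for g h x
    proof (cases "x \<in> X")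
      case True
      then show ?thesis using g h X2[OF True g h] Xinv[OF True h] by (simp add: V_def)
    next
      case False
      have "act h x \<notin> X" using Xinv[OF _ heis_inv_discrete[OF h], of "act h x"] actD(5)[OF h x] False by auto
      then show ?thesis using g h False by (simp add: V_def)
    qed
    show "(\<integral>\<^sup>+x. \<phi> (?act g x) * ennreal (V g x) \<partial>M) = (\<integral>\<^sup>+x. \<phi> x \<partial>M)"
      if g: "g \<in> ?G" and \<phi>: "\<phi> \<in> borel_measurable M" for g \<phi>
    proof -
      have "(\<integral>\<^sup>+x. \<phi> (?act g x) * ennreal (V g x) \<partial>M) = (\<integral>\<^sup>+x. \<phi> (act g x) * ennreal (?w g x) \<partial>M)"
        using AEX g by (intro nn_integral_cong_AE) (auto simp: V_def elim!: eventually_mono)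
      also have "\<dots> = (\<integral>\<^sup>+x. \<phi> x \<partial>M)" by (rule heis_omega_change[OF g \<phi>])
      finally show ?thesis .
    qed
  qed
  moreover have "AE x in M. \<forall>g\<in>?G. V g x = ?w g x" using AEX by eventually_elim (simp add: V_def)
  ultimately show ?thesis by blast
qed

end

theorem theorem1:
  fixes M :: "'x measure" and act :: "'n::finite heis \<Rightarrow> 'x \<Rightarrow> 'x" and f :: "'x \<Rightarrow> real"
  assumes "prob_space M" and "standard_borel_space M"
    and "nonsingular_heis_action M act" and "ergodic_heis_action M act"
    and "integrable M f"
  shows "AE x in M. ((\<lambda>k. (\<Sum>g\<in>heis_ball k. heis_hat M act g f x) /
                           (\<Sum>g\<in>heis_ball k. heis_hat M act g (\<lambda>_. 1) x))
                     \<longlongrightarrow> integral\<^sup>L M f) sequentially"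
proof -
  let ?act = "\<lambda>g. if g \<in> discrete_heis then act g else (\<lambda>x. x)"
  obtain V where V: "heis_flow M ?act V" and eq: "AE x in M. \<forall>g\<in>discrete_heis. V g x = heis_omega M act g x"
    using heis_flow_exists[OF assms(1,3)] by blast
  interpret heis_flow M ?act V by (rule V)
  have "ratio_converges f"
  proof (rule ratio_theorem[OF _ assms(5)])
    fix A assume A: "A \<in> sets M" and inv: "\<And>g. g \<in> discrete_heis \<Longrightarrow> ?act g -` A \<inter> space M = A"
    then have "\<forall>g\<in>discrete_heis. act g -` A \<inter> space M = A" by auto
    then show "emeasure M A = 0 \<or> emeasure M (space M - A) = 0"
      using assms(4) A unfolding ergodic_heis_action_def by blast
  qed
  with eq show ?thesis
    unfolding ratio_converges_def
  proof eventually_elim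
    case (elim x)
    have "ratio k f x = (\<Sum>g\<in>heis_ball k. heis_hat M act g f x) / (\<Sum>g\<in>heis_ball k. heis_hat M act g (\<lambda>_. 1) x)" for k
      unfolding ratio_def heis_ball_eq heis_hat_def
      using elim(1) by (intro arg_cong2[of _ _ _ _ "(/)"] sum.cong refl) (auto simp: hball_def)
    with elim(2) show ?case by simp
  qed
qed

end
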